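(* Let $T$ be a tournament on $n$ vertices and let $k,m,t\in \mathbb{N}$ with $m\geq t\geq 2$. If $T$ is strongly $10^7k^6t^2m\log (ktm)$-connected, then $V(T)$ contains $t$ pairwise disjoint vertex sets $V_1,\dots, V_t$ such that for every $j\in \{1,\dots, t\}$: (i) $|V_j|\leq n/m$, and (ii) for any set $R\subseteq V(T)\setminus \bigcup_{i=1}^t V_i$ the subtournament $T[V_j\cup R]$ is strongly $k$-connected.
   Context: A tournament is an orientation of a complete graph. A tournament is strongly connected if for every ordered pair of vertices $u,v$ there is a directed path from $u$ to $v$. For $k\in\mathbb{N}$, a tournament $T$ is strongly $k$-connected if $|V(T)|>k$ and the removal of any set of fewer than $k$ vertices results in a strongly connected tournament. $T[U]$ denotes the subtournament induced by $U\subseteq V(T)$. Here $\log$ denotes $\log_2$. *)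

theory Defs
  imports Complex_Main
begin

definition tournament :: "'a set \<Rightarrow> ('a \<Rightarrow> 'a \<Rightarrow> bool) \<Rightarrow> bool" where
  "tournament V E \<longleftrightarrow> finite V \<and> (\<forall>u\<in>V. \<not> E u u) \<and>
     (\<forall>u\<in>V. \<forall>v\<in>V. u \<noteq> v \<longrightarrow> (E u v \<longleftrightarrow> \<not> E v u))"

definition strongly_connected :: "'a set \<Rightarrow> ('a \<Rightarrow> 'a \<Rightarrow> bool) \<Rightarrow> bool" where
  "strongly_connected U E \<longleftrightarrow>
     (\<forall>u\<in>U. \<forall>v\<in>U. (\<lambda>x y. x \<in> U \<and> y \<in> U \<and> E x y)\<^sup>*\<^sup>* u v)"

definition strongly_k_connected :: "'a set \<Rightarrow> ('a \<Rightarrow> 'a \<Rightarrow> bool) \<Rightarrow> nat \<Rightarrow> bool" where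
  "strongly_k_connected U E k \<longleftrightarrow> card U > k \<and>
     (\<forall>S\<subseteq>U. card S < k \<longrightarrow> strongly_connected (U - S) E)"

end

theory Submission
  imports Defs "HOL-Library.Disjoint_Sets"
begin

text \<open>Take the vertices of smallest in-degree. Each of them lies in a small set \<open>A\<close> that dominates
  all but a tiny fraction of the tournament and is dominated by one of its own vertices \<open>a\<close>; dually,
  take almost in-dominating sets at vertices of small out-degree. If \<open>V\<^sub>j\<close> contains \<open>k\<close> disjoint
  in-dominating sets, each joined by a path to an out-dominating set, then after deleting fewer than
  \<open>k\<close> vertices one of these triples survives and connects everything that is not exceptional, that
  is, dominated by the out-dominating sets and dominating the in-dominating ones.
  An exceptional vertex needs \<open>k\<close> in-neighbours (or out-neighbours) that are already reached. They
  exist, because an exceptional vertex does not have the smallest in-degree, whereas the exceptional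
  sets are small compared with that degree.

  The paths need not join prescribed pairs, so Menger's theorem suffices. Each hub offers \<open>r\<close>
  ports; among the resulting paths many are short, and we keep \<open>k * t\<close> of them that use distinct
  hubs and do not meet the vertices reserved for each other. Each hub has \<open>k\<close> extra vertices
  \<open>N\<close> in front of \<open>a\<close>, and a path stops when it first sees one of them, so that all its earlier
  vertices are dominated by the whole of \<open>N\<close>. The remaining exceptional vertices are finally
  distributed among the \<open>V\<^sub>j\<close>.\<close>

section \<open>Menger's theorem\<close>

text \<open>The bound comes from the reservations. Each exceptional vertex drags up to
  \<open>2 * k\<close> further ones into a class, so the exceptional sets may occupy only a fraction
  of order \<open>1 / (k * m)\<close> of \<open>V\<close>. With \<open>G = 10 * k * t\<close> hubs
  of each kind this takes about \<open>2 * log 2 (k * t * m)\<close> vertices per dominating set;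
  together with the \<open>k\<close> vertices of \<open>N\<close> a hub has
  \<open>s \<le> 10 * k * log 2 (k * t * m)\<close> vertices. Neighbours for the ends of all
  \<open>G * r\<close> paths must be reserved before it is known which paths survive, and
  \<open>r\<close> is of order \<open>k ^ 2 * m\<close>: besides absorbing the conflicts it makes
  the paths short enough for the size bound \<open>n / m\<close>. This costs order
  \<open>k ^ 5 * t * m\<close>, while the exceptional sets cost order
  \<open>k ^ 3 * t ^ 2 * m * s\<close>. The common multiple \<open>k ^ 5 * t ^ 2 * m * s\<close> and
  the bound on \<open>s\<close> give \<open>k ^ 6 * t ^ 2 * m * log 2 (k * t * m)\<close>.\<close>

definition walk :: "('a \<times> 'a) set \<Rightarrow> 'a list \<Rightarrow> bool" where
  "walk F xs \<longleftrightarrow> xs \<noteq> [] \<and> successively (\<lambda>x y. (x, y) \<in> F) xs"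

text \<open>A separator may use vertices of \<open>X\<close> and \<open>Y\<close>, and one-vertex
  walks count, so every separator contains \<open>X \<inter> Y\<close>. This is what settles the
  edgeless case of Menger's theorem.\<close>

definition separates :: "('a \<times> 'a) set \<Rightarrow> 'a set \<Rightarrow> 'a set \<Rightarrow> 'a set \<Rightarrow> bool" where
  "separates F X Y S \<longleftrightarrow>
     (\<forall>xs. walk F xs \<longrightarrow> hd xs \<in> X \<longrightarrow> last xs \<in> Y \<longrightarrow> set xs \<inter> S \<noteq> {})"

lemma walk_append:
  "xs \<noteq> [] \<Longrightarrow> ys \<noteq> [] \<Longrightarrow>
   walk F (xs @ ys) \<longleftrightarrow> walk F xs \<and> walk F ys \<and> (last xs, hd ys) \<in> F"
  by (auto simp: walk_def successively_append_iff)

lemma walk_join: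
  assumes "walk F xs" "walk F ys" "last xs = hd ys"
  shows "walk F (xs @ tl ys)" "hd (xs @ tl ys) = hd xs" "last (xs @ tl ys) = last ys"
    "set (xs @ tl ys) = set xs \<union> set ys"
proof -
  from assms obtain y zs where ys: "ys = y # zs" by (cases ys) (auto simp: walk_def)
  have xs: "xs \<noteq> []" using assms by (simp add: walk_def)
  show "walk F (xs @ tl ys)"
    using assms xs ys by (cases zs) (auto simp: walk_def successively_append_iff)
  show "hd (xs @ tl ys) = hd xs" using xs by simp
  show "last (xs @ tl ys) = last ys" using assms(3) xs ys by (cases zs) auto
  have "y \<in> set xs" using assms(3) xs ys by (metis last_in_set list.sel(1))
  then show "set (xs @ tl ys) = set xs \<union> set ys" using ys by auto
qed

lemma walk_mono: "walk F xs \<Longrightarrow> F \<subseteq> F' \<Longrightarrow> walk F' xs"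
  unfolding walk_def using successively_mono[of "\<lambda>x y. (x, y) \<in> F" xs "\<lambda>x y. (x, y) \<in> F'"] by blast

text \<open>Serves to discard the deleted edge: a walk stopped at its first visit to
  \<open>x\<close> never leaves \<open>x\<close>.\<close>

lemma walk_avoid_fst:
  "walk (insert (x, y) F) xs \<Longrightarrow> x \<notin> set (butlast xs) \<Longrightarrow> walk F xs"
  unfolding walk_def
  by (induction xs rule: induct_list012) auto

lemma walk_avoid_snd:
  "walk (insert (x, y) F) xs \<Longrightarrow> y \<notin> set (tl xs) \<Longrightarrow> walk F xs"
  unfolding walk_def
  by (induction xs rule: induct_list012) (auto simp: successively_Cons)

lemma walk_prefix:
  assumes "walk F xs" "v \<in> set xs" "v \<in> T"
  obtains ys where "walk F ys" "hd ys = hd xs" "last ys \<in> T" "set (butlast ys) \<inter> T = {}"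
    "set ys \<subseteq> set xs"
proof -
  from assms obtain ps y qs where xs: "xs = ps @ y # qs" "y \<in> T" "\<forall>z\<in>set ps. z \<notin> T"
    using split_list_first_prop[of xs "\<lambda>z. z \<in> T"] by blast
  have "walk F (ps @ [y])"
    using assms(1) xs(1) by (auto simp: walk_def successively_append_iff successively_Cons)
  moreover have "hd (ps @ [y]) = hd xs" using xs by (cases ps) auto
  ultimately show thesis by (rule that) (use xs in auto)
qed

lemma walk_suffix:
  assumes "walk F xs" "v \<in> set xs" "v \<in> T"
  obtains ys where "walk F ys" "last ys = last xs" "hd ys \<in> T" "set (tl ys) \<inter> T = {}"
    "set ys \<subseteq> set xs"
proof -
  from assms obtain ps y qs where xs: "xs = ps @ y # qs" "y \<in> T" "\<forall>z\<in>set qs. z \<notin> T"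
    using split_list_last_prop[of xs "\<lambda>z. z \<in> T"] by blast
  have "walk F (y # qs)"
    using assms(1) xs(1) by (simp add: walk_def successively_append_iff)
  then show thesis by (rule that) (use xs in auto)
qed

lemma hd_tl_set: "v \<in> set xs \<Longrightarrow> v = hd xs \<or> v \<in> set (tl xs)"
  by (cases xs) auto

lemma last_butlast_set: "v \<in> set xs \<Longrightarrow> v = last xs \<or> v \<in> set (butlast xs)"
  by (induction xs) auto

text \<open>Induction on the edge set. If deleting the edge \<open>(x, y)\<close> leaves a separator
  \<open>S\<close> with fewer than \<open>N\<close> vertices, then \<open>insert x S\<close> and
  \<open>insert y S\<close> separate in the full graph and have exactly \<open>N\<close> vertices.
  The induction hypothesis links \<open>X\<close> to the former and the latter to \<open>Y\<close>;
  the two families are glued along \<open>S\<close> and the deleted edge.\<close>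

lemma Menger:
  assumes "finite F" "finite X"
    and "\<And>S. finite S \<Longrightarrow> separates F X Y S \<Longrightarrow> N \<le> card S"
  shows "\<exists>P. (\<forall>i<N. walk F (P i) \<and> hd (P i) \<in> X \<and> last (P i) \<in> Y) \<and>
    disjoint_family_on (\<lambda>i. set (P i)) {..<N}"
  using assms
proof (induction F arbitrary: X Y rule: finite_induct)
  case empty
  have "separates {} X Y (X \<inter> Y)"
    unfolding separates_def
  proof (intro allI impI)
    fix xs assume *: "walk {} xs" "hd xs \<in> X" "last xs \<in> Y"
    then obtain v where "xs = [v]"
      unfolding walk_def by (cases xs; cases "tl xs") (auto simp: successively_Cons)
    then show "set xs \<inter> (X \<inter> Y) \<noteq> {}" using * by auto
  qed
  then have "N \<le> card (X \<inter> Y)" using empty by auto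
  then obtain T where T: "T \<subseteq> X \<inter> Y" "card T = N" by (meson obtain_subset_with_card_n)
  then have "finite T" using empty finite_subset by blast
  then obtain h where h: "bij_betw h {..<N} T" using T ex_bij_betw_nat_finite[of T] by (auto simp: atLeast0LessThan)
  show ?case
  proof (intro exI[of _ "\<lambda>i. [h i]"] conjI allI impI)
    show "disjoint_family_on (\<lambda>i. set [h i]) {..<N}"
      using h by (auto simp: disjoint_family_on_def bij_betw_def inj_on_def)
  qed (use h T in \<open>auto simp: walk_def bij_betw_def\<close>)
next
  case (insert e F)
  obtain x y where e: "e = (x, y)" by force
  show ?case
  proof (cases "\<forall>S. finite S \<longrightarrow> separates F X Y S \<longrightarrow> N \<le> card S")
    case True
    then obtain P where "\<forall>i<N. walk F (P i) \<and> hd (P i) \<in> X \<and> last (P i) \<in> Y"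
      "disjoint_family_on (\<lambda>i. set (P i)) {..<N}"
      using insert.IH[of X Y] insert.prems by auto
    then show ?thesis by (meson walk_mono subset_insertI)
  next
    case False
    then obtain S where S: "finite S" "separates F X Y S" "card S < N" by force
    have sepx: "separates (insert e F) X Y (insert x S)"
      unfolding separates_def
    proof (intro allI impI)
      fix xs assume xs: "walk (insert e F) xs" "hd xs \<in> X" "last xs \<in> Y"
      show "set xs \<inter> insert x S \<noteq> {}"
      proof (cases "x \<in> set xs")
        case False
        then have "walk F xs" using xs(1) walk_avoid_fst[of x y F xs] e in_set_butlastD by metis
        then show ?thesis using S(2) xs unfolding separates_def by blast
      qed auto
    qed
    have sepy: "separates (insert e F) X Y (insert y S)"
      unfolding separates_def
    proof (intro allI impI)
      fix xs assume xs: "walk (insert e F) xs" "hd xs \<in> X" "last xs \<in> Y"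
      show "set xs \<inter> insert y S \<noteq> {}"
      proof (cases "y \<in> set xs")
        case False
        then have "walk F xs" using xs(1) walk_avoid_snd[of x y F xs] e
          by (metis list.set_sel(2) tl_Nil)
        then show ?thesis using S(2) xs unfolding separates_def by blast
      qed auto
    qed
    have card: "card (insert x S) = N" "card (insert y S) = N" "x \<notin> S" "y \<notin> S"
      using insert.prems(2)[OF _ sepx] insert.prems(2)[OF _ sepy] S
      by (auto simp: card_insert_if split: if_splits)
    \<comment> \<open>A walk from \<open>X\<close> to \<open>Y\<close> is cut at its first visit to
      \<open>insert x S\<close>. The prefix cannot use the deleted edge, so \<open>S'\<close> meets
      it.\<close>
    have "N \<le> card S'" if S': "finite S'" "separates F X (insert x S) S'" for S'
    proof (rule insert.prems(2)[OF S'(1)], unfold separates_def, intro allI impI)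
      fix xs assume xs: "walk (insert e F) xs" "hd xs \<in> X" "last xs \<in> Y"
      then obtain v where "v \<in> set xs" "v \<in> insert x S"
        using sepx unfolding separates_def by blast
      then obtain ys where ys: "walk (insert e F) ys" "hd ys = hd xs" "last ys \<in> insert x S"
        "set (butlast ys) \<inter> insert x S = {}" "set ys \<subseteq> set xs"
        using walk_prefix[OF xs(1)] by metis
      then have "walk F ys" using walk_avoid_fst[of x y F ys] e by auto
      then show "set xs \<inter> S' \<noteq> {}" using S'(2) ys xs unfolding separates_def by fastforce
    qed
    then obtain P0 where P0: "\<And>i. i < N \<Longrightarrow> walk F (P0 i) \<and> hd (P0 i) \<in> X \<and> last (P0 i) \<in> insert x S"
      "disjoint_family_on (\<lambda>i. set (P0 i)) {..<N}"
      using insert.IH[of X "insert x S"] insert.prems by auto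
    have "N \<le> card S'" if S': "finite S'" "separates F (insert y S) Y S'" for S'
    proof (rule insert.prems(2)[OF S'(1)], unfold separates_def, intro allI impI)
      fix xs assume xs: "walk (insert e F) xs" "hd xs \<in> X" "last xs \<in> Y"
      then obtain v where "v \<in> set xs" "v \<in> insert y S"
        using sepy unfolding separates_def by blast
      then obtain ys where ys: "walk (insert e F) ys" "last ys = last xs" "hd ys \<in> insert y S"
        "set (tl ys) \<inter> insert y S = {}" "set ys \<subseteq> set xs"
        using walk_suffix[OF xs(1)] by metis
      then have "walk F ys" using walk_avoid_snd[of x y F ys] e by auto
      then show "set xs \<inter> S' \<noteq> {}" using S'(2) ys xs unfolding separates_def by fastforce
    qed
    then obtain Q0 where Q0: "\<And>i. i < N \<Longrightarrow> walk F (Q0 i) \<and> hd (Q0 i) \<in> insert y S \<and> last (Q0 i) \<in> Y"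
      "disjoint_family_on (\<lambda>i. set (Q0 i)) {..<N}"
      using insert.IH[of "insert y S" Y] insert.prems S by auto
    have "\<exists>ys. walk F ys \<and> hd ys = hd (P0 i) \<and> last ys \<in> insert x S \<and>
        set (butlast ys) \<inter> insert x S = {} \<and> set ys \<subseteq> set (P0 i)" if "i < N" for i
      using P0(1)[OF that] walk_prefix[of F "P0 i" "last (P0 i)" "insert x S"]
      by (metis last_in_set walk_def)
    then obtain P where P: "\<And>i. i < N \<Longrightarrow> walk F (P i) \<and> hd (P i) = hd (P0 i) \<and>
        last (P i) \<in> insert x S \<and> set (butlast (P i)) \<inter> insert x S = {} \<and> set (P i) \<subseteq> set (P0 i)"
      by metis
    have "\<exists>ys. walk F ys \<and> last ys = last (Q0 i) \<and> hd ys \<in> insert y S \<and>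
        set (tl ys) \<inter> insert y S = {} \<and> set ys \<subseteq> set (Q0 i)" if "i < N" for i
      using Q0(1)[OF that] walk_suffix[of F "Q0 i" "hd (Q0 i)" "insert y S"]
      by (metis hd_in_set walk_def)
    then obtain Q where Q: "\<And>i. i < N \<Longrightarrow> walk F (Q i) \<and> last (Q i) = last (Q0 i) \<and>
        hd (Q i) \<in> insert y S \<and> set (tl (Q i)) \<inter> insert y S = {} \<and> set (Q i) \<subseteq> set (Q0 i)"
      by metis
    have Pdis: "set (P i) \<inter> set (P j) = {}" if "i < N" "j < N" "i \<noteq> j" for i j
      using P that P0(2) unfolding disjoint_family_on_def by (metis disjoint_iff lessThan_iff subsetD)
    have Qdis: "set (Q i) \<inter> set (Q j) = {}" if "i < N" "j < N" "i \<noteq> j" for i j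
      using Q that Q0(2) unfolding disjoint_family_on_def by (metis disjoint_iff lessThan_iff subsetD)
    have ne: "P i \<noteq> []" "Q i \<noteq> []" if "i < N" for i
      using P[OF that] Q[OF that] by (auto simp: walk_def)
    \<comment> \<open>\<open>N\<close> disjoint walks start in a set of size \<open>N\<close>, hence
      exactly one at each of its points; \<open>q\<close> finds it.\<close>
    have "inj_on (\<lambda>i. hd (Q i)) {..<N}"
      using Qdis ne by (intro inj_onI) (metis disjoint_iff hd_in_set lessThan_iff)
    then have "card ((\<lambda>i. hd (Q i)) ` {..<N}) = N" by (simp add: card_image)
    moreover have "(\<lambda>i. hd (Q i)) ` {..<N} \<subseteq> insert y S" using Q by auto
    ultimately have "(\<lambda>i. hd (Q i)) ` {..<N} = insert y S"
      using card S by (intro card_subset_eq) auto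
    then have "\<forall>b\<in>insert y S. \<exists>i<N. hd (Q i) = b" by (metis imageE lessThan_iff)
    then obtain q where q: "\<And>b. b \<in> insert y S \<Longrightarrow> q b < N \<and> hd (Q (q b)) = b"
      by metis
    have inj: "last (P i) \<noteq> last (P j)" if "i < N" "j < N" "i \<noteq> j" for i j
      using Pdis[OF that] ne that by (metis disjoint_iff last_in_set)
    \<comment> \<open>If \<open>P i\<close> and \<open>Q j\<close> met outside \<open>S\<close>, the
      first part of one and the last part of the other would form a walk in \<open>F\<close> from
      \<open>X\<close> to \<open>Y\<close> that avoids \<open>S\<close>.\<close>
    have cross: "v = last (P i) \<and> v = hd (Q j) \<and> v \<in> S" if cr: "i < N" "j < N" "v \<in> set (P i)" "v \<in> set (Q j)" for i j v
    proof -
      have vS: "v \<in> S"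
      proof (rule ccontr)
        assume vS: "v \<notin> S"
        obtain as bs where ab: "P i = as @ v # bs" "v \<notin> set as" using cr(3) by (metis split_list_first)
        obtain cs ds where cd: "Q j = cs @ v # ds" "v \<notin> set ds" using cr(4) by (metis split_list_last)
        have "walk F (as @ [v])" "walk F (v # ds)"
          using P[OF cr(1)] Q[OF cr(2)] ab cd
          by (auto simp: walk_def successively_append_iff successively_Cons)
        then have "walk F (as @ v # ds)"
          using walk_join(1)[of F "as @ [v]" "v # ds"] by simp
        moreover have "hd (as @ v # ds) \<in> X" using P[OF cr(1)] P0(1)[OF cr(1)] ab
          by (metis hd_append list.sel(1))
        moreover have "last (as @ v # ds) \<in> Y" using Q[OF cr(2)] Q0(1)[OF cr(2)] cd
          by (metis last_appendR list.distinct(1))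
        ultimately have "set (as @ v # ds) \<inter> S \<noteq> {}" using S(2) unfolding separates_def by blast
        moreover have "set as \<subseteq> set (butlast (P i))" using ab by (auto simp: butlast_append)
        moreover have "set ds \<subseteq> set (tl (Q j))" using cd by (cases cs) auto
        ultimately show False using P[OF cr(1)] Q[OF cr(2)] vS by auto
      qed
      then show ?thesis
        using P[OF cr(1)] Q[OF cr(2)] cr hd_tl_set[of v "Q j"] last_butlast_set[of v "P i"] by auto
    qed
    \<comment> \<open>The walk ending in \<open>x\<close> continues over the deleted edge to the
      walk starting in \<open>y\<close>; any other one continues at a shared vertex of
      \<open>S\<close>.\<close>
    define \<sigma> where "\<sigma> i = (if last (P i) = x then q y else q (last (P i)))" for i
    define R where "R i = (if last (P i) = x then P i @ Q (\<sigma> i) else P i @ tl (Q (\<sigma> i)))" for i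
    have \<sigma>: "\<sigma> i < N" "last (P i) \<noteq> x \<Longrightarrow> last (P i) = hd (Q (\<sigma> i))"
      "last (P i) = x \<Longrightarrow> hd (Q (\<sigma> i)) = y" if "i < N" for i
      using P[OF that] q unfolding \<sigma>_def by auto
    have \<sigma>inj: "\<sigma> i \<noteq> \<sigma> j" if "i < N" "j < N" "i \<noteq> j" for i j
      using inj[OF that] \<sigma>(2,3)[OF that(1)] \<sigma>(2,3)[OF that(2)] P[OF that(1)] P[OF that(2)] card
      by (metis insertE)
    have F: "F \<subseteq> insert e F" by blast
    have setR: "set (R i) = set (P i) \<union> set (Q (\<sigma> i))" if "i < N" for i
      using walk_join(4)[of F "P i" "Q (\<sigma> i)"] P[OF that] Q[OF \<sigma>(1)[OF that]] \<sigma>[OF that]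
      by (auto simp: R_def)
    show ?thesis
    proof (intro exI[of _ R] conjI allI impI)
      fix i assume i: "i < N"
      note PQ = P[OF i] Q[OF \<sigma>(1)[OF i]] \<sigma>[OF i] ne(1)[OF i] ne(2)[OF \<sigma>(1)[OF i]]
      show "walk (insert e F) (R i)"
        using walk_join(1)[of F "P i" "Q (\<sigma> i)"] walk_append[of "P i" "Q (\<sigma> i)" "insert e F"]
          PQ walk_mono[OF _ F] e by (auto simp: R_def)
      show "hd (R i) \<in> X" using PQ P0(1)[OF i] by (auto simp: R_def)
      show "last (R i) \<in> Y"
        using walk_join(3)[of F "P i" "Q (\<sigma> i)"] PQ Q0(1)[OF \<sigma>(1)[OF i]] by (auto simp: R_def)
    next
      show "disjoint_family_on (\<lambda>i. set (R i)) {..<N}"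
        unfolding disjoint_family_on_def
      proof (intro ballI impI)
        fix i j assume ij: "i \<in> {..<N}" "j \<in> {..<N}" "i \<noteq> j"
        have *: "set (P i) \<inter> set (Q (\<sigma> j)) = {}" if ij: "i < N" "j < N" "i \<noteq> j" for i j
        proof (rule ccontr)
          assume "set (P i) \<inter> set (Q (\<sigma> j)) \<noteq> {}"
          then obtain v where "v = last (P i)" "v = hd (Q (\<sigma> j))" "v \<in> S"
            using cross[OF ij(1) \<sigma>(1)[OF ij(2)]] by blast
          then show False using \<sigma>[OF ij(2)] card inj[OF ij] by metis
        qed
        show "set (R i) \<inter> set (R j) = {}"
          using Pdis[of i j] Qdis[OF \<sigma>(1) \<sigma>(1) \<sigma>inj, of i j] *[of i j] *[of j i] setR ij by auto
      qed
    qed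
  qed
qed

section \<open>Dominating sets and robust reachability\<close>

text \<open>\<open>F\<close> stands for everything chosen so far. With at most \<open>q\<close>
  elements per index and one index still open it has at most \<open>q * (card I - 1)\<close>
  elements.\<close>

lemma greedy_disjoint:
  assumes "finite I"
    and "\<And>i F. i \<in> I \<Longrightarrow> finite F \<Longrightarrow> card F + q \<le> q * card I \<Longrightarrow>
      \<exists>X. P i X \<and> finite X \<and> card X \<le> q \<and> X \<inter> F = {}"
  shows "\<exists>g. (\<forall>i\<in>I. P i (g i) \<and> finite (g i) \<and> card (g i) \<le> q) \<and> disjoint_family_on g I"
proof -
  have "\<exists>g. (\<forall>i\<in>J. P i (g i) \<and> finite (g i) \<and> card (g i) \<le> q) \<and> disjoint_family_on g J"
    if "J \<subseteq> I" for J
    using finite_subset[OF that assms(1)] that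
  proof (induction J rule: finite_induct)
    case empty
    then show ?case by (auto simp: disjoint_family_on_def)
  next
    case (insert i J)
    then obtain g where g: "\<And>j. j \<in> J \<Longrightarrow> P j (g j) \<and> finite (g j) \<and> card (g j) \<le> q"
      "disjoint_family_on g J" by auto
    have "card (\<Union>j\<in>J. g j) \<le> (\<Sum>j\<in>J. card (g j))" by (rule card_UN_le[OF insert(1)])
    also have "\<dots> \<le> (\<Sum>j\<in>J. q)" using g by (intro sum_mono) auto
    also have "\<dots> = q * card (insert i J) - q" using insert(1,2) by simp
    finally have "card (\<Union>j\<in>J. g j) + q \<le> q * card (insert i J)" using insert(1,2) by simp
    also have "\<dots> \<le> q * card I" using insert.prems assms(1) by (simp add: card_mono del: card_insert_disjoint)
    finally obtain X where X: "P i X" "finite X" "card X \<le> q" "X \<inter> (\<Union>j\<in>J. g j) = {}"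
      using assms(2)[of i "\<Union>j\<in>J. g j"] insert g by auto
    show ?case
    proof (intro exI[of _ "g(i := X)"] conjI ballI)
      show "disjoint_family_on (g(i := X)) (insert i J)"
        using g(2) X(4) insert(2) unfolding disjoint_family_on_def by auto
    qed (use g X insert in auto)
  qed
  then show ?thesis by blast
qed

text \<open>Read \<open>f\<close> as a digraph with out-degrees at most \<open>d\<close>. The
  in-degrees average at most \<open>d\<close> too, so some vertex has at most \<open>2 * d\<close>
  neighbours. Keep it, delete it and its neighbours from \<open>X\<close>, and repeat.\<close>

lemma independent_subset:
  assumes "finite X" and "\<And>x. x \<in> X \<Longrightarrow> card (f x \<inter> X) \<le> d"
  shows "\<exists>Y\<subseteq>X. card X \<le> (2 * d + 1) * card Y \<and> (\<forall>x\<in>Y. \<forall>y\<in>Y. x \<noteq> y \<longrightarrow> y \<notin> f x)"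
  using assms
proof (induction "card X" arbitrary: X rule: less_induct)
  case less
  show ?case
  proof (cases "X = {}")
    case False
    let ?in = "\<lambda>x. {y \<in> X. x \<in> f y}"
    have "(\<Sum>x\<in>X. card (?in x)) = (\<Sum>x\<in>X. \<Sum>y\<in>X. of_bool (x \<in> f y))"
      using less.prems(1) by (simp add: of_bool_def sum.If_cases Int_def conj_commute)
    also have "\<dots> = (\<Sum>y\<in>X. \<Sum>x\<in>X. of_bool (x \<in> f y))" by (rule sum.swap)
    also have "\<dots> = (\<Sum>y\<in>X. card (f y \<inter> X))"
      using less.prems(1) by (simp add: of_bool_def sum.If_cases Int_def conj_commute)
    also have "\<dots> \<le> (\<Sum>y\<in>X. d)" using less.prems by (intro sum_mono)
    finally have sum: "(\<Sum>x\<in>X. card (?in x)) \<le> (\<Sum>x\<in>X. d)" .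
    have "\<exists>x\<in>X. card (?in x) \<le> d"
    proof (rule ccontr)
      assume "\<not> (\<exists>x\<in>X. card (?in x) \<le> d)"
      then have "(\<Sum>x\<in>X. d) < (\<Sum>x\<in>X. card (?in x))"
        using False less.prems(1) by (intro sum_strict_mono) (auto simp: not_le)
      then show False using sum by simp
    qed
    then obtain x where x: "x \<in> X" "card (?in x) \<le> d" by blast
    define D where "D = insert x ((f x \<inter> X) \<union> ?in x)"
    have D: "D \<subseteq> X" using x by (auto simp: D_def)
    have "card D \<le> Suc (card ((f x \<inter> X) \<union> ?in x))"
      unfolding D_def using less.prems(1) by (simp add: card_insert_if)
    also have "\<dots> \<le> 2 * d + 1"
      using card_Un_le[of "f x \<inter> X" "?in x"] x less.prems(2)[OF x(1)] by simp
    finally have cD: "card D \<le> 2 * d + 1" .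
    have "X - D \<subset> X" using x by (auto simp: D_def)
    then have lt: "card (X - D) < card X" using less.prems(1) by (rule psubset_card_mono[rotated])
    have "card (f y \<inter> (X - D)) \<le> d" if "y \<in> X - D" for y
      using less.prems(2)[of y] card_mono[of "f y \<inter> X" "f y \<inter> (X - D)"] less.prems(1) that by fastforce
    then obtain Y where Y: "Y \<subseteq> X - D" "card (X - D) \<le> (2 * d + 1) * card Y"
      "\<forall>a\<in>Y. \<forall>b\<in>Y. a \<noteq> b \<longrightarrow> b \<notin> f a"
      using less.hyps[OF lt] less.prems(1) by auto
    have "finite Y" "x \<notin> Y" using Y(1) less.prems(1) finite_subset by (auto simp: D_def)
    then have "card (insert x Y) = Suc (card Y)" by simp
    moreover have "card X \<le> card (X - D) + card D"
      using less.prems(1) D by (simp add: card_Diff_subset finite_subset)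
    ultimately have "card X \<le> (2 * d + 1) * card (insert x Y)" using Y(2) cD by simp
    moreover have "\<forall>a\<in>insert x Y. \<forall>b\<in>insert x Y. a \<noteq> b \<longrightarrow> b \<notin> f a"
      using Y by (auto simp: D_def)
    moreover have "insert x Y \<subseteq> X" using Y x by auto
    ultimately show ?thesis by blast
  qed auto
qed

lemma smallest_subset:
  fixes f :: "'a \<Rightarrow> nat"
  assumes "finite V" "G \<le> card V"
  shows "\<exists>X d. X \<subseteq> V \<and> card X = G \<and> (\<forall>x\<in>X. f x \<le> d) \<and> (\<forall>x\<in>V - X. d \<le> f x)"
  using assms(2)
proof (induction G)
  case 0
  then show ?case by (intro exI[of _ "{}"] exI[of _ 0]) auto
next
  case (Suc G)
  then obtain X d where X: "X \<subseteq> V" "card X = G" "\<forall>x\<in>X. f x \<le> d" "\<forall>x\<in>V - X. d \<le> f x" by auto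
  have "V - X \<noteq> {}" using X Suc.prems by (metis Diff_eq_empty_iff Suc_n_not_le_n subset_antisym)
  then obtain z where z: "z \<in> V - X" "\<And>y. y \<in> V - X \<Longrightarrow> f z \<le> f y"
    using assms(1) arg_min_least[of "V - X" _ f] arg_min_if_finite(1)[of "V - X" f] by blast
  have "finite X" using X(1) assms(1) finite_subset by blast
  moreover have "\<forall>x\<in>insert z X. f x \<le> f z" using X(3,4) z(1) by (metis insertE le_trans order_refl)
  ultimately show ?case using X z by (intro exI[of _ "insert z X"] exI[of _ "f z"]) auto
qed

section \<open>Reachability and degrees in tournaments\<close>

definition nin :: "'a set \<Rightarrow> ('a \<Rightarrow> 'a \<Rightarrow> bool) \<Rightarrow> 'a \<Rightarrow> 'a set" where
  "nin V E x = {y \<in> V. E y x}"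

definition reach :: "'a set \<Rightarrow> ('a \<Rightarrow> 'a \<Rightarrow> bool) \<Rightarrow> 'a \<Rightarrow> 'a \<Rightarrow> bool" where
  "reach U E = (\<lambda>x y. x \<in> U \<and> y \<in> U \<and> E x y)\<^sup>*\<^sup>*"

lemma strongly_connected_reach:
  "strongly_connected U E \<longleftrightarrow> (\<forall>u\<in>U. \<forall>v\<in>U. reach U E u v)"
  by (simp add: strongly_connected_def reach_def)

lemma reach_flip: "reach U E\<inverse>\<inverse> x y \<longleftrightarrow> reach U E y x"
proof -
  have "(\<lambda>x y. x \<in> U \<and> y \<in> U \<and> E\<inverse>\<inverse> x y) = (\<lambda>x y. x \<in> U \<and> y \<in> U \<and> E x y)\<inverse>\<inverse>" by auto
  then show ?thesis unfolding reach_def by (simp only: rtranclp_conversep conversep_iff)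
qed

lemma reach_trans: "reach U E x y \<Longrightarrow> reach U E y z \<Longrightarrow> reach U E x z"
  unfolding reach_def by (rule rtranclp_trans)

lemma reach_refl [simp]: "reach U E x x"
  by (simp add: reach_def)

lemma reach_edge: "x \<in> U \<Longrightarrow> y \<in> U \<Longrightarrow> E x y \<Longrightarrow> reach U E x y"
  by (simp add: reach_def r_into_rtranclp)

lemma reach_mono: "reach U E x y \<Longrightarrow> U \<subseteq> U' \<Longrightarrow> reach U' E x y"
  unfolding reach_def by (induction rule: rtranclp_induct) (auto intro: rtranclp.rtrancl_into_rtrancl)

lemma tournament_flip: "tournament V E \<Longrightarrow> tournament V E\<inverse>\<inverse>"
  unfolding tournament_def conversep_iff by metis

lemma strongly_k_connected_flip:
  "strongly_k_connected V E K \<Longrightarrow> strongly_k_connected V E\<inverse>\<inverse> K"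
  unfolding strongly_k_connected_def strongly_connected_reach reach_flip by blast

lemma tournament_asym: "tournament V E \<Longrightarrow> x \<in> V \<Longrightarrow> y \<in> V \<Longrightarrow> E x y \<Longrightarrow> \<not> E y x"
  unfolding tournament_def by metis

lemma tournament_total:
  "tournament V E \<Longrightarrow> x \<in> V \<Longrightarrow> y \<in> V \<Longrightarrow> x \<noteq> y \<Longrightarrow> \<not> E y x \<Longrightarrow> E x y"
  unfolding tournament_def by metis

lemma finite_nin: "tournament V E \<Longrightarrow> finite (nin V E x)"
  by (simp add: tournament_def nin_def)

text \<open>Otherwise deleting all in-neighbours of \<open>v\<close> would be allowed and would
  leave \<open>v\<close> unreachable from another remaining vertex, which exists because
  \<open>card V > K\<close>.\<close>

lemma degree_ge_connectivity:
  assumes "tournament V E" "strongly_k_connected V E K" "v \<in> V"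
  shows "K \<le> card (nin V E v)"
proof (rule ccontr)
  assume *: "\<not> K \<le> card (nin V E v)"
  let ?S = "nin V E v"
  have v: "v \<notin> ?S" using assms by (auto simp: nin_def tournament_def)
  have fin: "finite V" using assms by (simp add: tournament_def)
  have S: "?S \<subseteq> V" by (auto simp: nin_def)
  have con: "strongly_connected (V - ?S) E"
    using assms(2) * S unfolding strongly_k_connected_def by simp
  have "\<not> V \<subseteq> insert v ?S"
  proof
    assume "V \<subseteq> insert v ?S"
    then have "card V \<le> Suc (card ?S)" using card_mono[of "insert v ?S" V] v fin S
      by (simp add: finite_subset card_insert_if)
    then show False using assms(2) * by (auto simp: strongly_k_connected_def)
  qed
  then obtain u where u: "u \<in> V - ?S" "u \<noteq> v" by blast
  have "reach (V - ?S) E u v"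
    using con u v assms(3) unfolding strongly_connected_reach by blast
  then show False using u unfolding reach_def nin_def by (cases rule: rtranclp.cases) auto
qed

text \<open>In-degrees and out-degrees inside \<open>X\<close> have the same sum, and at each vertex
  they add up to at most \<open>card X\<close>.\<close>

lemma tournament_low_indegree:
  assumes "tournament V E" "X \<subseteq> V" "X \<noteq> {}"
  shows "\<exists>x\<in>X. 2 * card {y \<in> X. E y x} \<le> card X"
proof (rule ccontr)
  assume *: "\<not> ?thesis"
  have fin: "finite X" using assms finite_subset by (auto simp: tournament_def)
  have "card {y \<in> X. E y x} + card {y \<in> X. E x y} \<le> card X" if "x \<in> X" for x
  proof -
    have "{y \<in> X. E y x} \<inter> {y \<in> X. E x y} = {}"
      using tournament_asym[OF assms(1)] assms(2) that by blast
    then show ?thesis using fin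
      by (subst card_Un_disjoint[symmetric]) (auto intro!: card_mono)
  qed
  then have "(\<Sum>x\<in>X. card {y \<in> X. E y x} + card {y \<in> X. E x y}) \<le> (\<Sum>x\<in>X. card X)"
    by (intro sum_mono)
  moreover have "(\<Sum>x\<in>X. card {y \<in> X. E y x}) = (\<Sum>x\<in>X. card {y \<in> X. E x y})"
  proof -
    have "(\<Sum>x\<in>X. card {y \<in> X. E y x}) = (\<Sum>x\<in>X. \<Sum>y\<in>X. of_bool (E y x))"
      using fin by (simp add: of_bool_def sum.If_cases Int_def conj_commute)
    also have "\<dots> = (\<Sum>y\<in>X. \<Sum>x\<in>X. of_bool (E y x))" by (rule sum.swap)
    also have "\<dots> = (\<Sum>x\<in>X. card {y \<in> X. E x y})"
      using fin by (simp add: of_bool_def sum.If_cases Int_def conj_commute)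
    finally show ?thesis .
  qed
  moreover have "(\<Sum>x\<in>X. card X) < (\<Sum>x\<in>X. 2 * card {y \<in> X. E y x})"
    using * fin assms(3) by (intro sum_strict_mono) (auto simp: not_le)
  ultimately show False by (simp add: sum.distrib sum_distrib_left[symmetric])
qed

section \<open>Small dominating sets and robust reachability\<close>

lemma card_insert_le_Suc: "card (insert a A) \<le> Suc (card A)"
  by (cases "finite A") (simp_all add: card_insert_if)

text \<open>Each new vertex is dominated by at most half of the vertices outside \<open>Z\<close> that are still
  undominated, so the excess of the undominated set over \<open>card Z\<close> is halved.\<close>
lemma dominating_set:
  assumes T: "tournament V E" and "v \<in> V" "finite Z" "v \<notin> Z"
  shows "\<exists>A a. A \<subseteq> V \<and> A \<inter> Z = {} \<and> v \<in> A \<and> a \<in> A \<and> card A \<le> c + 1 \<and> (\<forall>x\<in>A - {a}. E a x) \<and>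
    2 ^ c * card {x \<in> V. \<forall>y\<in>A. \<not> E y x} \<le> 2 ^ c * (card Z + 1) + card (nin V E v)"
proof -
  have fin: "finite V" using T by (simp add: tournament_def)
  \<comment> \<open>The induction tracks the vertices dominating all of \<open>A\<close>: these are
    the candidates for the next vertex, and every undominated vertex outside \<open>A\<close> is
    among them.\<close>
  have "\<exists>A a. A \<subseteq> V \<and> A \<inter> Z = {} \<and> v \<in> A \<and> a \<in> A \<and> card A \<le> c + 1 \<and> (\<forall>x\<in>A - {a}. E a x) \<and>
    2 ^ c * card {x \<in> V. \<forall>y\<in>A. E x y} \<le> 2 ^ c * card Z + card (nin V E v)"
  proof (induction c)
    case 0
    then show ?case using assms by (intro exI[of _ "{v}"] exI[of _ v]) (auto simp: nin_def)
  next
    case (Suc c)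
    then obtain A a where A: "A \<subseteq> V" "A \<inter> Z = {}" "v \<in> A" "a \<in> A" "card A \<le> c + 1"
      "\<forall>x\<in>A - {a}. E a x"
      "2 ^ c * card {x \<in> V. \<forall>y\<in>A. E x y} \<le> 2 ^ c * card Z + card (nin V E v)" by blast
    let ?D = "{x \<in> V. \<forall>y\<in>A. E x y}"
    show ?case
    proof (cases "?D \<subseteq> Z")
      \<comment> \<open>Only forbidden candidates are left, so \<open>A\<close> is kept; there are
        at most \<open>card Z\<close> of them.\<close>
      case True
      then have "card ?D \<le> card Z" using assms(3) card_mono by blast
      then have "2 ^ Suc c * card ?D \<le> 2 ^ Suc c * card Z" by simp
      then show ?thesis using A by (intro exI[of _ A] exI[of _ a]) (auto intro: trans_le_add1)
    next
      case False
      \<comment> \<open>The new vertex dominates all earlier ones and takes over the role of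
        \<open>a\<close>.\<close>
      then obtain b where b: "b \<in> ?D - Z" "2 * card {y \<in> ?D - Z. E y b} \<le> card (?D - Z)"
        using tournament_low_indegree[OF T, of "?D - Z"] by blast
      let ?D' = "{x \<in> V. \<forall>y\<in>insert b A. E x y}"
      have finA: "finite A" using A fin finite_subset by blast
      have "?D' \<subseteq> {y \<in> ?D - Z. E y b} \<union> (?D \<inter> Z)" by auto
      then have "card ?D' \<le> card ({y \<in> ?D - Z. E y b} \<union> (?D \<inter> Z))"
        by (intro card_mono) (use fin in auto)
      also have "\<dots> \<le> card {y \<in> ?D - Z. E y b} + card (?D \<inter> Z)" by (rule card_Un_le)
      finally have "2 * card ?D' \<le> card (?D - Z) + card (?D \<inter> Z) + card (?D \<inter> Z)" using b by simp
      also have "card (?D - Z) + card (?D \<inter> Z) = card ?D"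
        using fin by (subst card_Un_disjoint[symmetric]) (auto simp: Un_Diff_Int)
      also have "card (?D \<inter> Z) \<le> card Z" using assms(3) by (simp add: card_mono)
      finally have "2 * card ?D' \<le> card ?D + card Z" by simp
      then have "2 ^ c * (2 * card ?D') \<le> 2 ^ c * (card ?D + card Z)" by (rule mult_le_mono2)
      then have "2 ^ Suc c * card ?D' \<le> 2 ^ Suc c * card Z + card (nin V E v)"
        using A(7) by (simp add: algebra_simps)
      moreover have "card (insert b A) \<le> Suc c + 1" using A(5) finA by (simp add: card_insert_if)
      ultimately show ?thesis using A b by (intro exI[of _ "insert b A"] exI[of _ b]) auto
    qed
  qed
  then obtain A a where A: "A \<subseteq> V" "A \<inter> Z = {}" "v \<in> A" "a \<in> A" "card A \<le> c + 1"
    "\<forall>x\<in>A - {a}. E a x"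
    "2 ^ c * card {x \<in> V. \<forall>y\<in>A. E x y} \<le> 2 ^ c * card Z + card (nin V E v)" by blast
  \<comment> \<open>The vertex \<open>a\<close> is itself undominated, which accounts for the
    \<open>+ 1\<close> in the bound; the rest of \<open>A\<close> is dominated by
    \<open>a\<close>.\<close>
  have "{x \<in> V. \<forall>y\<in>A. \<not> E y x} \<subseteq> insert a {x \<in> V. \<forall>y\<in>A. E x y}"
  proof
    fix x assume x: "x \<in> {x \<in> V. \<forall>y\<in>A. \<not> E y x}"
    show "x \<in> insert a {x \<in> V. \<forall>y\<in>A. E x y}"
    proof (cases "x \<in> A")
      case True
      then show ?thesis using A(4,6) x by auto
    next
      case False
      then have "E x y" if "y \<in> A" for y
        using tournament_total[OF T, of x y] A(1) x that by blast
      then show ?thesis using x by auto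
    qed
  qed
  then have "card {x \<in> V. \<forall>y\<in>A. \<not> E y x} \<le> Suc (card {x \<in> V. \<forall>y\<in>A. E x y})"
    by (intro order_trans[OF card_mono card_insert_le_Suc]) (simp_all add: fin)
  then have "2 ^ c * card {x \<in> V. \<forall>y\<in>A. \<not> E y x} \<le> 2 ^ c * Suc (card {x \<in> V. \<forall>y\<in>A. E x y})"
    by (rule mult_le_mono2)
  then have "2 ^ c * card {x \<in> V. \<forall>y\<in>A. \<not> E y x} \<le> 2 ^ c * (card Z + 1) + card (nin V E v)"
    using A(7) by simp
  then show ?thesis using A by blast
qed

text \<open>When fewer than \<open>k\<close> vertices are deleted, a surviving vertex with \<open>acc W E k B\<close> is still
  reachable from any vertex that reaches the surviving part of \<open>B\<close>.\<close>
inductive acc :: "'a set \<Rightarrow> ('a \<Rightarrow> 'a \<Rightarrow> bool) \<Rightarrow> nat \<Rightarrow> 'a set \<Rightarrow> 'a \<Rightarrow> bool"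
  for W E k B where
  base: "x \<in> B \<Longrightarrow> acc W E k B x"
| step: "N \<subseteq> W \<Longrightarrow> finite N \<Longrightarrow> k \<le> card N \<Longrightarrow>
    (\<And>y. y \<in> N \<Longrightarrow> E y x \<and> acc W E k B y) \<Longrightarrow> acc W E k B x"

lemma acc_mono:
  "acc W E k B x \<Longrightarrow> W \<subseteq> W' \<Longrightarrow> B \<subseteq> B' \<Longrightarrow> acc W' E k B' x"
proof (induction rule: acc.induct)
  case (step N x)
  then show ?case by (intro acc.step[of N]) auto
qed (auto intro: acc.base)

text \<open>Fewer than \<open>k\<close> deletions spare at least one of the \<open>k\<close>
  in-neighbours that each \<open>step\<close> supplies.\<close>

lemma acc_reach:
  assumes "acc W E k B y" "finite S" "card S < k" "y \<in> W - S"
    and "\<And>b. b \<in> B \<Longrightarrow> b \<in> W - S \<Longrightarrow> reach (W - S) E a b"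
  shows "reach (W - S) E a y"
  using assms(1,4)
proof (induction rule: acc.induct)
  case (base x)
  then show ?case using assms(5) by blast
next
  case (step N x)
  have "\<not> N \<subseteq> S" using step(3) assms(2,3) card_mono[of S N] by auto
  then obtain z where z: "z \<in> N" "z \<notin> S" by blast
  then have "z \<in> W - S" using step(1) by blast
  moreover have "E z x" "reach (W - S) E a z" using step(4)[OF z(1)] calculation by auto
  ultimately show ?case using step(5) reach_edge[of z "W - S" x E] reach_trans by metis
qed

text \<open>Some \<open>H i\<close> avoids the deleted set \<open>S\<close>, since the
  \<open>H i\<close> are disjoint. \<open>BA\<close> and \<open>BB\<close> are the vertices served
  by every \<open>H i\<close>, so it does not matter which one survives; \<open>acc\<close> carries
  this over to the rest of \<open>W\<close>.\<close>

lemma strongly_k_connected_by_hubs: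
  assumes W: "finite W" "k < card W"
    and I: "finite I" "k \<le> card I" "disjoint_family_on H I"
    and H: "\<And>i. i \<in> I \<Longrightarrow> H i \<subseteq> W \<and> reach (H i) E (b i) (a i)"
    and A: "\<And>i x. i \<in> I \<Longrightarrow> x \<in> BA \<Longrightarrow> \<exists>y\<in>H i. reach (H i) E (a i) y \<and> E y x"
    and B: "\<And>i x. i \<in> I \<Longrightarrow> x \<in> BB \<Longrightarrow> \<exists>y\<in>H i. reach (H i) E y (b i) \<and> E x y"
    and acc: "\<And>x. x \<in> W \<Longrightarrow> acc W E k BA x \<and> acc W E\<inverse>\<inverse> k BB x"
  shows "strongly_k_connected W E k"
  unfolding strongly_k_connected_def strongly_connected_reach
proof (intro conjI allI impI ballI)
  fix S u v assume S: "S \<subseteq> W" "card S < k" and u: "u \<in> W - S" and v: "v \<in> W - S"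
  have finS: "finite S" using S W finite_subset by blast
  have "\<exists>i\<in>I. H i \<inter> S = {}"
  proof (rule ccontr)
    assume "\<not> ?thesis"
    then have "\<forall>i\<in>I. \<exists>x. x \<in> H i \<inter> S" by blast
    then obtain g where g: "\<And>i. i \<in> I \<Longrightarrow> g i \<in> H i \<inter> S" by metis
    have "inj_on g I"
      using g I(3) by (intro inj_onI) (metis IntD1 disjoint_family_onD disjoint_iff)
    then have "card I \<le> card S" using g finS by (intro card_inj_on_le) auto
    then show False using I S by simp
  qed
  then obtain i where i: "i \<in> I" "H i \<subseteq> W - S" using H by blast
  have "reach (W - S) E (a i) v"
  proof (rule acc_reach[of W E k BA])
    fix x assume x: "x \<in> BA" "x \<in> W - S"
    obtain y where y: "y \<in> H i" "reach (H i) E (a i) y" "E y x" using A[OF i(1) x(1)] by blast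
    then show "reach (W - S) E (a i) x"
      using i x y reach_mono[of "H i" E "a i" y "W - S"] reach_edge[of y "W - S" x E]
        reach_trans[of "W - S" E "a i" y x] by blast
  qed (use acc v S finS in auto)
  moreover have "reach (W - S) E\<inverse>\<inverse> (b i) u"
  proof (rule acc_reach[of W "E\<inverse>\<inverse>" k BB])
    fix x assume x: "x \<in> BB" "x \<in> W - S"
    obtain y where y: "y \<in> H i" "reach (H i) E y (b i)" "E x y" using B[OF i(1) x(1)] by blast
    then show "reach (W - S) E\<inverse>\<inverse> (b i) x"
      using i x y reach_mono[of "H i" E y "b i" "W - S"] reach_edge[of x "W - S" y E]
        reach_trans[of "W - S" E x y "b i"] unfolding reach_flip by blast
  qed (use acc u S finS in auto)
  moreover have "reach (W - S) E (b i) (a i)" using H[OF i(1)] i(2) reach_mono[of "H i" E "b i" "a i"] by blast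
  ultimately show "reach (W - S) E u v" unfolding reach_flip using reach_trans[of "W - S" E] by blast
qed (use W in auto)

section \<open>Distributing the exceptional vertices\<close>

text \<open>\<open>W - EA\<close> and \<open>W - EB\<close> are the bases because vertices outside
  \<open>EA\<close> will be dominated by every out-dominating hub, and those outside
  \<open>EB\<close> will send an edge into every in-dominating one.\<close>

definition robust :: "('a \<Rightarrow> 'a \<Rightarrow> bool) \<Rightarrow> nat \<Rightarrow> 'a set \<Rightarrow> 'a set \<Rightarrow> 'a set \<Rightarrow> 'a \<Rightarrow> bool" where
  "robust E k EA EB W x \<longleftrightarrow> acc W E k (W - EA) x \<and> acc W E\<inverse>\<inverse> k (W - EB) x"

lemma robust_mono: "robust E k EA EB W x \<Longrightarrow> W \<subseteq> W' \<Longrightarrow> robust E k EA EB W' x"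
  unfolding robust_def using acc_mono[of W _ k _ x W'] by blast

lemma acc_neighbours:
  assumes "N \<subseteq> nin V E x" "N \<subseteq> W" "N \<inter> EA = {}" "finite N" "k \<le> card N"
  shows "acc W E k (W - EA) x"
  using assms by (intro acc.step[of N]) (auto simp: nin_def intro!: acc.base)

text \<open>\<open>M\<close> will be the uncoloured unexceptional vertices. Fewer than
  \<open>k\<close> elements of \<open>N\<close> are lost there, so more than
  \<open>k * card J\<close> are left for the classes.\<close>

lemma pigeonhole_classes:
  assumes "finite N" "finite J" "N \<subseteq> M \<union> (\<Union>j\<in>J. B j)" "card (N \<inter> M) < k" "k * card J + k \<le> card N"
  shows "\<exists>j\<in>J. k \<le> card (N \<inter> B j)"
proof (rule ccontr)
  assume *: "\<not> ?thesis"
  have "N = (N \<inter> M) \<union> (\<Union>j\<in>J. N \<inter> B j)" using assms(3) by blast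
  then have "card N \<le> card (N \<inter> M) + card (\<Union>j\<in>J. N \<inter> B j)" using card_Un_le by metis
  also have "card (\<Union>j\<in>J. N \<inter> B j) \<le> (\<Sum>j\<in>J. card (N \<inter> B j))" by (rule card_UN_le[OF assms(2)])
  also have "\<dots> \<le> (\<Sum>j\<in>J. k)" using * by (intro sum_mono) auto
  finally show False using assms(4,5) by (simp add: mult.commute)
qed

text \<open>A vertex of \<open>EA\<close> has its colour forced if it has few in-neighbours in the set \<open>F\<close> of
  uncoloured vertices outside \<open>EA \<union> EB\<close>, and dually for \<open>EB\<close>. Both cannot happen at once,
  because \<open>F\<close> is large. A vertex forced on the \<open>EB\<close> side
  takes a colour that occurs often among its out-neighbours; since these lie outside
  \<open>EA \<union> EB\<close>, no cyclic dependency arises. Vertices forced on the \<open>EA\<close> side are coloured last.\<close>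
lemma extend_colour_classes:
  fixes C :: "nat \<Rightarrow> 'a set"
  assumes T: "tournament V E" and t: "1 \<le> t" and EAB: "EA \<subseteq> V" "EB \<subseteq> V"
    and C: "\<And>j. j \<in> {1..t} \<Longrightarrow> C j \<subseteq> V" "disjoint_family_on C {1..t}"
      "\<And>j x. j \<in> {1..t} \<Longrightarrow> x \<in> C j \<Longrightarrow> robust E k EA EB (C j) x"
    and supply_in: "\<And>x. x \<in> V - (\<Union>j\<in>{1..t}. C j) \<Longrightarrow> k * t + k \<le> card (nin V E x - EA)"
    and supply_out: "\<And>x. x \<in> V - (\<Union>j\<in>{1..t}. C j) \<Longrightarrow>
      k * t + k \<le> card (nin V E\<inverse>\<inverse> x - (EA \<union> EB))"
    and room: "card (\<Union>j\<in>{1..t}. C j) + (3 * k + 1) * card (EA \<union> EB) + 2 * k + 1 \<le> card V"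
  shows "\<exists>D. (\<forall>j\<in>{1..t}. C j \<subseteq> D j \<and> D j \<subseteq> V \<and> (\<forall>x\<in>D j. robust E k EA EB (D j) x) \<and>
      card (D j) \<le> card (C j) + (3 * k + 1) * card (EA \<union> EB)) \<and>
    disjoint_family_on D {1..t} \<and> EA \<union> EB \<subseteq> (\<Union>j\<in>{1..t}. D j)"
proof -
  define W0 where "W0 = (\<Union>j\<in>{1..t}. C j)"
  define X where "X = (EA \<union> EB) - W0"
  define F where "F = V - W0 - (EA \<union> EB)"
  let ?in = "nin V E" and ?out = "nin V E\<inverse>\<inverse>"
  define I where "I x \<longleftrightarrow> x \<in> EA \<and> card (?in x \<inter> F) < k" for x
  define Q where "Q x \<longleftrightarrow> x \<in> EB \<and> card (?out x \<inter> F) < k" for x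
  have fin: "finite V" using T by (simp add: tournament_def)
  have finE: "finite (EA \<union> EB)" using EAB fin finite_subset by blast
  have W0: "W0 \<subseteq> V" using C(1) unfolding W0_def by blast
  have finX: "finite X" using finE by (simp add: X_def)
  have finF: "finite F" using fin by (simp add: F_def)
  have XV: "X \<subseteq> V" using EAB by (auto simp: X_def)
  have FX: "F \<inter> X = {}" "F \<inter> W0 = {}" "X \<inter> W0 = {}" "F \<inter> EA = {}" "F \<inter> EB = {}" "F \<subseteq> V"
    by (auto simp: F_def X_def)
  have XW: "x \<in> V - (\<Union>j\<in>{1..t}. C j)" if "x \<in> X" for x
    using that XV FX(3) unfolding W0_def by blast
  have cX: "card X \<le> card (EA \<union> EB)" using finE by (auto simp: X_def intro: card_mono)
  have fin_n: "finite (?in x)" "finite (?out x)" for x using fin by (auto simp: nin_def)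
  have "card V \<le> card (F \<union> (W0 \<union> (EA \<union> EB)))"
    using finF finE finite_subset[OF W0 fin] by (intro card_mono) (auto simp: F_def)
  also have "\<dots> \<le> card F + (card W0 + card (EA \<union> EB))"
    using card_Un_le[of F "W0 \<union> (EA \<union> EB)"] card_Un_le[of W0 "EA \<union> EB"] by linarith
  finally have "card V \<le> card F + (card W0 + card (EA \<union> EB))" .
  \<comment> \<open>Each vertex of \<open>X\<close> will take at most \<open>2 * k\<close> vertices
    of \<open>F\<close>. The surplus keeps the greedy choice possible and excludes that a vertex is
    forced on both sides.\<close>
  then have cF: "3 * k * card X + 2 * k + 1 \<le> card F"
    using room mult_le_mono2[OF cX, of "3 * k"] add_mult_distrib[of "3 * k" 1 "card (EA \<union> EB)"]
    unfolding W0_def by linarith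
  have both: "card F \<le> card (?in x \<inter> F) + card (?out x \<inter> F) + 1" if "x \<in> V" for x
  proof -
    have "F \<subseteq> insert x ((?in x \<inter> F) \<union> (?out x \<inter> F))"
      using tournament_total[OF T _ that] FX(6) by (auto simp: nin_def)
    then have "card F \<le> card (insert x ((?in x \<inter> F) \<union> (?out x \<inter> F)))"
      using finF by (intro card_mono) auto
    also have "\<dots> \<le> Suc (card ((?in x \<inter> F) \<union> (?out x \<inter> F)))" by (rule card_insert_le_Suc)
    finally show ?thesis using card_Un_le[of "?in x \<inter> F" "?out x \<inter> F"] by simp
  qed
  have excl: "\<not> (I x \<and> Q x)" if "x \<in> V" for x
    using both[OF that] cF unfolding I_def Q_def by linarith
  \<comment> \<open>An out-neighbour outside \<open>EA \<union> EB\<close> lies in \<open>F\<close>,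
    which contains fewer than \<open>k\<close> of them, or in some \<open>C j\<close>.\<close>
  have "\<exists>j\<in>{1..t}. k \<le> card ((?out x - (EA \<union> EB)) \<inter> C j)" if x: "x \<in> X" "Q x" for x
  proof (rule pigeonhole_classes)
    show "?out x - (EA \<union> EB) \<subseteq> F \<union> (\<Union>j\<in>{1..t}. C j)"
      by (auto simp: F_def W0_def nin_def)
    have "(?out x - (EA \<union> EB)) \<inter> F = ?out x \<inter> F" using FX by auto
    then show "card ((?out x - (EA \<union> EB)) \<inter> F) < k" using x by (simp add: Q_def)
    show "k * card {1..t} + k \<le> card (?out x - (EA \<union> EB))"
      using supply_out[OF XW[OF x(1)]] by simp
  qed (use fin_n in auto)
  then obtain c0 where c0: "\<And>x. x \<in> X \<Longrightarrow> Q x \<Longrightarrow> c0 x \<in> {1..t} \<and>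
      k \<le> card ((?out x - (EA \<union> EB)) \<inter> C (c0 x))" by metis
  \<comment> \<open>Colour 1 is the default for unforced vertices; where \<open>I\<close> holds, the
    value is replaced by \<open>c2\<close> later.\<close>
  define c1 where "c1 x = (if Q x then c0 x else 1)" for x
  have c1: "c1 x \<in> {1..t}" if "x \<in> X" for x using c0[OF that] t by (auto simp: c1_def)
  \<comment> \<open>The classes just before the vertices with \<open>I\<close> are placed. An
    in-neighbour outside \<open>EA\<close> never satisfies \<open>I\<close>, so it lies in
    \<open>F\<close> or already has a colour.\<close>
  define B where "B j = C j \<union> {z \<in> X. \<not> I z \<and> c1 z = j}" for j
  have "\<exists>j\<in>{1..t}. k \<le> card ((?in x - EA) \<inter> B j)" if x: "x \<in> X" "I x" for x
  proof (rule pigeonhole_classes)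
    show "?in x - EA \<subseteq> F \<union> (\<Union>j\<in>{1..t}. B j)"
    proof
      fix z assume z: "z \<in> ?in x - EA"
      consider "z \<in> F" | "z \<in> W0" | "z \<in> X" using z by (auto simp: F_def X_def nin_def)
      then show "z \<in> F \<union> (\<Union>j\<in>{1..t}. B j)"
      proof cases
        case 3
        then have "z \<in> B (c1 z)" using z by (auto simp: B_def I_def)
        then show ?thesis using c1[OF 3] by blast
      qed (auto simp: B_def W0_def)
    qed
    have "(?in x - EA) \<inter> F = ?in x \<inter> F" using FX by auto
    then show "card ((?in x - EA) \<inter> F) < k" using x by (simp add: I_def)
    show "k * card {1..t} + k \<le> card (?in x - EA)"
      using supply_in[OF XW[OF x(1)]] by simp
  qed (use fin_n in auto)
  then obtain c2 where c2: "\<And>x. x \<in> X \<Longrightarrow> I x \<Longrightarrow> c2 x \<in> {1..t} \<and>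
      k \<le> card ((?in x - EA) \<inter> B (c2 x))" by metis
  define c where "c x = (if I x then c2 x else c1 x)" for x
  have c: "c x \<in> {1..t}" if "x \<in> X" for x using c1[OF that] c2[OF that] by (auto simp: c_def)
  define U where "U = {x \<in> X. \<not> I x \<and> \<not> Q x}"
  define P where "P = {x \<in> X. I x \<or> Q x}"
  have cU: "c x = 1" if "x \<in> U" for x using that by (auto simp: U_def c_def c1_def)
  \<comment> \<open>An unforced vertex finds enough neighbours in \<open>F\<close> on each side
    where it is exceptional. All unforced vertices get colour 1, so their sets \<open>h x\<close>
    may overlap.\<close>
  have "\<exists>Y\<subseteq>F. card Y \<le> 2 * k \<and> (x \<in> EA \<longrightarrow> k \<le> card (Y \<inter> ?in x)) \<and>
      (x \<in> EB \<longrightarrow> k \<le> card (Y \<inter> ?out x))" if x: "x \<in> U" for x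
  proof -
    have "\<exists>Y. Y \<subseteq> F \<inter> ?in x \<and> card Y \<le> k \<and> (x \<in> EA \<longrightarrow> k \<le> card Y)"
    proof (cases "x \<in> EA")
      case True
      then have "k \<le> card (F \<inter> ?in x)" using x by (auto simp: U_def I_def Int_commute)
      then show ?thesis by (metis obtain_subset_with_card_n order_refl)
    qed (auto intro: exI[of _ "{}"])
    then obtain Y1 where Y1: "Y1 \<subseteq> F \<inter> ?in x" "card Y1 \<le> k" "x \<in> EA \<longrightarrow> k \<le> card Y1" by blast
    have "\<exists>Y. Y \<subseteq> F \<inter> ?out x \<and> card Y \<le> k \<and> (x \<in> EB \<longrightarrow> k \<le> card Y)"
    proof (cases "x \<in> EB")
      case True
      then have "k \<le> card (F \<inter> ?out x)" using x by (auto simp: U_def Q_def Int_commute)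
      then show ?thesis by (metis obtain_subset_with_card_n order_refl)
    qed (auto intro: exI[of _ "{}"])
    then obtain Y2 where Y2: "Y2 \<subseteq> F \<inter> ?out x" "card Y2 \<le> k" "x \<in> EB \<longrightarrow> k \<le> card Y2" by blast
    have "card Y1 \<le> card ((Y1 \<union> Y2) \<inter> ?in x)" "card Y2 \<le> card ((Y1 \<union> Y2) \<inter> ?out x)"
      by (rule card_mono; use Y1 Y2 fin_n in auto)+
    then show ?thesis using Y1 Y2 card_Un_le[of Y1 Y2]
      by (intro exI[of _ "Y1 \<union> Y2"]) auto
  qed
  then obtain h where h: "\<And>x. x \<in> U \<Longrightarrow> h x \<subseteq> F \<and> card (h x) \<le> 2 * k \<and>
      (x \<in> EA \<longrightarrow> k \<le> card (h x \<inter> ?in x)) \<and> (x \<in> EB \<longrightarrow> k \<le> card (h x \<inter> ?out x))" by metis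
  define H where "H = (\<Union>x\<in>U. h x)"
  have finU: "finite U" and finP: "finite P" using finX by (auto simp: U_def P_def)
  have "card U + card P = card X"
    using finX excl XV by (subst card_Un_disjoint[symmetric]) (auto simp: U_def P_def intro!: arg_cong[of _ _ card])
  moreover have "card H \<le> 2 * k * card U"
    using card_UN_le[OF finU, of h] sum_mono[of U "\<lambda>x. card (h x)" "\<lambda>x. 2 * k"] h
    by (fastforce simp: H_def mult.commute)
  ultimately have cH: "card H + 2 * k * card P \<le> 2 * k * card X"
    by (metis add_mult_distrib2 add_right_mono)
  have HF: "H \<subseteq> F" using h by (auto simp: H_def)
  \<comment> \<open>A vertex forced on one side has almost all of \<open>F\<close> on its other
    side. Since forced vertices have various colours, these neighbours are chosen disjointly and
    outside \<open>H\<close>, which is tied to colour 1.\<close>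
  have "\<exists>g. (\<forall>x\<in>P. (g x \<subseteq> F - H \<and> g x \<subseteq> (if I x then ?out x else ?in x) \<and> k \<le> card (g x)) \<and>
      finite (g x) \<and> card (g x) \<le> k) \<and> disjoint_family_on g P"
  proof (rule greedy_disjoint[OF finP])
    fix x and Z :: "'a set" assume x: "x \<in> P" and Z: "finite Z" "card Z + k \<le> k * card P"
    let ?n = "if I x then ?out x else ?in x"
    have xV: "x \<in> V" using x XV by (auto simp: P_def)
    have "card F \<le> card (?n \<inter> F) + k"
      using both[OF xV] x by (auto simp: P_def I_def Q_def)
    also have "card (?n \<inter> F) \<le> card ((?n \<inter> F - H - Z) \<union> (H \<union> Z))"
      using fin_n finF HF Z by (intro card_mono) (auto intro: finite_subset)
    also have "\<dots> \<le> card (?n \<inter> F - H - Z) + (card H + card Z)"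
      using card_Un_le[of "?n \<inter> F - H - Z" "H \<union> Z"] card_Un_le[of H Z] by linarith
    finally have "k \<le> card (?n \<inter> F - H - Z)" using cF cH Z(2) by (simp add: algebra_simps)
    then obtain Y where "Y \<subseteq> ?n \<inter> F - H - Z" "card Y = k" "finite Y"
      by (rule obtain_subset_with_card_n)
    then show "\<exists>Y. (Y \<subseteq> F - H \<and> Y \<subseteq> ?n \<and> k \<le> card Y) \<and> finite Y \<and> card Y \<le> k \<and> Y \<inter> Z = {}"
      by (intro exI[of _ Y]) auto
  qed
  then obtain g where g': "\<forall>x\<in>P. (g x \<subseteq> F - H \<and> g x \<subseteq> (if I x then ?out x else ?in x) \<and> k \<le> card (g x)) \<and>
      finite (g x) \<and> card (g x) \<le> k" and gd: "disjoint_family_on g P"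
    by (elim exE conjE)
  have g: "g x \<subseteq> F - H \<and> g x \<subseteq> (if I x then ?out x else ?in x) \<and>
      k \<le> card (g x) \<and> finite (g x) \<and> card (g x) \<le> k" if "x \<in> P" for x
    using bspec[OF g' that] by (elim conjE, intro conjI) assumption+
  define D where "D j = C j \<union> {x \<in> X. c x = j} \<union> (if j = 1 then H else {}) \<union> (\<Union>x\<in>{x \<in> P. c x = j}. g x)" for j
  have gF: "g x \<subseteq> F - H" if "x \<in> P" for x using g[OF that] by (elim conjE)
  have Dcases: "z \<in> C l \<or> z \<in> X \<and> c z = l \<or> l = 1 \<and> z \<in> H \<or> (\<exists>x\<in>P. c x = l \<and> z \<in> g x \<and> z \<in> F - H)"
    if z: "z \<in> D l" for z l
  proof -
    have "z \<in> C l \<or> z \<in> X \<and> c z = l \<or> l = 1 \<and> z \<in> H \<or> (\<exists>x\<in>P. c x = l \<and> z \<in> g x)"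
      using z unfolding D_def by (auto split: if_splits)
    then show ?thesis using gF by blast
  qed
  have DV: "D j \<subseteq> V" if "j \<in> {1..t}" for j
  proof -
    have "(\<Union>x\<in>{x \<in> P. c x = j}. g x) \<subseteq> F" using gF by blast
    then show ?thesis using C(1)[OF that] XV HF FX(6) by (auto simp: D_def)
  qed
  have CD: "C j \<subseteq> D j" for j by (auto simp: D_def)
  have card: "card (D j) \<le> card (C j) + (3 * k + 1) * card (EA \<union> EB)" for j
  proof -
    have "card {x \<in> X. c x = j} \<le> card X" using finX by (intro card_mono) auto
    moreover have "card (if j = 1 then H else {}) \<le> card H" by simp
    moreover have "card (\<Union>x\<in>{x \<in> P. c x = j}. g x) \<le> k * card P"
    proof -
      have "card (\<Union>x\<in>{x \<in> P. c x = j}. g x) \<le> (\<Sum>x\<in>{x \<in> P. c x = j}. card (g x))"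
        using finP by (intro card_UN_le) auto
      also have "\<dots> \<le> (\<Sum>x\<in>{x \<in> P. c x = j}. k)" using g by (intro sum_mono) auto
      also have "\<dots> \<le> k * card P" using finP by (simp add: card_mono)
      finally show ?thesis .
    qed
    ultimately have "card (D j) \<le> card (C j) + card X + card H + k * card P"
      unfolding D_def
      using card_Un_le[of "C j \<union> {x \<in> X. c x = j} \<union> (if j = 1 then H else {})" "\<Union>x\<in>{x \<in> P. c x = j}. g x"]
        card_Un_le[of "C j \<union> {x \<in> X. c x = j}" "if j = 1 then H else {}"]
        card_Un_le[of "C j" "{x \<in> X. c x = j}"] by linarith
    also have "\<dots> \<le> card (C j) + (3 * k + 1) * card X" using cH by (simp add: algebra_simps)
    finally show ?thesis using mult_le_mono2[OF cX, of "3 * k + 1"] by linarith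
  qed
  have disj: "disjoint_family_on D {1..t}"
    unfolding disjoint_family_on_def
  proof (intro ballI impI)
    fix i j assume ij: "i \<in> {1..t}" "j \<in> {1..t}" "i \<noteq> j"
    show "D i \<inter> D j = {}"
    proof (rule ccontr)
      assume "D i \<inter> D j \<noteq> {}"
      then obtain z where z: "z \<in> D i" "z \<in> D j" by blast
      consider "z \<in> W0" | "z \<in> X" | "z \<in> H" | "z \<in> F - H"
        using Dcases[OF z(1)] ij(1) unfolding W0_def by blast
      then show False
      proof cases
        case 1
        have "z \<in> C l" if "z \<in> D l" for l
          using Dcases[OF that] 1 FX(2,3) HF by blast
        then show ?thesis using z ij C(2) unfolding disjoint_family_on_def by blast
      next
        case 2
        have "c z = l" if "z \<in> D l" "l \<in> {1..t}" for l
          using Dcases[OF that(1)] that(2) 2 FX(1,3) HF unfolding W0_def by blast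
        then show ?thesis using z ij by metis
      next
        case 3
        have "l = 1" if "z \<in> D l" "l \<in> {1..t}" for l
          using Dcases[OF that(1)] that(2) 3 FX(1,2) HF unfolding W0_def by blast
        then show ?thesis using z ij by metis
      next
        case 4
        have *: "\<exists>x\<in>P. c x = l \<and> z \<in> g x" if "z \<in> D l" "l \<in> {1..t}" for l
          using Dcases[OF that(1)] that(2) 4 FX(1,2) unfolding W0_def by blast
        obtain x y where xy: "x \<in> P" "c x = i" "z \<in> g x" "y \<in> P" "c y = j" "z \<in> g y"
          using *[OF z(1) ij(1)] *[OF z(2) ij(2)] by blast
        then have "x \<noteq> y" using ij(3) by metis
        then show ?thesis using disjoint_family_onD[OF gd xy(1,4)] xy(3,6) by blast
      qed
    qed
  qed
  have rob: "robust E k EA EB (D j) x" if j: "j \<in> {1..t}" and x: "x \<in> D j" for j x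
  proof -
    consider "x \<in> C j" | "x \<in> F" | "x \<in> X" "c x = j"
      using Dcases[OF x] HF by blast
    then show ?thesis
    proof cases
      case 1
      then show ?thesis using robust_mono[OF C(3)[OF j 1] CD] by blast
    next
      case 2
      then show ?thesis using x FX by (auto simp: robust_def intro!: acc.base)
    next
      case 3
      have BD: "B j \<subseteq> D j" using 3 by (auto simp: B_def D_def c_def)
      have gD: "g x \<subseteq> D j" if "x \<in> P" using 3 that by (auto simp: D_def)
      have hD: "h x \<subseteq> D j" if "x \<in> U" using 3 that cU[OF that] by (auto simp: D_def H_def)
      have xV: "x \<in> V" using 3 XV by blast
      \<comment> \<open>In each case the supplied in-neighbours lie outside \<open>EA\<close>, so
        one \<open>step\<close> above the base suffices; the dual claim works with neighbours
        outside \<open>EB\<close>.\<close>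
      have "acc (D j) E k (D j - EA) x"
      proof (cases "x \<in> EA")
        case True
        consider "I x" | "\<not> I x" "Q x" | "\<not> I x" "\<not> Q x" by blast
        then show ?thesis
        proof cases
          case 1
          then show ?thesis using c2[OF 3(1) 1] BD 3 fin_n
            by (intro acc_neighbours[of "(?in x - EA) \<inter> B j" V]) (auto simp: c_def)
        next
          case 2
          then have "x \<in> P" using 3 by (simp add: P_def)
          then show ?thesis using g[of x] gD 2 FX by (intro acc_neighbours[of "g x" V]) auto
        next
          case 33: 3
          then have "x \<in> U" using 3 by (simp add: U_def)
          then show ?thesis using h[of x] hD True FX fin_n
            by (intro acc_neighbours[of "h x \<inter> ?in x" V]) auto
        qed
      qed (use x in \<open>auto intro: acc.base\<close>)
      moreover have "acc (D j) E\<inverse>\<inverse> k (D j - EB) x"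
      proof (cases "x \<in> EB")
        case True
        consider "Q x" | "\<not> Q x" "I x" | "\<not> I x" "\<not> Q x" by blast
        then show ?thesis
        proof cases
          case 1
          then have "c x = c0 x" using excl[OF xV] by (auto simp: c_def c1_def)
          then show ?thesis using c0[OF 3(1) 1] CD[of j] 3 fin_n
            by (intro acc_neighbours[of "(?out x - (EA \<union> EB)) \<inter> C j" V]) auto
        next
          case 2
          then have "x \<in> P" using 3 by (simp add: P_def)
          then show ?thesis using g[of x] gD 2 FX by (intro acc_neighbours[of "g x" V]) auto
        next
          case 33: 3
          then have "x \<in> U" using 3 by (simp add: U_def)
          then show ?thesis using h[of x] hD True FX fin_n
            by (intro acc_neighbours[of "h x \<inter> ?out x" V]) auto
        qed
      qed (use x in \<open>auto intro: acc.base\<close>)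
      ultimately show ?thesis by (simp add: robust_def)
    qed
  qed
  have "EA \<union> EB \<subseteq> (\<Union>j\<in>{1..t}. D j)"
  proof
    fix x assume x: "x \<in> EA \<union> EB"
    show "x \<in> (\<Union>j\<in>{1..t}. D j)"
    proof (cases "x \<in> W0")
      case True
      then show ?thesis using CD by (auto simp: W0_def)
    next
      case False
      then have "x \<in> X" using x by (simp add: X_def)
      then show ?thesis using c[of x] by (intro UN_I[of "c x"]) (auto simp: D_def)
    qed
  qed
  then show ?thesis by (intro exI[of _ D] conjI ballI CD DV rob card disj)
qed

section \<open>Hubs\<close>

text \<open>A union over the roots, not an intersection: a vertex outside it is dominated by each
  single \<open>A v\<close>, hence by whichever hub survives a deletion.\<close>

definition undom :: "'a set \<Rightarrow> ('a \<Rightarrow> 'a \<Rightarrow> bool) \<Rightarrow> ('a \<Rightarrow> 'a set) \<Rightarrow> 'a set \<Rightarrow> 'a set" where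
  "undom V E A X = (\<Union>v\<in>X. {x \<in> V. \<forall>y\<in>A v. \<not> E y x})"

text \<open>In-dominating hubs are the same notion for the reversed tournament; there
  \<open>N\<close> consists of out-neighbours of \<open>a\<close>.\<close>

definition hub :: "'a set \<Rightarrow> ('a \<Rightarrow> 'a \<Rightarrow> bool) \<Rightarrow> nat \<Rightarrow> 'a set \<Rightarrow> 'a set \<Rightarrow> 'a \<Rightarrow> bool" where
  "hub V E k A N a \<longleftrightarrow> A \<subseteq> V \<and> N \<subseteq> V \<and> a \<in> A \<and> (\<forall>x\<in>A - {a}. E a x) \<and>
     card N = k \<and> A \<inter> N = {} \<and> (\<forall>e\<in>N. E e a)"

text \<open>\<open>N\<close> is taken from the at least \<open>K\<close> in-neighbours of
  \<open>a\<close>, of which at most \<open>card Z + c + 1\<close> are excluded. The root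
  \<open>v\<close> is left out of the size count because all roots are set aside before hubs are
  chosen greedily.\<close>

lemma hub_exists:
  assumes T: "tournament V E" and v: "v \<in> V" "v \<notin> Z" "finite Z"
    and deg: "\<forall>x\<in>V. K \<le> card (nin V E x)" and K: "card Z + c + 1 + k \<le> K"
  shows "\<exists>A N a. hub V E k A N a \<and> v \<in> A \<and> (A \<union> N) \<inter> Z = {} \<and> card (A \<union> N - {v}) \<le> c + k \<and>
    2 ^ c * card {x \<in> V. \<forall>y\<in>A. \<not> E y x} \<le> 2 ^ c * (card Z + 1) + card (nin V E v)"
proof -
  obtain A a where A: "A \<subseteq> V" "A \<inter> Z = {}" "v \<in> A" "a \<in> A" "card A \<le> c + 1"
    "\<forall>x\<in>A - {a}. E a x"
    "2 ^ c * card {x \<in> V. \<forall>y\<in>A. \<not> E y x} \<le> 2 ^ c * (card Z + 1) + card (nin V E v)"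
    using dominating_set[OF T v(1,3,2), of c] by (elim exE conjE) (rule that)
  have finA: "finite A" using A T finite_subset by (auto simp: tournament_def)
  have "card (nin V E a) \<le> card ((nin V E a - A - Z) \<union> (A \<union> Z))"
    using finA v finite_nin[OF T] by (intro card_mono) auto
  also have "\<dots> \<le> card (nin V E a - A - Z) + (card A + card Z)"
    using card_Un_le[of "nin V E a - A - Z" "A \<union> Z"] card_Un_le[of A Z] by linarith
  finally have "k \<le> card (nin V E a - A - Z)" using bspec[OF deg, of a] A K by fastforce
  then obtain N where N: "N \<subseteq> nin V E a - A - Z" "card N = k" "finite N"
    by (rule obtain_subset_with_card_n)
  have "card (A \<union> N - {v}) = card (A \<union> N) - 1" using A finA N by simp
  also have "\<dots> \<le> c + k" using card_Un_le[of A N] A N by simp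
  finally have "card (A \<union> N - {v}) \<le> c + k" .
  moreover have "hub V E k A N a" using A N unfolding hub_def nin_def by blast
  moreover have "(A \<union> N) \<inter> Z = {}" using A N by blast
  ultimately show ?thesis using A by blast
qed

text \<open>The hubs at \<open>Xm\<close> are out-dominating, those at \<open>Xp\<close> in-dominating. The two supply conditions
  are not dual to each other: for out-neighbours also \<open>EA\<close> can be avoided, because the smallest
  out-degrees are assumed to be at least as large as the smallest in-degrees (\<open>dm \<le> dp\<close> below).
  This is what stops the recursive demand for further neighbours.\<close>
locale hub_system =
  fixes V :: "'a set" and E :: "'a \<Rightarrow> 'a \<Rightarrow> bool" and k K G s :: nat and Xm Xp :: "'a set"
    and A N :: "'a \<Rightarrow> 'a set" and a :: "'a \<Rightarrow> 'a" and core EA EB :: "'a set"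
  assumes tour: "tournament V E" and k: "1 \<le> k"
    and deg_in: "\<And>x. x \<in> V \<Longrightarrow> K \<le> card (nin V E x)"
    and deg_out: "\<And>x. x \<in> V \<Longrightarrow> K \<le> card (nin V E\<inverse>\<inverse> x)"
    and fin_roots: "finite Xm" "finite Xp"
    and roots_disj: "Xm \<inter> Xp = {}" and card_roots: "card Xm = G" "card Xp = G"
    and hub_m: "\<And>v. v \<in> Xm \<Longrightarrow> hub V E k (A v) (N v) (a v)"
    and hub_p: "\<And>v. v \<in> Xp \<Longrightarrow> hub V E\<inverse>\<inverse> k (A v) (N v) (a v)"
    and hub_card: "\<And>v. v \<in> Xm \<union> Xp \<Longrightarrow> card (A v \<union> N v) \<le> s"
    and hub_disj: "disjoint_family_on (\<lambda>v. A v \<union> N v) (Xm \<union> Xp)"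
    and core_eq: "core = (\<Union>v\<in>Xm \<union> Xp. A v \<union> N v)"
    and EA_eq: "EA = undom V E A Xm" and EB_eq: "EB = undom V E\<inverse>\<inverse> A Xp"
    and supply_in: "\<And>y. y \<in> V - core \<Longrightarrow> K \<le> 2 * card (nin V E y - (EA \<union> core))"
    and supply_out: "\<And>y. y \<in> V - core \<Longrightarrow> K \<le> 2 * card (nin V E\<inverse>\<inverse> y - (EA \<union> EB \<union> core))"

text \<open>A root of degree \<open>d\<close> misses about \<open>d / 2 ^ c\<close> vertices, so
  \<open>8 * G \<le> 2 ^ c\<close> limits all roots of one kind to an eighth of \<open>dm\<close> or
  \<open>dp\<close>, up to an additive term absorbed by \<open>K\<close>. A vertex outside
  \<open>core\<close> is no root and has at least these degrees, so half of \<open>K\<close> is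
  still available to it.\<close>

lemma hub_system_exists:
  fixes V :: "'a set"
  assumes T: "tournament V E" and k: "1 \<le> k"
    and deg: "\<And>x. x \<in> V \<Longrightarrow> K \<le> card (nin V E x)" "\<And>x. x \<in> V \<Longrightarrow> K \<le> card (nin V E\<inverse>\<inverse> x)"
    and X: "Xm \<subseteq> V" "Xp \<subseteq> V" "Xm \<inter> Xp = {}" "card Xm = G" "card Xp = G"
    and dm: "\<And>v. v \<in> Xm \<Longrightarrow> card (nin V E v) \<le> dm"
      "\<And>x. x \<in> V - (Xm \<union> Xp) \<Longrightarrow> dm \<le> card (nin V E x)"
    and dp: "\<And>v. v \<in> Xp \<Longrightarrow> card (nin V E\<inverse>\<inverse> v) \<le> dp"
      "\<And>x. x \<in> V - (Xm \<union> Xp) \<Longrightarrow> dp \<le> card (nin V E\<inverse>\<inverse> x)"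
    and dmp: "dm \<le> dp"
    and s: "s = c + 1 + k" and Gc: "8 * G \<le> 2 ^ c"
    and K: "2 * G * s + s \<le> K" "16 * G * (2 * G * s + 1) + 16 * G * s \<le> K"
  shows "\<exists>A N a core EA EB. hub_system V E k K G s Xm Xp A N a core EA EB \<and>
    2 ^ c * card (EA \<union> EB) \<le> 2 ^ c * (2 * G * (2 * G * s + 1)) + 2 * G * card V"
proof -
  have fin: "finite V" using T by (simp add: tournament_def)
  have finX: "finite Xm" "finite Xp" using X fin finite_subset by blast+
  let ?R = "Xm \<union> Xp"
  have cR: "card ?R = 2 * G" using X finX by (simp add: card_Un_disjoint)
  \<comment> \<open>Reversing the edges for roots in \<open>Xp\<close> lets a single greedy choice
    build both kinds of hub.\<close>
  define D where "D v = (if v \<in> Xm then E else E\<inverse>\<inverse>)" for v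
  have TD: "tournament V (D v)" for v using T tournament_flip[OF T] by (simp add: D_def)
  have degD: "\<forall>x\<in>V. K \<le> card (nin V (D v) x)" for v using deg by (simp add: D_def)
  define P where "P v Y \<longleftrightarrow> (\<exists>A N a. hub V (D v) k A N a \<and> A \<union> N = insert v Y \<and> v \<notin> Y \<and> Y \<inter> ?R = {} \<and>
    2 ^ c * card {x \<in> V. \<forall>y\<in>A. \<not> D v y x} \<le> 2 ^ c * (2 * G * s + 1) + card (nin V (D v) v))" for v Y
  have "\<exists>g. (\<forall>v\<in>?R. P v (g v) \<and> finite (g v) \<and> card (g v) \<le> c + k) \<and> disjoint_family_on g ?R"
  proof (rule greedy_disjoint)
    fix v and F :: "'a set" assume v: "v \<in> ?R" and F: "finite F" "card F + (c + k) \<le> (c + k) * card ?R"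
    \<comment> \<open>All other roots are forbidden from the outset, so no hub can swallow the root
      of a later one.\<close>
    let ?Z = "(F \<union> ?R) - {v}"
    have vV: "v \<in> V" using v X by blast
    have "card ?Z \<le> card (F \<union> ?R)" using F finX by (intro card_mono) auto
    also have "\<dots> \<le> card F + 2 * G" using card_Un_le[of F ?R] cR by simp
    also have "\<dots> \<le> 2 * G * s" using F(2) cR by (simp add: s algebra_simps)
    finally have cZ: "card ?Z \<le> 2 * G * s" .
    then have cK: "card ?Z + c + 1 + k \<le> K" using K(1) by (simp add: s)
    have vZ: "v \<notin> ?Z" "finite ?Z" using F finX by auto
    obtain A N a where h: "hub V (D v) k A N a" "v \<in> A" "(A \<union> N) \<inter> ?Z = {}"
      "card (A \<union> N - {v}) \<le> c + k"
      "2 ^ c * card {x \<in> V. \<forall>y\<in>A. \<not> D v y x} \<le> 2 ^ c * (card ?Z + 1) + card (nin V (D v) v)"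
      using hub_exists[OF TD[of v] vV vZ degD cK] by (elim exE conjE) (rule that)
    have le: "2 ^ c * card {x \<in> V. \<forall>y\<in>A. \<not> D v y x} \<le> 2 ^ c * (2 * G * s + 1) + card (nin V (D v) v)"
      by (rule order_trans[OF h(5)]) (use cZ in simp)
    have eq: "A \<union> N = insert v (A \<union> N - {v})" "v \<notin> A \<union> N - {v}" "(A \<union> N - {v}) \<inter> ?R = {}"
      using h(2,3) by blast+
    have "P v (A \<union> N - {v})"
      unfolding P_def by (intro exI[of _ A] exI[of _ N] exI[of _ a] conjI h(1) le eq)
    moreover have "finite (A \<union> N - {v})" using h(1) fin finite_subset by (auto simp: hub_def)
    ultimately show "\<exists>Y. P v Y \<and> finite Y \<and> card Y \<le> c + k \<and> Y \<inter> F = {}"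
      using h(3,4) by (intro exI[of _ "A \<union> N - {v}"]) auto
  qed (use finX in auto)
  then obtain g where g: "\<forall>v\<in>?R. P v (g v) \<and> finite (g v) \<and> card (g v) \<le> c + k"
    and gd: "disjoint_family_on g ?R" by (elim exE conjE)
  let ?Q = "\<lambda>v p. hub V (D v) k (fst p) (fst (snd p)) (snd (snd p)) \<and>
      fst p \<union> fst (snd p) = insert v (g v) \<and> v \<notin> g v \<and> g v \<inter> ?R = {} \<and>
      2 ^ c * card {x \<in> V. \<forall>y\<in>fst p. \<not> D v y x} \<le> 2 ^ c * (2 * G * s + 1) + card (nin V (D v) v)"
  have "\<forall>v\<in>?R. \<exists>p. ?Q v p"
  proof
    fix v assume "v \<in> ?R"
    with g have "P v (g v)" by blast
    then obtain A N a where "hub V (D v) k A N a \<and> A \<union> N = insert v (g v) \<and> v \<notin> g v \<and> g v \<inter> ?R = {} \<and>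
      2 ^ c * card {x \<in> V. \<forall>y\<in>A. \<not> D v y x} \<le> 2 ^ c * (2 * G * s + 1) + card (nin V (D v) v)"
      unfolding P_def by (elim exE)
    then have "?Q v (A, N, a)" by simp
    then show "\<exists>p. ?Q v p" by (rule exI)
  qed
  then obtain f where f: "\<forall>v\<in>?R. ?Q v (f v)" by (rule bchoice[THEN exE])
  define A where "A v = fst (f v)" for v
  define N where "N v = fst (snd (f v))" for v
  define a where "a v = snd (snd (f v))" for v
  have h: "hub V (D v) k (A v) (N v) (a v) \<and> A v \<union> N v = insert v (g v) \<and>
      v \<notin> g v \<and> g v \<inter> ?R = {} \<and>
      2 ^ c * card {x \<in> V. \<forall>y\<in>A v. \<not> D v y x} \<le> 2 ^ c * (2 * G * s + 1) + card (nin V (D v) v)"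
    if "v \<in> ?R" for v using bspec[OF f that] unfolding A_def N_def a_def .
  define core where "core = (\<Union>v\<in>?R. A v \<union> N v)"
  define EA where "EA = undom V E A Xm"
  define EB where "EB = undom V E\<inverse>\<inverse> A Xp"
  have Dm: "D v = E" if "v \<in> Xm" for v using that by (simp add: D_def)
  have Dp: "D v = E\<inverse>\<inverse>" if "v \<in> Xp" for v using that X by (auto simp: D_def)
  have hm: "hub V E k (A v) (N v) (a v)" "2 ^ c * card {x \<in> V. \<forall>y\<in>A v. \<not> E y x} \<le> 2 ^ c * (2 * G * s + 1) + card (nin V E v)"
    if "v \<in> Xm" for v using h[of v] Dm[OF that] that by auto
  have hp: "hub V E\<inverse>\<inverse> k (A v) (N v) (a v)" "2 ^ c * card {x \<in> V. \<forall>y\<in>A v. \<not> E\<inverse>\<inverse> y x} \<le> 2 ^ c * (2 * G * s + 1) + card (nin V E\<inverse>\<inverse> v)"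
    if "v \<in> Xp" for v using h[of v] Dp[OF that] that by auto
  have cardU: "card (A v \<union> N v) \<le> s" if "v \<in> ?R" for v
    using h[OF that] g that by (simp add: s)
  have disj: "disjoint_family_on (\<lambda>v. A v \<union> N v) ?R"
    unfolding disjoint_family_on_def
  proof (intro ballI impI)
    fix v w assume vw: "v \<in> ?R" "w \<in> ?R" "v \<noteq> w"
    have "g v \<inter> g w = {}" using disjoint_family_onD[OF gd vw] .
    moreover have "A v \<union> N v = insert v (g v)" "A w \<union> N w = insert w (g w)"
      "w \<notin> g v" "v \<notin> g w" using h[OF vw(1)] h[OF vw(2)] vw by blast+
    ultimately show "(A v \<union> N v) \<inter> (A w \<union> N w) = {}" using vw(3) by simp
  qed
  have ccore: "card core \<le> 2 * G * s"
  proof -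
    have "card core \<le> (\<Sum>v\<in>?R. card (A v \<union> N v))" unfolding core_def using finX by (intro card_UN_le) auto
    also have "\<dots> \<le> (\<Sum>v\<in>?R. s)" using cardU by (intro sum_mono)
    finally show ?thesis using cR by simp
  qed
  have und: "2 ^ c * card (undom V D' A Y) \<le> G * (2 ^ c * (2 * G * s + 1)) + G * d"
    if "card Y = G" "finite Y" "\<And>v. v \<in> Y \<Longrightarrow> 2 ^ c * card {x \<in> V. \<forall>y\<in>A v. \<not> D' y x} \<le> 2 ^ c * (2 * G * s + 1) + d"
    for D' :: "'a \<Rightarrow> 'a \<Rightarrow> bool" and Y d
  proof -
    have "2 ^ c * card (undom V D' A Y) \<le> 2 ^ c * (\<Sum>v\<in>Y. card {x \<in> V. \<forall>y\<in>A v. \<not> D' y x})"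
      unfolding undom_def using that(2) by (intro mult_le_mono2 card_UN_le)
    also have "\<dots> = (\<Sum>v\<in>Y. 2 ^ c * card {x \<in> V. \<forall>y\<in>A v. \<not> D' y x})" by (simp add: sum_distrib_left)
    also have "\<dots> \<le> (\<Sum>v\<in>Y. 2 ^ c * (2 * G * s + 1) + d)" using that(3) by (intro sum_mono)
    also have "\<dots> = G * (2 ^ c * (2 * G * s + 1)) + G * d" using that(1) by (simp add: add_mult_distrib2)
    finally show ?thesis .
  qed
  have EAd: "2 ^ c * card EA \<le> G * (2 ^ c * (2 * G * s + 1)) + G * dm"
    unfolding EA_def using hm(2) dm(1) by (intro und[OF X(4) finX(1)]) (meson add_left_mono order_trans)
  have EBd: "2 ^ c * card EB \<le> G * (2 ^ c * (2 * G * s + 1)) + G * dp"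
    unfolding EB_def using hp(2) dp(1) by (intro und[OF X(5) finX(2)]) (meson add_left_mono order_trans)
  have nn: "card (nin V D' v) \<le> card V" for D' and v :: 'a
    using fin by (intro card_mono) (auto simp: nin_def)
  \<comment> \<open>The same estimate with the trivial degree bound \<open>card V\<close> yields the
    second conclusion.\<close>
  have EAn: "2 ^ c * card EA \<le> G * (2 ^ c * (2 * G * s + 1)) + G * card V"
    unfolding EA_def using hm(2) nn by (intro und[OF X(4) finX(1)]) (meson add_left_mono order_trans)
  have EBn: "2 ^ c * card EB \<le> G * (2 ^ c * (2 * G * s + 1)) + G * card V"
    unfolding EB_def using hp(2) nn by (intro und[OF X(5) finX(2)]) (meson add_left_mono order_trans)
  have eight: "8 * e \<le> 8 * (G * (2 * G * s + 1)) + d"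
    if "2 ^ c * e \<le> G * (2 ^ c * (2 * G * s + 1)) + G * d" for e d
  proof -
    have "2 ^ c * (8 * e) \<le> 2 ^ c * (8 * (G * (2 * G * s + 1))) + (8 * G) * d"
      using that by (simp add: algebra_simps)
    also have "\<dots> \<le> 2 ^ c * (8 * (G * (2 * G * s + 1))) + 2 ^ c * d" using Gc by (intro add_left_mono mult_le_mono1)
    finally have "2 ^ c * (8 * e) \<le> 2 ^ c * (8 * (G * (2 * G * s + 1)) + d)" by (simp add: add_mult_distrib2)
    then show ?thesis by (subst (asm) mult_le_cancel1) simp
  qed
  note EA8 = eight[OF EAd] and EB8 = eight[OF EBd]
  have fins: "finite EA" "finite EB" "finite core"
    using fin finX finite_subset h by (auto simp: EA_def EB_def undom_def core_def g)
  have minus: "card S \<le> card (S - Y) + card Y" if "finite S" "finite Y" for S Y :: "'a set"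
    by (metis card_Un_le card_mono finite_Diff finite_Un order_trans Un_Diff_cancel2 Un_upper1 that)
  have out_core: "y \<notin> ?R" if "y \<notin> core" for y
    using that h unfolding core_def by blast
  have "hub_system V E k K G s Xm Xp A N a core EA EB"
  proof
    fix y assume y: "y \<in> V - core"
    then have yR: "y \<in> V - (Xm \<union> Xp)" using out_core by blast
    have "card (nin V E y) \<le> card (nin V E y - (EA \<union> core)) + (card EA + card core)"
      using minus[OF finite_nin[OF T, of y], of "EA \<union> core"] fins card_Un_le[of EA core] by simp
    moreover have "dm \<le> card (nin V E y)" "K \<le> card (nin V E y)" using dm(2)[OF yR] deg(1) y by auto
    ultimately show "K \<le> 2 * card (nin V E y - (EA \<union> core))"
      using EA8 ccore K(2) by (simp add: algebra_simps)
    have "card (nin V E\<inverse>\<inverse> y) \<le> card (nin V E\<inverse>\<inverse> y - (EA \<union> EB \<union> core)) + (card EA + card EB + card core)"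
      using minus[OF finite_nin[OF tournament_flip[OF T], of y], of "EA \<union> EB \<union> core"] fins
        card_Un_le[of "EA \<union> EB" core] card_Un_le[of EA EB] by simp
    moreover have "dp \<le> card (nin V E\<inverse>\<inverse> y)" "K \<le> card (nin V E\<inverse>\<inverse> y)" using dp(2)[OF yR] deg(2) y by auto
    ultimately show "K \<le> 2 * card (nin V E\<inverse>\<inverse> y - (EA \<union> EB \<union> core))"
      using EA8 EB8 ccore K(2) dmp by (simp add: algebra_simps)
  qed (use T k deg finX X hm hp cardU disj in \<open>simp_all add: core_def EA_def EB_def\<close>)
  moreover have "2 ^ c * card (EA \<union> EB) \<le> 2 ^ c * (2 * G * (2 * G * s + 1)) + 2 * G * card V"
    using mult_le_mono2[OF card_Un_le[of EA EB], of "2 ^ c"] EAn EBn by (simp add: algebra_simps)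
  ultimately show ?thesis by blast
qed

section \<open>Reserved neighbours and linking paths\<close>

lemma card_le_Diff_plus:
  assumes "finite S" "finite Y"
  shows "card S \<le> card (S - Y) + card Y"
proof -
  have "card S \<le> card ((S - Y) \<union> Y)" using assms by (intro card_mono) auto
  also have "\<dots> \<le> card (S - Y) + card Y" by (rule card_Un_le)
  finally show ?thesis .
qed

section \<open>Disjoint walks in highly connected tournaments\<close>

lemma walk_set:
  "walk F xs \<Longrightarrow> F \<subseteq> U \<times> U \<Longrightarrow> hd xs \<in> U \<Longrightarrow> set xs \<subseteq> U"
  unfolding walk_def by (induction xs rule: induct_list012) auto

lemma walk_reach:
  assumes "walk F xs" "\<And>x y. (x, y) \<in> F \<Longrightarrow> E x y"
  shows "reach (set xs) E (hd xs) (last xs)"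
  using assms(1)
proof (induction xs rule: induct_list012)
  case (3 x y zs)
  then have "reach (set (y # zs)) E y (last (y # zs))" "E x y"
    using assms(2) by (auto simp: walk_def)
  moreover have "set (y # zs) \<subseteq> set (x # y # zs)" by auto
  ultimately have "reach (set (x # y # zs)) E y (last (x # y # zs))"
    using reach_mono[of "set (y # zs)" E y "last (y # zs)" "set (x # y # zs)"] by simp
  moreover have "reach (set (x # y # zs)) E x y" using \<open>E x y\<close> by (intro reach_edge) auto
  ultimately show ?case using reach_trans[of "set (x # y # zs)" E x y] by simp
qed (auto simp: walk_def)

lemma reach_walk:
  assumes "reach U E x y" "x \<in> U"
  shows "\<exists>xs. walk {(x, y). x \<in> U \<and> y \<in> U \<and> E x y} xs \<and> hd xs = x \<and> last xs = y \<and> set xs \<subseteq> U"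
  using assms(1) unfolding reach_def
proof (induction rule: rtranclp_induct)
  case base
  then show ?case using assms(2) by (intro exI[of _ "[x]"]) (auto simp: walk_def)
next
  case (step y z)
  then obtain xs where xs: "walk {(x, y). x \<in> U \<and> y \<in> U \<and> E x y} xs" "hd xs = x" "last xs = y" "set xs \<subseteq> U"
    by blast
  then have "xs \<noteq> []" by (simp add: walk_def)
  then show ?case using xs step
    by (intro exI[of _ "xs @ [z]"]) (auto simp: walk_def successively_append_iff)
qed

text \<open>A separator with fewer than \<open>M\<close> vertices forms together with
  \<open>B\<close> a set of fewer than \<open>K\<close> vertices, whose deletion leaves a path
  between surviving points of \<open>X\<close> and \<open>Y\<close>.\<close>

lemma disjoint_walks:
  assumes T: "tournament V E" and con: "strongly_k_connected V E K"
    and B: "B \<subseteq> V" and P: "X \<subseteq> V - B" "Y \<subseteq> V - B" "M \<le> card X" "M \<le> card Y"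
    and K: "card B + M \<le> K"
  shows "\<exists>P. (\<forall>i<M. walk {(x, y). x \<in> V - B \<and> y \<in> V - B \<and> E x y} (P i) \<and> hd (P i) \<in> X \<and> last (P i) \<in> Y) \<and>
    disjoint_family_on (\<lambda>i. set (P i)) {..<M}"
proof (rule Menger)
  have fin: "finite V" using T by (simp add: tournament_def)
  then show "finite X" using P(1) finite_subset by blast
  have "finite ((V - B) \<times> (V - B))" using fin by simp
  then show "finite {(x, y). x \<in> V - B \<and> y \<in> V - B \<and> E x y}" by (rule rev_finite_subset) auto
  fix S assume S: "finite S" "separates {(x, y). x \<in> V - B \<and> y \<in> V - B \<and> E x y} X Y S"
  show "M \<le> card S"
  proof (rule ccontr)
    assume "\<not> M \<le> card S"
    then have lt: "card S < M" by simp
    have "\<not> X \<subseteq> S" "\<not> Y \<subseteq> S" using lt P(3,4) card_mono[OF S(1)] by (meson leD le_trans)+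
    then obtain x y where xy: "x \<in> X" "x \<notin> S" "y \<in> Y" "y \<notin> S" by blast
    \<comment> \<open>A separator may contain points outside \<open>V\<close>, while only subsets of
      \<open>V\<close> can be deleted.\<close>
    let ?S = "B \<union> (S \<inter> V)"
    have "card ?S \<le> card B + card (S \<inter> V)" by (rule card_Un_le)
    also have "card (S \<inter> V) \<le> card S" using S(1) by (simp add: card_mono)
    finally have "card ?S < K" using lt K by linarith
    moreover have "?S \<subseteq> V" using B by blast
    ultimately have "strongly_connected (V - ?S) E"
      using con[unfolded strongly_k_connected_def, THEN conjunct2, rule_format, of ?S] by simp
    moreover have xy': "x \<in> V - ?S" "y \<in> V - ?S" using xy P by auto
    ultimately have "reach (V - ?S) E x y" unfolding strongly_connected_reach by blast
    then obtain xs where xs: "walk {(x, y). x \<in> V - ?S \<and> y \<in> V - ?S \<and> E x y} xs" "hd xs = x"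
      "last xs = y" "set xs \<subseteq> V - ?S" using reach_walk[OF _ xy'(1)] by blast
    have "walk {(x, y). x \<in> V - B \<and> y \<in> V - B \<and> E x y} xs" using xs(1) by (rule walk_mono) auto
    then have "set xs \<inter> S \<noteq> {}" using S(2) xs(2,3) xy unfolding separates_def by blast
    then show False using xs(4) by auto
  qed
qed

text \<open>A vertex other than the two ends has all of \<open>Na\<close> as in-neighbours and all
  of \<open>Nb\<close> as out-neighbours, so it becomes robust through the hubs. Only the two ends
  need reserved neighbours, whatever the length of the path.\<close>

definition linked :: "('a \<Rightarrow> 'a \<Rightarrow> bool) \<Rightarrow> 'a set \<Rightarrow> 'a set \<Rightarrow> 'a list \<Rightarrow> bool" where
  "linked E Nb Na ys \<longleftrightarrow> ys \<noteq> [] \<and> reach (set ys) E (hd ys) (last ys) \<and>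
     (\<exists>f\<in>Nb. E f (hd ys)) \<and> (\<exists>e\<in>Na. E (last ys) e) \<and>
     (\<forall>p\<in>set ys. p \<noteq> last ys \<longrightarrow> (\<forall>e\<in>Na. E e p)) \<and> (\<forall>p\<in>set ys. p \<noteq> hd ys \<longrightarrow> (\<forall>f\<in>Nb. E p f))"

text \<open>In a shortest such walk no vertex before the last one sends an edge to \<open>Na\<close>, so it is dominated
  by all of \<open>Na\<close>.\<close>
lemma linked_subwalk:
  assumes T: "tournament V E" and U: "U \<subseteq> V" "Na \<subseteq> V - U" "Nb \<subseteq> V - U"
    and xs: "walk {(x, y). x \<in> U \<and> y \<in> U \<and> E x y} xs" "hd xs \<in> U"
    and hits: "\<exists>f\<in>Nb. E f (hd xs)" "\<exists>e\<in>Na. E (last xs) e"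
  shows "\<exists>ys. set ys \<subseteq> set xs \<and> linked E Nb Na ys"
proof -
  let ?F = "{(x, y). x \<in> U \<and> y \<in> U \<and> E x y}"
  define Q where "Q ys \<longleftrightarrow> walk ?F ys \<and> set ys \<subseteq> set xs \<and> (\<exists>f\<in>Nb. E f (hd ys)) \<and> (\<exists>e\<in>Na. E (last ys) e)" for ys
  have "Q xs" using xs hits by (simp add: Q_def)
  then obtain ys where ys: "Q ys" and min: "\<And>zs. Q zs \<Longrightarrow> length ys \<le> length zs"
    using ex_has_least_nat[of Q xs length] by blast
  have ne: "ys \<noteq> []" using ys by (simp add: Q_def walk_def)
  have "set xs \<subseteq> U" using xs by (intro walk_set[OF xs(1)]) auto
  then have yU: "set ys \<subseteq> U" using ys by (auto simp: Q_def)
  have "E e p" if p: "p \<in> set ys" "p \<noteq> last ys" and e: "e \<in> Na" for p e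
  proof (rule ccontr)
    assume "\<not> E e p"
    then have ep: "E p e" using tournament_total[OF T, of p e] p e yU U by blast
    obtain as bs where ab: "ys = as @ p # bs" using p(1) by (metis split_list)
    have bs: "bs \<noteq> []" using p(2) ab by auto
    have "walk ?F (as @ [p])"
      using ys unfolding Q_def ab walk_def by (simp add: successively_append_iff)
    moreover have "hd (as @ [p]) = hd ys" using ab by (cases as) auto
    ultimately have "Q (as @ [p])" using ys ep e unfolding Q_def by (auto simp: ab)
    then have "length ys \<le> length (as @ [p])" by (rule min)
    then show False using ab bs by simp
  qed
  moreover have "E p f" if p: "p \<in> set ys" "p \<noteq> hd ys" and f: "f \<in> Nb" for p f
  proof (rule ccontr)
    assume "\<not> E p f"
    then have fp: "E f p" using tournament_total[OF T, of f p] p f yU U by blast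
    obtain as bs where ab: "ys = as @ p # bs" using p(1) by (metis split_list)
    have as: "as \<noteq> []" using p(2) ab by auto
    have "Q (p # bs)"
      using ys fp f ab unfolding Q_def walk_def
      by (auto simp: successively_append_iff)
    then have "length ys \<le> length (p # bs)" by (rule min)
    then show False using ab as by simp
  qed
  moreover have "reach (set ys) E (hd ys) (last ys)"
    using ys unfolding Q_def by (intro walk_reach[of ?F]) auto
  ultimately have "linked E Nb Na ys" using ys ne unfolding linked_def Q_def by blast
  then show ?thesis using ys unfolding Q_def by blast
qed

section \<open>Reserved neighbours that make hub vertices robust\<close>

context hub_system
begin

abbreviation rob where "rob \<equiv> robust E k EA EB"

lemma finite_V: "finite V"
  using tour by (simp add: tournament_def)

lemma fin_nin: "finite (nin V E x)" "finite (nin V E\<inverse>\<inverse> x)"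
  using finite_V by (auto simp: nin_def)

lemma hub_subset: "v \<in> Xm \<union> Xp \<Longrightarrow> A v \<union> N v \<subseteq> V"
  using hub_m hub_p unfolding hub_def by blast

lemma core_subset: "core \<subseteq> V"
  unfolding core_eq using hub_subset by blast

lemma finite_core: "finite core"
  using core_subset finite_V finite_subset by blast

lemma card_core: "card core \<le> 2 * G * s"
proof -
  have "card core \<le> (\<Sum>v\<in>Xm \<union> Xp. card (A v \<union> N v))"
    unfolding core_eq using fin_roots by (intro card_UN_le) auto
  also have "\<dots> \<le> (\<Sum>v\<in>Xm \<union> Xp. s)" using hub_card by (intro sum_mono)
  also have "\<dots> = 2 * G * s" using fin_roots roots_disj card_roots by (simp add: card_Un_disjoint)
  finally show ?thesis .
qed

lemma choose_neighbours:
  assumes "finite S" "finite F" "card F + k \<le> card S"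
  obtains Z where "Z \<subseteq> S" "Z \<inter> F = {}" "card Z = k" "finite Z"
proof -
  have "k \<le> card (S - F)" using card_le_Diff_plus[OF assms(1,2)] assms(3) by linarith
  then obtain Z where "Z \<subseteq> S - F" "card Z = k" "finite Z" by (rule obtain_subset_with_card_n)
  then show thesis by (intro that[of Z]) auto
qed

text \<open>The set \<open>X\<close> consists of \<open>k\<close> in-neighbours of \<open>y\<close> outside \<open>EA\<close> and of \<open>k\<close> out-neighbours outside
  \<open>EA \<union> EB\<close> of each of these and of \<open>y\<close>.\<close>
lemma kit_exists:
  assumes y: "y \<in> V - core" and F: "finite F" "2 * (card F + k) \<le> K"
  shows "\<exists>X. X \<subseteq> V - core \<and> X \<inter> F = {} \<and> finite X \<and> card X \<le> 3 * k ^ 2 \<and>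
    (\<forall>x\<in>insert y X. rob (insert y X) x)"
proof -
  have "card F + k \<le> card (nin V E y - (EA \<union> core))" using supply_in[OF y] F(2) by simp
  then obtain Z where Z: "Z \<subseteq> nin V E y - (EA \<union> core)" "Z \<inter> F = {}" "card Z = k" "finite Z"
    using choose_neighbours[OF _ F(1)] fin_nin by (metis finite_Diff)
  have ZV: "z \<in> V - core" if "z \<in> insert y Z" for z using that Z y by (auto simp: nin_def)
  have "\<exists>W. W \<subseteq> nin V E\<inverse>\<inverse> z - (EA \<union> EB \<union> core) \<and> W \<inter> F = {} \<and> card W = k \<and> finite W" if "z \<in> insert y Z" for z
  proof -
    have "card F + k \<le> card (nin V E\<inverse>\<inverse> z - (EA \<union> EB \<union> core))"
      using supply_out[OF ZV[OF that]] F(2) by simp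
    then show ?thesis using choose_neighbours[OF _ F(1)] fin_nin by (metis finite_Diff)
  qed
  then obtain W where W: "\<And>z. z \<in> insert y Z \<Longrightarrow>
      W z \<subseteq> nin V E\<inverse>\<inverse> z - (EA \<union> EB \<union> core) \<and> W z \<inter> F = {} \<and> card (W z) = k \<and> finite (W z)"
    by metis
  define X where "X = Z \<union> (\<Union>z\<in>insert y Z. W z)"
  have WX: "W z \<subseteq> X" if "z \<in> insert y Z" for z using that unfolding X_def by blast
  have "card (\<Union>z\<in>insert y Z. W z) \<le> (\<Sum>z\<in>insert y Z. card (W z))"
    using Z by (intro card_UN_le) auto
  also have "\<dots> \<le> (\<Sum>z\<in>insert y Z. k)" using W by (intro sum_mono) auto
  also have "\<dots> \<le> (k + 1) * k" using Z(3) card_insert_le_Suc[of y Z] mult_le_mono1[of "card (insert y Z)" "k + 1" k] by simp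
  finally have "card X \<le> k + (k + 1) * k" unfolding X_def using card_Un_le[of Z "\<Union>z\<in>insert y Z. W z"] Z(3) by linarith
  also have "\<dots> \<le> 3 * k ^ 2" using k by (cases k) (auto simp: power2_eq_square)
  finally have cX: "card X \<le> 3 * k ^ 2" .
  have accz: "rob (insert y X) z" if z: "z \<in> insert y Z" for z
  proof -
    have "acc (insert y X) E\<inverse>\<inverse> k (insert y X - EB) z"
      using W[OF z] WX[OF z] by (intro acc_neighbours[of "W z" V]) auto
    moreover have "acc (insert y X) E k (insert y X - EA) z"
    proof (cases "z = y")
      case True
      then show ?thesis using Z unfolding X_def by (intro acc_neighbours[of Z V]) auto
    next
      case False
      then have "z \<in> Z" using z by simp
      then have "z \<in> insert y X - EA" using Z unfolding X_def by auto
      then show ?thesis by (rule acc.base)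
    qed
    ultimately show ?thesis by (simp add: robust_def)
  qed
  have "rob (insert y X) x" if xX: "x \<in> insert y X" for x
  proof (cases "x \<in> insert y Z")
    case False
    then obtain z where z: "z \<in> insert y Z" "x \<in> W z" using xX unfolding X_def by auto
    then have "x \<in> insert y X - EA" "x \<in> insert y X - EB" using W[OF z(1)] xX by auto
    then show ?thesis by (simp add: robust_def acc.base)
  qed (rule accz)
  moreover have "X \<subseteq> V - core" "X \<inter> F = {}" "finite X"
  proof -
    have *: "W z \<subseteq> V - core" "W z \<inter> F = {}" "finite (W z)" if "z \<in> insert y Z" for z
      using W[OF that] by (auto simp: nin_def)
    show "X \<subseteq> V - core" using *(1) ZV unfolding X_def by blast
    show "X \<inter> F = {}" using *(2) Z(2) unfolding X_def by blast
    show "finite X" unfolding X_def using *(3) Z(4) by simp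
  qed
  ultimately show ?thesis using cX by blast
qed

text \<open>Inside \<open>core\<close> only the degree of \<open>x\<close> is controlled, so the
  \<open>k\<close> in-neighbours and \<open>k\<close> out-neighbours chosen for it may be
  exceptional. They lie outside \<open>core\<close>, however, and each of them gets a set from
  \<open>kit_exists\<close>.\<close>

lemma reserve_exists:
  assumes x: "x \<in> V" and F: "finite F" "2 * (card F + card core + k) \<le> K"
  shows "\<exists>X. X \<subseteq> V - core \<and> X \<inter> F = {} \<and> finite X \<and> card X \<le> 8 * k ^ 3 \<and>
    (\<forall>z\<in>insert x X. rob (insert x X) z)"
proof -
  have le: "card (F \<union> core) + k \<le> K" using card_Un_le[of F core] F(2) by simp
  have fFc: "finite (F \<union> core)" using F finite_core by simp
  obtain Yi where Yi: "Yi \<subseteq> nin V E x" "Yi \<inter> (F \<union> core) = {}" "card Yi = k" "finite Yi"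
    using choose_neighbours[OF fin_nin(1) fFc, of x] deg_in[OF x] le by (metis le_trans)
  obtain Yo where Yo: "Yo \<subseteq> nin V E\<inverse>\<inverse> x" "Yo \<inter> (F \<union> core) = {}" "card Yo = k" "finite Yo"
    using choose_neighbours[OF fin_nin(2) fFc, of x] deg_out[OF x] le by (metis le_trans)
  let ?Y = "Yi \<union> Yo"
  have YV: "?Y \<subseteq> V - core" using Yi Yo by (auto simp: nin_def)
  have K2: "2 * (card F + k) \<le> K" using F(2) by simp
  have "\<forall>y\<in>?Y. \<exists>X. X \<subseteq> V - core \<and> X \<inter> F = {} \<and> finite X \<and> card X \<le> 3 * k ^ 2 \<and>
    (\<forall>z\<in>insert y X. rob (insert y X) z)" using kit_exists[OF _ F(1) K2] YV by blast
  then obtain g where g: "\<forall>y\<in>?Y. g y \<subseteq> V - core \<and> g y \<inter> F = {} \<and> finite (g y) \<and> card (g y) \<le> 3 * k ^ 2 \<and>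
    (\<forall>z\<in>insert y (g y). rob (insert y (g y)) z)" by (rule bchoice[THEN exE])
  define X where "X = ?Y \<union> (\<Union>y\<in>?Y. g y)"
  have cY: "card ?Y \<le> 2 * k" using card_Un_le[of Yi Yo] Yi Yo by simp
  have "card (\<Union>y\<in>?Y. g y) \<le> (\<Sum>y\<in>?Y. card (g y))" using Yi Yo by (intro card_UN_le) auto
  also have "\<dots> \<le> (\<Sum>y\<in>?Y. 3 * k ^ 2)" using g by (intro sum_mono) auto
  also have "\<dots> \<le> (2 * k) * (3 * k ^ 2)" using cY by (simp add: mult_le_mono1)
  finally have "card X \<le> 2 * k + 6 * k ^ 3"
    unfolding X_def using card_Un_le[of ?Y "\<Union>y\<in>?Y. g y"] cY by (simp add: power2_eq_square power3_eq_cube)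
  also have "\<dots> \<le> 8 * k ^ 3" using k power_increasing[of 1 3 k] by simp
  finally have cX: "card X \<le> 8 * k ^ 3" .
  have rX: "rob (insert x X) z" if z: "z \<in> X" for z
  proof -
    obtain y where y: "y \<in> ?Y" "z \<in> insert y (g y)" using z unfolding X_def by blast
    have "rob (insert y (g y)) z" using g y by blast
    moreover have "insert y (g y) \<subseteq> insert x X" using y unfolding X_def by blast
    ultimately show ?thesis by (rule robust_mono)
  qed
  have "acc (insert x X) E k (insert x X - EA) x"
    using Yi rX unfolding X_def robust_def by (intro acc.step[of Yi]) (auto simp: nin_def)
  moreover have "acc (insert x X) E\<inverse>\<inverse> k (insert x X - EB) x"
    using Yo rX unfolding X_def robust_def by (intro acc.step[of Yo]) (auto simp: nin_def)
  ultimately have "\<forall>z\<in>insert x X. rob (insert x X) z" using rX by (simp add: robust_def)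
  moreover have "X \<subseteq> V - core" "X \<inter> F = {}" "finite X"
    using YV Yi Yo g unfolding X_def by auto
  ultimately show ?thesis using cX by blast
qed

text \<open>\<open>robust\<close> is monotone in the set, so the vertices of one hub can be treated
  separately and their reserved sets may overlap; only different hubs have to stay disjoint.\<close>

lemma block_exists:
  assumes v: "v \<in> Xm \<union> Xp" and F: "finite F" "2 * (card F + card core + k) \<le> K"
  shows "\<exists>X. (X \<subseteq> V - core \<and> (\<forall>z\<in>A v \<union> N v \<union> X. rob (A v \<union> N v \<union> X) z)) \<and>
    finite X \<and> card X \<le> s * (8 * k ^ 3) \<and> X \<inter> F = {}"
proof -
  let ?U = "A v \<union> N v"
  have UV: "?U \<subseteq> V" by (rule hub_subset[OF v])
  then have finU: "finite ?U" using finite_V finite_subset by blast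
  have "\<forall>x\<in>?U. \<exists>X. X \<subseteq> V - core \<and> X \<inter> F = {} \<and> finite X \<and> card X \<le> 8 * k ^ 3 \<and>
    (\<forall>z\<in>insert x X. rob (insert x X) z)" using reserve_exists[OF _ F] UV by blast
  then obtain g where g: "\<forall>x\<in>?U. g x \<subseteq> V - core \<and> g x \<inter> F = {} \<and> finite (g x) \<and> card (g x) \<le> 8 * k ^ 3 \<and>
    (\<forall>z\<in>insert x (g x). rob (insert x (g x)) z)" by (rule bchoice[THEN exE])
  define X where "X = (\<Union>x\<in>?U. g x)"
  have "card X \<le> (\<Sum>x\<in>?U. card (g x))" unfolding X_def by (rule card_UN_le[OF finU])
  also have "\<dots> \<le> (\<Sum>x\<in>?U. 8 * k ^ 3)" using g by (intro sum_mono) auto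
  also have "\<dots> \<le> s * (8 * k ^ 3)" using hub_card[OF v] by (simp add: mult_le_mono1)
  finally have cX: "card X \<le> s * (8 * k ^ 3)" .
  have "rob (?U \<union> X) z" if z: "z \<in> ?U \<union> X" for z
  proof -
    obtain x where x: "x \<in> ?U" "z \<in> insert x (g x)" using z unfolding X_def by blast
    have "rob (insert x (g x)) z" using g x by blast
    moreover have "insert x (g x) \<subseteq> ?U \<union> X" using x unfolding X_def by blast
    ultimately show ?thesis by (rule robust_mono)
  qed
  moreover have "X \<subseteq> V - core" "X \<inter> F = {}" "finite X" using g finU unfolding X_def by auto
  ultimately show ?thesis using cX by blast
qed

lemma blocks_exist:
  assumes K: "2 * (16 * G * s * k ^ 3 + 2 * G * s + k) \<le> K"
  shows "\<exists>B. (\<forall>v\<in>Xm \<union> Xp. A v \<union> N v \<subseteq> B v \<and> B v \<subseteq> V \<and> (\<forall>x\<in>B v. rob (B v) x)) \<and>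
    disjoint_family_on B (Xm \<union> Xp) \<and> card (\<Union>v\<in>Xm \<union> Xp. B v) \<le> 2 * G * s + 16 * G * s * k ^ 3"
proof -
  let ?R = "Xm \<union> Xp"
  have cR: "card ?R = 2 * G" using fin_roots roots_disj card_roots by (simp add: card_Un_disjoint)
  have "\<exists>g. (\<forall>v\<in>?R. (g v \<subseteq> V - core \<and> (\<forall>z\<in>A v \<union> N v \<union> g v. rob (A v \<union> N v \<union> g v) z)) \<and>
    finite (g v) \<and> card (g v) \<le> s * (8 * k ^ 3)) \<and> disjoint_family_on g ?R"
  proof (rule greedy_disjoint)
    fix v and F :: "'a set"
    assume v: "v \<in> ?R" and F: "finite F" "card F + s * (8 * k ^ 3) \<le> s * (8 * k ^ 3) * card ?R"
    have "2 * (card F + card core + k) \<le> K" using F(2) K card_core cR by (simp add: algebra_simps)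
    then show "\<exists>X. (X \<subseteq> V - core \<and> (\<forall>z\<in>A v \<union> N v \<union> X. rob (A v \<union> N v \<union> X) z)) \<and>
      finite X \<and> card X \<le> s * (8 * k ^ 3) \<and> X \<inter> F = {}" by (rule block_exists[OF v F(1)])
  qed (use fin_roots in auto)
  then obtain g where g: "\<forall>v\<in>?R. (g v \<subseteq> V - core \<and> (\<forall>z\<in>A v \<union> N v \<union> g v. rob (A v \<union> N v \<union> g v) z)) \<and>
    finite (g v) \<and> card (g v) \<le> s * (8 * k ^ 3)" and gd: "disjoint_family_on g ?R"
    by (elim exE conjE)
  define B where "B v = A v \<union> N v \<union> g v" for v
  have gv: "g v \<subseteq> V - core" "card (g v) \<le> s * (8 * k ^ 3)" if "v \<in> ?R" for v
    using bspec[OF g that] by auto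
  have Uc: "A v \<union> N v \<subseteq> core" if "v \<in> ?R" for v using that unfolding core_eq by blast
  have "disjoint_family_on B ?R"
    unfolding disjoint_family_on_def
  proof (intro ballI impI)
    fix v w assume vw: "v \<in> ?R" "w \<in> ?R" "v \<noteq> w"
    show "B v \<inter> B w = {}"
      using disjoint_family_onD[OF gd vw] disjoint_family_onD[OF hub_disj vw] gv(1)[OF vw(1)] gv(1)[OF vw(2)]
        Uc[OF vw(1)] Uc[OF vw(2)] unfolding B_def by blast
  qed
  moreover have "card (\<Union>v\<in>?R. B v) \<le> 2 * G * s + 16 * G * s * k ^ 3"
  proof -
    have "card (\<Union>v\<in>?R. B v) \<le> (\<Sum>v\<in>?R. card (B v))" using fin_roots by (intro card_UN_le) auto
    also have "\<dots> \<le> (\<Sum>v\<in>?R. s + s * (8 * k ^ 3))"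
    proof (rule sum_mono)
      fix v assume v: "v \<in> ?R"
      show "card (B v) \<le> s + s * (8 * k ^ 3)"
        unfolding B_def using card_Un_le[of "A v \<union> N v" "g v"] hub_card[OF v] gv(2)[OF v] by linarith
    qed
    also have "\<dots> = 2 * G * s + 16 * G * s * k ^ 3" using cR by (simp add: algebra_simps)
    finally show ?thesis .
  qed
  moreover have "A v \<union> N v \<subseteq> B v \<and> B v \<subseteq> V \<and> (\<forall>x\<in>B v. rob (B v) x)" if v: "v \<in> ?R" for v
    using bspec[OF g v] hub_subset[OF v] unfolding B_def by blast
  ultimately show ?thesis by (intro exI[of _ B] conjI ballI) auto
qed

end

section \<open>Linking paths and their selection\<close>

context hub_system
begin

text \<open>The \<open>r\<close> ports of a hub are neighbours of one vertex of its
  \<open>N\<close>. Menger's theorem joins the ports at \<open>Xp\<close> to those at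
  \<open>Xm\<close> in an uncontrolled pairing; disjoint walks have distinct end ports, so no hub is
  used more than \<open>r\<close> times.\<close>

lemma linked_family_exists:
  assumes con: "strongly_k_connected V E K"
    and L: "L \<subseteq> V" "core \<subseteq> L" and K: "card L + 2 * G * r \<le> K"
  shows "\<exists>\<alpha> \<beta> S. (\<forall>i<G * r. \<alpha> i \<in> Xm \<and> \<beta> i \<in> Xp \<and> set (S i) \<subseteq> V - L \<and>
      linked E (N (\<beta> i)) (N (\<alpha> i)) (S i)) \<and> disjoint_family_on (\<lambda>i. set (S i)) {..<G * r} \<and>
    (\<forall>v. card {i \<in> {..<G * r}. \<alpha> i = v} \<le> r \<and> card {i \<in> {..<G * r}. \<beta> i = v} \<le> r)"
proof -
  let ?R = "Xm \<union> Xp"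
  have cR: "card ?R = 2 * G" using fin_roots roots_disj card_roots by (simp add: card_Un_disjoint)
  have finL: "finite L" using L finite_V finite_subset by blast
  define D where "D v = (if v \<in> Xm then E else E\<inverse>\<inverse>)" for v
  have NL: "N v \<subseteq> L" if "v \<in> ?R" for v using L(2) that unfolding core_eq by blast
  have Nne: "\<exists>e. e \<in> N v" if "v \<in> ?R" for v
  proof -
    have "card (N v) = k" using that hub_m hub_p unfolding hub_def by blast
    then have "N v \<noteq> {}" using k by auto
    then show ?thesis by blast
  qed
  have "\<exists>g. (\<forall>v\<in>?R. (g v \<subseteq> V - L \<and> r \<le> card (g v) \<and> (\<exists>e\<in>N v. g v \<subseteq> nin V (D v) e)) \<and>
      finite (g v) \<and> card (g v) \<le> r) \<and> disjoint_family_on g ?R"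
  proof (rule greedy_disjoint)
    fix v and F :: "'a set"
    assume v: "v \<in> ?R" and F: "finite F" "card F + r \<le> r * card ?R"
    obtain e where e: "e \<in> N v" using Nne[OF v] by blast
    then have eV: "e \<in> V" using NL[OF v] L by blast
    have "K \<le> card (nin V (D v) e)" using deg_in[OF eV] deg_out[OF eV] by (simp add: D_def)
    moreover have "card (F \<union> L) \<le> card F + card L" by (rule card_Un_le)
    moreover have "finite (nin V (D v) e)" using fin_nin by (simp add: D_def)
    moreover have "finite (F \<union> L)" using F finL by simp
    ultimately have "r \<le> card (nin V (D v) e - (F \<union> L))"
      using card_le_Diff_plus[of "nin V (D v) e" "F \<union> L"] F(2) K cR by (simp add: algebra_simps)
    then obtain X where X: "X \<subseteq> nin V (D v) e - (F \<union> L)" "card X = r" "finite X"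
      by (rule obtain_subset_with_card_n)
    have "X \<subseteq> V - L" "X \<subseteq> nin V (D v) e" "X \<inter> F = {}" using X(1) by (auto simp: nin_def)
    then show "\<exists>X. (X \<subseteq> V - L \<and> r \<le> card X \<and> (\<exists>e\<in>N v. X \<subseteq> nin V (D v) e)) \<and>
        finite X \<and> card X \<le> r \<and> X \<inter> F = {}"
      using X e by (intro exI[of _ X]) auto
  qed (use fin_roots in auto)
  then obtain g where g: "\<forall>v\<in>?R. (g v \<subseteq> V - L \<and> r \<le> card (g v) \<and> (\<exists>e\<in>N v. g v \<subseteq> nin V (D v) e)) \<and>
      finite (g v) \<and> card (g v) \<le> r" and gd: "disjoint_family_on g ?R" by (elim exE conjE)
  have gv: "g v \<subseteq> V - L" "card (g v) = r" "finite (g v)" "\<exists>e\<in>N v. g v \<subseteq> nin V (D v) e" if "v \<in> ?R" for v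
    using bspec[OF g that] by auto
  have cardU: "card (\<Union>v\<in>Y. g v) = G * r" if "Y \<subseteq> ?R" "card Y = G" "finite Y" for Y
  proof -
    have "card (\<Union>v\<in>Y. g v) = (\<Sum>v\<in>Y. card (g v))"
    proof (rule card_UN_disjoint[OF that(3)])
      show "\<forall>v\<in>Y. finite (g v)" using gv(3) that(1) by blast
      show "\<forall>i\<in>Y. \<forall>j\<in>Y. i \<noteq> j \<longrightarrow> g i \<inter> g j = {}"
        using disjoint_family_onD[OF gd] that(1) by (meson subsetD)
    qed
    also have "\<dots> = (\<Sum>v\<in>Y. r)" using gv(2) that(1) by (intro sum.cong) auto
    finally show ?thesis using that by simp
  qed
  have PXY: "(\<Union>v\<in>Xp. g v) \<subseteq> V - L" "(\<Union>v\<in>Xm. g v) \<subseteq> V - L" using gv(1) by blast+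
  have cXY: "G * r \<le> card (\<Union>v\<in>Xp. g v)" "G * r \<le> card (\<Union>v\<in>Xm. g v)"
    using cardU[of Xp] cardU[of Xm] card_roots fin_roots by simp_all
  have K': "card L + G * r \<le> K" using K by simp
  let ?F = "{(x, y). x \<in> V - L \<and> y \<in> V - L \<and> E x y}"
  obtain P where P: "\<forall>i<G * r. walk ?F (P i) \<and> hd (P i) \<in> (\<Union>v\<in>Xp. g v) \<and> last (P i) \<in> (\<Union>v\<in>Xm. g v)"
    and Pd: "disjoint_family_on (\<lambda>i. set (P i)) {..<G * r}"
    using disjoint_walks[OF tour con L(1) PXY cXY K'] by (elim exE conjE)
  have "\<forall>i\<in>{..<G * r}. \<exists>v. v \<in> Xm \<and> last (P i) \<in> g v" using P by blast
  then obtain \<alpha> where \<alpha>: "\<forall>i\<in>{..<G * r}. \<alpha> i \<in> Xm \<and> last (P i) \<in> g (\<alpha> i)" by (rule bchoice[THEN exE])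
  have "\<forall>i\<in>{..<G * r}. \<exists>v. v \<in> Xp \<and> hd (P i) \<in> g v" using P by blast
  then obtain \<beta> where \<beta>: "\<forall>i\<in>{..<G * r}. \<beta> i \<in> Xp \<and> hd (P i) \<in> g (\<beta> i)" by (rule bchoice[THEN exE])
  have Pne: "P i \<noteq> []" if "i < G * r" for i using P that by (simp add: walk_def)
  \<comment> \<open>Shortening may move the ends away from the ports, but they remain attached to
    \<open>N\<close> of the same two hubs.\<close>
  have "\<forall>i\<in>{..<G * r}. \<exists>ys. set ys \<subseteq> set (P i) \<and> linked E (N (\<beta> i)) (N (\<alpha> i)) ys"
  proof
    fix i assume i: "i \<in> {..<G * r}"
    have \<alpha>i: "\<alpha> i \<in> Xm" "last (P i) \<in> g (\<alpha> i)" and \<beta>i: "\<beta> i \<in> Xp" "hd (P i) \<in> g (\<beta> i)"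
      using \<alpha> \<beta> i by blast+
    have *: "\<beta> i \<notin> Xm" using \<beta>i roots_disj by blast
    have "\<exists>e\<in>N (\<alpha> i). E (last (P i)) e" using gv(4)[of "\<alpha> i"] \<alpha>i by (auto simp: D_def nin_def)
    moreover have "\<exists>f\<in>N (\<beta> i). E f (hd (P i))" using gv(4)[of "\<beta> i"] \<beta>i * by (auto simp: D_def nin_def)
    moreover have "N (\<alpha> i) \<subseteq> V - (V - L)" "N (\<beta> i) \<subseteq> V - (V - L)"
      using NL[of "\<alpha> i"] NL[of "\<beta> i"] \<alpha>i \<beta>i L(1) by auto
    moreover have "hd (P i) \<in> V - L" using gv(1)[of "\<beta> i"] \<beta>i by blast
    moreover have "walk ?F (P i)" using P i by blast
    ultimately show "\<exists>ys. set ys \<subseteq> set (P i) \<and> linked E (N (\<beta> i)) (N (\<alpha> i)) ys"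
      by (intro linked_subwalk[OF tour, of "V - L"]) auto
  qed
  then obtain S where S: "\<forall>i\<in>{..<G * r}. set (S i) \<subseteq> set (P i) \<and> linked E (N (\<beta> i)) (N (\<alpha> i)) (S i)"
    by (rule bchoice[THEN exE])
  have PL: "set (P i) \<subseteq> V - L" if i: "i < G * r" for i
    using P i PXY by (intro walk_set[of ?F]) auto
  have inj: "inj_on (\<lambda>i. last (P i)) {..<G * r}" "inj_on (\<lambda>i. hd (P i)) {..<G * r}"
    using disjoint_family_onD[OF Pd] Pne
    by (intro inj_onI; metis disjoint_iff last_in_set hd_in_set lessThan_iff)+
  have c\<alpha>: "card {i \<in> {..<G * r}. \<alpha> i = v} \<le> r" for v
  proof (cases "v \<in> Xm")
    case True
    have "card {i \<in> {..<G * r}. \<alpha> i = v} \<le> card (g v)"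
      using \<alpha> gv(3)[of v] True by (intro card_inj_on_le[OF inj_on_subset[OF inj(1)]]) auto
    then show ?thesis using gv(2)[of v] True by simp
  next
    case False
    then have "{i \<in> {..<G * r}. \<alpha> i = v} = {}" using \<alpha> by blast
    then show ?thesis by (metis card.empty le0)
  qed
  have c\<beta>: "card {i \<in> {..<G * r}. \<beta> i = v} \<le> r" for v
  proof (cases "v \<in> Xp")
    case True
    have "card {i \<in> {..<G * r}. \<beta> i = v} \<le> card (g v)"
      using \<beta> gv(3)[of v] True by (intro card_inj_on_le[OF inj_on_subset[OF inj(2)]]) auto
    then show ?thesis using gv(2)[of v] True by simp
  next
    case False
    then have "{i \<in> {..<G * r}. \<beta> i = v} = {}" using \<beta> by blast
    then show ?thesis by (metis card.empty le0)
  qed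
  have Sd: "disjoint_family_on (\<lambda>i. set (S i)) {..<G * r}"
    unfolding disjoint_family_on_def
  proof (intro ballI impI)
    fix i j assume ij: "i \<in> {..<G * r}" "j \<in> {..<G * r}" "i \<noteq> j"
    show "set (S i) \<inter> set (S j) = {}"
      using disjoint_family_onD[OF Pd ij] bspec[OF S ij(1)] bspec[OF S ij(2)] by blast
  qed
  have main: "\<alpha> i \<in> Xm \<and> \<beta> i \<in> Xp \<and> set (S i) \<subseteq> V - L \<and> linked E (N (\<beta> i)) (N (\<alpha> i)) (S i)" if "i < G * r" for i
    using \<alpha> \<beta> S PL[OF that] that by blast
  then have all: "\<forall>i<G * r. \<alpha> i \<in> Xm \<and> \<beta> i \<in> Xp \<and> set (S i) \<subseteq> V - L \<and> linked E (N (\<beta> i)) (N (\<alpha> i)) (S i)"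
    by simp
  have fib: "\<forall>v. card {i \<in> {..<G * r}. \<alpha> i = v} \<le> r \<and> card {i \<in> {..<G * r}. \<beta> i = v} \<le> r"
    using c\<alpha> c\<beta> by simp
  show ?thesis
    by (intro exI[of _ \<alpha>] exI[of _ \<beta>] exI[of _ S] conjI all Sd fib)
qed

text \<open>Disjoint sets \<open>g i\<close> are reserved for the ends of all paths first, although
  they may meet other paths. Path \<open>i\<close> is in conflict with every path that shares one of
  its hubs or meets \<open>g i\<close>; an independent set among the short paths has neither
  defect.\<close>

lemma linked_selection:
  assumes L: "L \<subseteq> V" "core \<subseteq> L" and G: "G = 10 * k * t" and r: "12 * k ^ 2 + 1 \<le> r"
    and K: "2 * (card L + 6 * k ^ 2 * (G * r) + k) \<le> K"
    and S: "\<forall>i<G * r. set (S i) \<subseteq> V - L \<and> S i \<noteq> []"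
    and Sd: "disjoint_family_on (\<lambda>i. set (S i)) {..<G * r}"
    and fib: "\<forall>v. card {i \<in> {..<G * r}. \<alpha> i = v} \<le> r \<and> card {i \<in> {..<G * r}. \<beta> i = v} \<le> r"
  shows "\<exists>Y kt. Y \<subseteq> {..<G * r} \<and> card Y = k * t \<and> inj_on \<alpha> Y \<and> inj_on \<beta> Y \<and>
    (\<forall>i\<in>Y. G * r * card (set (S i)) \<le> 2 * card V \<and> kt i \<subseteq> V - L \<and> card (kt i) \<le> 6 * k ^ 2 \<and>
      (\<forall>x\<in>{hd (S i), last (S i)} \<union> kt i. rob ({hd (S i), last (S i)} \<union> kt i) x)) \<and>
    disjoint_family_on (\<lambda>i. set (S i) \<union> kt i) Y"
proof -
  let ?M = "G * r"
  have finL: "finite L" using L finite_V finite_subset by blast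
  have "\<exists>g. (\<forall>i\<in>{..<?M}. (g i \<subseteq> V - L \<and>
      (\<forall>x\<in>{hd (S i), last (S i)} \<union> g i. rob ({hd (S i), last (S i)} \<union> g i) x)) \<and>
      finite (g i) \<and> card (g i) \<le> 6 * k ^ 2) \<and> disjoint_family_on g {..<?M}"
  proof (rule greedy_disjoint)
    fix i and F :: "'a set"
    assume i: "i \<in> {..<?M}" and F: "finite F" "card F + 6 * k ^ 2 \<le> 6 * k ^ 2 * card {..<?M}"
    let ?u = "hd (S i)" and ?w = "last (S i)"
    have "?u \<in> set (S i)" "?w \<in> set (S i)" "set (S i) \<subseteq> V - L" using S i by auto
    then have uw: "?u \<in> V - core" "?w \<in> V - core" using L(2) by blast+
    have F': "finite (F \<union> L)" "2 * (card (F \<union> L) + k) \<le> K"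
      using F K finL card_Un_le[of F L] by auto
    obtain X where X: "X \<subseteq> V - core" "X \<inter> (F \<union> L) = {}" "finite X" "card X \<le> 3 * k ^ 2"
      "\<forall>x\<in>insert ?u X. rob (insert ?u X) x"
      using kit_exists[OF uw(1) F'] by (elim exE conjE) (rule that)
    obtain Z where Z: "Z \<subseteq> V - core" "Z \<inter> (F \<union> L) = {}" "finite Z" "card Z \<le> 3 * k ^ 2"
      "\<forall>x\<in>insert ?w Z. rob (insert ?w Z) x"
      using kit_exists[OF uw(2) F'] by (elim exE conjE) (rule that)
    let ?Y = "X \<union> Z"
    have "rob ({?u, ?w} \<union> ?Y) x" if "x \<in> {?u, ?w} \<union> ?Y" for x
    proof (cases "x \<in> insert ?u X")
      case True
      have "rob (insert ?u X) x" using X(5) True by (rule bspec)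
      then show ?thesis by (rule robust_mono) blast
    next
      case False
      then have "x \<in> insert ?w Z" using that by blast
      with Z(5) have "rob (insert ?w Z) x" by (rule bspec)
      then show ?thesis by (rule robust_mono) blast
    qed
    moreover have "?Y \<subseteq> V - L" "?Y \<inter> F = {}" using X Z by blast+
    moreover have "card ?Y \<le> 6 * k ^ 2" using card_Un_le[of X Z] X(4) Z(4) by simp
    ultimately show "\<exists>Y. (Y \<subseteq> V - L \<and> (\<forall>x\<in>{?u, ?w} \<union> Y. rob ({?u, ?w} \<union> Y) x)) \<and>
        finite Y \<and> card Y \<le> 6 * k ^ 2 \<and> Y \<inter> F = {}"
      using X(3) Z(3) by (intro exI[of _ ?Y] conjI ballI) auto
  qed simp
  then obtain g where g: "\<forall>i\<in>{..<?M}. (g i \<subseteq> V - L \<and>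
      (\<forall>x\<in>{hd (S i), last (S i)} \<union> g i. rob ({hd (S i), last (S i)} \<union> g i) x)) \<and>
      finite (g i) \<and> card (g i) \<le> 6 * k ^ 2" and gd: "disjoint_family_on g {..<?M}" by (elim exE conjE)
  define Sh where "Sh = {i \<in> {..<?M}. ?M * card (set (S i)) \<le> 2 * card V}"
  define Ln where "Ln = {..<?M} - Sh"
  have finSh: "finite Sh" "finite Ln" by (auto simp: Sh_def Ln_def)
  have total: "(\<Sum>i\<in>J. card (set (S i))) \<le> card V" if "J \<subseteq> {..<?M}" for J
  proof -
    have "(\<Sum>i\<in>J. card (set (S i))) = card (\<Union>i\<in>J. set (S i))"
    proof (rule card_UN_disjoint[symmetric])
      show "finite J" using that finite_subset by blast
      show "\<forall>i\<in>J. \<forall>j\<in>J. i \<noteq> j \<longrightarrow> set (S i) \<inter> set (S j) = {}"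
        using disjoint_family_onD[OF Sd] that by (meson subsetD)
    qed simp
    also have "\<dots> \<le> card V" using S that finite_V by (intro card_mono UN_least) auto
    finally show ?thesis .
  qed
  \<comment> \<open>A long path has more than \<open>2 * card V / ?M\<close> vertices, so more than
    half of the \<open>?M\<close> disjoint paths cannot be long.\<close>
  have "2 * card Ln \<le> ?M"
  proof (rule ccontr)
    assume *: "\<not> 2 * card Ln \<le> ?M"
    have "card Ln * (2 * card V + 1) = (\<Sum>i\<in>Ln. 2 * card V + 1)" by simp
    also have "\<dots> \<le> (\<Sum>i\<in>Ln. ?M * card (set (S i)))"
      by (intro sum_mono) (auto simp: Ln_def Sh_def)
    also have "\<dots> = ?M * (\<Sum>i\<in>Ln. card (set (S i)))" by (simp only: sum_distrib_left)
    also have "\<dots> \<le> ?M * card V" using total[of Ln] by (simp add: Ln_def)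
    also have "\<dots> \<le> 2 * card Ln * card V" using * by (intro mult_le_mono1) simp
    finally show False using * by (simp add: algebra_simps)
  qed
  moreover have "card Ln = ?M - card Sh" unfolding Ln_def by (subst card_Diff_subset) (auto simp: Sh_def)
  moreover have "card Sh \<le> ?M" using card_mono[of "{..<?M}" Sh] by (auto simp: Sh_def)
  ultimately have cSh: "?M \<le> 2 * card Sh" by linarith
  define f where "f i = {j \<in> {..<?M}. \<alpha> j = \<alpha> i} \<union> {j \<in> {..<?M}. \<beta> j = \<beta> i} \<union>
    {j \<in> {..<?M}. set (S j) \<inter> g i \<noteq> {}}" for i
  have "card (f i \<inter> Sh) \<le> 2 * r + 6 * k ^ 2" if i: "i \<in> Sh" for i
  proof -
    have iM: "i \<in> {..<?M}" using i by (simp add: Sh_def)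
    have gi: "finite (g i)" "card (g i) \<le> 6 * k ^ 2" using bspec[OF g iM] by auto
    \<comment> \<open>As the paths are disjoint, at most \<open>card (g i)\<close> of them can meet
      \<open>g i\<close>.\<close>
    let ?J = "{j \<in> {..<?M}. set (S j) \<inter> g i \<noteq> {}}"
    have "\<forall>j\<in>?J. \<exists>x. x \<in> set (S j) \<inter> g i" by blast
    then obtain h where h: "\<forall>j\<in>?J. h j \<in> set (S j) \<inter> g i" by (rule bchoice[THEN exE])
    have "inj_on h ?J"
    proof (rule inj_onI, rule ccontr)
      fix j l assume jl: "j \<in> ?J" "l \<in> ?J" "h j = h l" "j \<noteq> l"
      then have "set (S j) \<inter> set (S l) = {}" using disjoint_family_onD[OF Sd, of j l] by blast
      then show False using bspec[OF h jl(1)] bspec[OF h jl(2)] jl(3) by auto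
    qed
    then have "card ?J \<le> card (g i)" using h gi(1) by (intro card_inj_on_le[of h]) auto
    moreover have "card (f i) \<le> card {j \<in> {..<?M}. \<alpha> j = \<alpha> i} + card {j \<in> {..<?M}. \<beta> j = \<beta> i} + card ?J"
      unfolding f_def
      using card_Un_le[of "{j \<in> {..<?M}. \<alpha> j = \<alpha> i} \<union> {j \<in> {..<?M}. \<beta> j = \<beta> i}" ?J]
        card_Un_le[of "{j \<in> {..<?M}. \<alpha> j = \<alpha> i}" "{j \<in> {..<?M}. \<beta> j = \<beta> i}"] by linarith
    moreover have "card (f i \<inter> Sh) \<le> card (f i)" by (rule card_mono) (auto simp: f_def)
    ultimately show ?thesis using gi(2) spec[OF fib, of "\<alpha> i"] spec[OF fib, of "\<beta> i"] by linarith
  qed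
  then obtain Y0 where Y0: "Y0 \<subseteq> Sh" "card Sh \<le> (2 * (2 * r + 6 * k ^ 2) + 1) * card Y0"
    "\<forall>x\<in>Y0. \<forall>y\<in>Y0. x \<noteq> y \<longrightarrow> y \<notin> f x"
    using independent_subset[OF finSh(1), of f "2 * r + 6 * k ^ 2"] by blast
  \<comment> \<open>At least half of the paths are short, and \<open>r > 12 * k ^ 2\<close> gives
    \<open>4 * r + 12 * k ^ 2 + 1 \<le> 5 * r\<close>. So a tenth of \<open>G\<close> survives,
    which is why \<open>G = 10 * k * t\<close>.\<close>
  have "?M \<le> 2 * ((2 * (2 * r + 6 * k ^ 2) + 1) * card Y0)"
    by (rule order_trans[OF cSh mult_le_mono2[OF Y0(2)]])
  also have "\<dots> \<le> 2 * ((5 * r) * card Y0)" using r by (intro mult_le_mono2 mult_le_mono1) simp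
  finally have "(10 * r) * (k * t) \<le> (10 * r) * card Y0" by (simp add: G algebra_simps)
  then have "k * t \<le> card Y0" using r by simp
  then obtain Y where Y: "Y \<subseteq> Y0" "card Y = k * t" "finite Y" by (rule obtain_subset_with_card_n)
  have YM: "Y \<subseteq> {..<?M}" using Y Y0 by (auto simp: Sh_def)
  have nf: "y \<notin> f x" if "x \<in> Y" "y \<in> Y" "x \<noteq> y" for x y using Y0(3) Y(1) that by blast
  have "inj_on \<alpha> Y" "inj_on \<beta> Y"
    using nf YM unfolding f_def inj_on_def by blast+
  moreover have "disjoint_family_on (\<lambda>i. set (S i) \<union> g i) Y"
    unfolding disjoint_family_on_def
  proof (intro ballI impI)
    fix i j assume ij: "i \<in> Y" "j \<in> Y" "i \<noteq> j"
    have iM: "i \<in> {..<?M}" "j \<in> {..<?M}" using ij YM by auto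
    have "set (S j) \<inter> g i = {}" "set (S i) \<inter> g j = {}"
      using nf[OF ij] nf[OF ij(2,1)] ij(3) iM unfolding f_def by auto
    then show "(set (S i) \<union> g i) \<inter> (set (S j) \<union> g j) = {}"
      using disjoint_family_onD[OF Sd iM ij(3)] disjoint_family_onD[OF gd iM ij(3)] by blast
  qed
  moreover have "?M * card (set (S i)) \<le> 2 * card V \<and> g i \<subseteq> V - L \<and> card (g i) \<le> 6 * k ^ 2 \<and>
      (\<forall>x\<in>{hd (S i), last (S i)} \<union> g i. rob ({hd (S i), last (S i)} \<union> g i) x)" if "i \<in> Y" for i
  proof -
    have "i \<in> Sh" "i \<in> {..<?M}" using that Y Y0 YM by blast+
    then show ?thesis using bspec[OF g] by (simp add: Sh_def)
  qed
  ultimately show ?thesis using YM Y(2) by (intro exI[of _ Y] exI[of _ g] conjI ballI) auto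
qed

end

section \<open>The coloured partition\<close>

text \<open>Meant for the interior of a path: the vertices of \<open>N1\<close> and
  \<open>N2\<close> belong to hubs and may be exceptional themselves, as long as they are
  robust.\<close>

lemma robust_step:
  assumes "N1 \<subseteq> W" "finite N1" "k \<le> card N1" "N2 \<subseteq> W" "finite N2" "k \<le> card N2"
    and "\<forall>e\<in>N1. E e x" "\<forall>f\<in>N2. E x f" "\<And>e. e \<in> N1 \<union> N2 \<Longrightarrow> robust E k EA EB W e"
  shows "robust E k EA EB W x"
  unfolding robust_def
proof
  show "acc W E k (W - EA) x"
    by (rule acc.step[of N1]) (use assms in \<open>simp_all add: robust_def\<close>)
  show "acc W E\<inverse>\<inverse> k (W - EB) x"
    by (rule acc.step[of N2]) (use assms in \<open>simp_all add: robust_def\<close>)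
qed

lemma equal_parts:
  fixes Y :: "'a set"
  assumes "finite Y" "card Y = k * t"
  shows "\<exists>I. (\<forall>j\<in>{1..t}. I j \<subseteq> Y \<and> card (I j) = k) \<and> disjoint_family_on I {1..t::nat}"
proof -
  have "\<exists>I. (\<forall>j\<in>{1..t}. (I j \<subseteq> Y \<and> k \<le> card (I j)) \<and> finite (I j) \<and> card (I j) \<le> k) \<and>
    disjoint_family_on I {1..t}"
  proof (rule greedy_disjoint)
    fix j :: nat and F :: "'a set" assume F: "finite F" "card F + k \<le> k * card {1..t}"
    then have "k \<le> card (Y - F)" using card_le_Diff_plus[OF assms(1) F(1)] assms(2) by simp
    then obtain X where "X \<subseteq> Y - F" "card X = k" "finite X" by (rule obtain_subset_with_card_n)
    then show "\<exists>X. (X \<subseteq> Y \<and> k \<le> card X) \<and> finite X \<and> card X \<le> k \<and> X \<inter> F = {}"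
      by (intro exI[of _ X]) auto
  qed simp
  then show ?thesis by (metis le_antisym)
qed

context hub_system
begin

lemma coloured_partition:
  assumes con: "strongly_k_connected V E K" and t: "1 \<le> t" and G: "G = 10 * k * t"
    and r: "12 * k ^ 2 + 1 \<le> r"
    and K: "2 * (2 * G * s + 16 * G * s * k ^ 3 + 6 * k ^ 2 * (G * r) + 2 * G * r + k) \<le> K"
    and room: "5 * (2 * G * s + 16 * G * s * k ^ 3 + 6 * k ^ 3 * t + (3 * k + 1) * card (EA \<union> EB) + 2 * k + 1)
      \<le> 4 * card V"
  shows "\<exists>D. (\<forall>j\<in>{1..t}. D j \<subseteq> V \<and>
      G * r * card (D j) \<le> G * r * (2 * G * s + 16 * G * s * k ^ 3 + 6 * k ^ 3 +
        (3 * k + 1) * card (EA \<union> EB)) + 2 * k * card V \<and>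
      (\<forall>R. R \<subseteq> V - (\<Union>i\<in>{1..t}. D i) \<longrightarrow> strongly_k_connected (D j \<union> R) E k)) \<and>
    disjoint_family_on D {1..t::nat}"
proof -
  let ?R = "Xm \<union> Xp" and ?l = "2 * G * s + 16 * G * s * k ^ 3"
  have K0: "2 * (16 * G * s * k ^ 3 + 2 * G * s + k) \<le> K" using K by simp
  obtain B where B: "\<forall>v\<in>?R. A v \<union> N v \<subseteq> B v \<and> B v \<subseteq> V \<and> (\<forall>x\<in>B v. rob (B v) x)"
    and Bd: "disjoint_family_on B ?R" and cB: "card (\<Union>v\<in>?R. B v) \<le> ?l"
    using blocks_exist[OF K0] by (elim exE conjE) (rule that)
  define L where "L = (\<Union>v\<in>?R. B v)"
  have Bv: "A v \<union> N v \<subseteq> B v" "B v \<subseteq> V" "B v \<subseteq> L" "\<And>x. x \<in> B v \<Longrightarrow> rob (B v) x" if "v \<in> ?R" for v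
    using bspec[OF B that] that unfolding L_def by auto
  have L: "L \<subseteq> V" "core \<subseteq> L" unfolding L_def core_eq using Bv(1,2) by blast+
  have cL: "card L \<le> ?l" using cB by (simp add: L_def)
  have K1: "card L + 2 * G * r \<le> K" using cL K by simp
  obtain \<alpha> \<beta> S where S: "\<forall>i<G * r. \<alpha> i \<in> Xm \<and> \<beta> i \<in> Xp \<and> set (S i) \<subseteq> V - L \<and>
      linked E (N (\<beta> i)) (N (\<alpha> i)) (S i)" and Sd: "disjoint_family_on (\<lambda>i. set (S i)) {..<G * r}"
    and fib: "\<forall>v. card {i \<in> {..<G * r}. \<alpha> i = v} \<le> r \<and> card {i \<in> {..<G * r}. \<beta> i = v} \<le> r"
    using linked_family_exists[OF con L K1] by (elim exE conjE) (rule that)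
  have Si: "\<forall>i<G * r. set (S i) \<subseteq> V - L \<and> S i \<noteq> []"
    using S unfolding linked_def by simp
  have K2: "2 * (card L + 6 * k ^ 2 * (G * r) + k) \<le> K" using cL K by simp
  obtain Y g where Y: "Y \<subseteq> {..<G * r}" "card Y = k * t" "inj_on \<alpha> Y" "inj_on \<beta> Y"
    and g: "\<forall>i\<in>Y. G * r * card (set (S i)) \<le> 2 * card V \<and> g i \<subseteq> V - L \<and> card (g i) \<le> 6 * k ^ 2 \<and>
      (\<forall>x\<in>{hd (S i), last (S i)} \<union> g i. rob ({hd (S i), last (S i)} \<union> g i) x)"
    and gd: "disjoint_family_on (\<lambda>i. set (S i) \<union> g i) Y"
    using linked_selection[OF L G r K2 Si Sd fib] by (elim exE conjE) (rule that)
  have finY: "finite Y" using Y(1) finite_subset by blast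
  obtain I where I: "\<forall>j\<in>{1..t}. I j \<subseteq> Y \<and> card (I j) = k" and Id: "disjoint_family_on I {1..t}"
    using equal_parts[OF finY Y(2)] by (elim exE conjE)
  have IY: "I j \<subseteq> Y" "card (I j) = k" "finite (I j)" if "j \<in> {1..t}" for j
    using bspec[OF I that] finY finite_subset by auto
  have sel: "\<alpha> i \<in> Xm" "\<beta> i \<in> Xp" "set (S i) \<subseteq> V - L" "linked E (N (\<beta> i)) (N (\<alpha> i)) (S i)" "g i \<subseteq> V - L"
    "G * r * card (set (S i)) \<le> 2 * card V" "card (g i) \<le> 6 * k ^ 2"
    "\<And>x. x \<in> {hd (S i), last (S i)} \<union> g i \<Longrightarrow> rob ({hd (S i), last (S i)} \<union> g i) x" if "i \<in> Y" for i
  proof -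
    have "i < G * r" using that Y(1) by auto
    then show "\<alpha> i \<in> Xm" "\<beta> i \<in> Xp" "set (S i) \<subseteq> V - L" "linked E (N (\<beta> i)) (N (\<alpha> i)) (S i)"
      using S by simp_all
    show "g i \<subseteq> V - L" "G * r * card (set (S i)) \<le> 2 * card V" "card (g i) \<le> 6 * k ^ 2"
      using bspec[OF g that] by simp_all
    have "\<forall>x\<in>{hd (S i), last (S i)} \<union> g i. rob ({hd (S i), last (S i)} \<union> g i) x"
      using bspec[OF g that] by (elim conjE)
    then show "\<And>x. x \<in> {hd (S i), last (S i)} \<union> g i \<Longrightarrow> rob ({hd (S i), last (S i)} \<union> g i) x"
      by (rule bspec)
  qed
  \<comment> \<open>One piece per selected path; a class receives \<open>k\<close> pieces.\<close>
  define pc where "pc i = B (\<alpha> i) \<union> B (\<beta> i) \<union> (set (S i) \<union> g i)" for i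
  define rest where "rest = ?R - (\<alpha> ` Y \<union> \<beta> ` Y)"
  define C where "C j = (\<Union>i\<in>I j. pc i) \<union> (if j = 1 then \<Union>v\<in>rest. B v else {})" for j :: nat
  have Rab: "\<alpha> i \<in> ?R" "\<beta> i \<in> ?R" if "i \<in> Y" for i using sel(1,2)[OF that] by auto
  have rest: "rest \<subseteq> ?R" by (auto simp: rest_def)
  have BB: "B v \<inter> B w = {}" if "v \<in> ?R" "w \<in> ?R" "v \<noteq> w" for v w
    using disjoint_family_onD[OF Bd that] .
  have pcV: "pc i \<subseteq> V" if "i \<in> Y" for i
    using Bv(2)[OF Rab(1)[OF that]] Bv(2)[OF Rab(2)[OF that]] sel(3,5)[OF that] unfolding pc_def by blast
  have pcd: "pc i \<inter> pc l = {}" if "i \<in> Y" "l \<in> Y" "i \<noteq> l" for i l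
  proof -
    have "\<alpha> i \<noteq> \<alpha> l" "\<beta> i \<noteq> \<beta> l" using Y(3,4) that unfolding inj_on_def by blast+
    moreover have "\<alpha> i \<noteq> \<beta> l" "\<beta> i \<noteq> \<alpha> l" using sel(1,2)[OF that(1)] sel(1,2)[OF that(2)] roots_disj by auto
    ultimately have "(B (\<alpha> i) \<union> B (\<beta> i)) \<inter> (B (\<alpha> l) \<union> B (\<beta> l)) = {}"
      using BB Rab that by (simp add: Int_Un_distrib Int_Un_distrib2)
    moreover have "(set (S i) \<union> g i) \<inter> (set (S l) \<union> g l) = {}"
      using disjoint_family_onD[OF gd that] .
    moreover have "B (\<alpha> i) \<union> B (\<beta> i) \<subseteq> L" "B (\<alpha> l) \<union> B (\<beta> l) \<subseteq> L"
      using Bv(3) Rab that by simp_all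
    moreover have "(set (S i) \<union> g i) \<inter> L = {}" "(set (S l) \<union> g l) \<inter> L = {}"
      using sel(3,5)[OF that(1)] sel(3,5)[OF that(2)] by auto
    ultimately show ?thesis unfolding pc_def by blast
  qed
  have pcr: "pc i \<inter> B v = {}" if "i \<in> Y" "v \<in> rest" for i v
  proof -
    have "\<alpha> i \<noteq> v" "\<beta> i \<noteq> v" "v \<in> ?R" using that by (auto simp: rest_def)
    then have "B (\<alpha> i) \<inter> B v = {}" "B (\<beta> i) \<inter> B v = {}" "B v \<subseteq> L"
      using BB Rab[OF that(1)] Bv(3) by blast+
    then show ?thesis using sel(3,5)[OF that(1)] unfolding pc_def by blast
  qed
  have Ccase: "(\<exists>i\<in>I j. z \<in> pc i) \<or> (j = 1 \<and> (\<exists>v\<in>rest. z \<in> B v))" if "z \<in> C j" for z j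
    using that unfolding C_def by (auto split: if_splits)
  have CV: "C j \<subseteq> V" if "j \<in> {1..t}" for j
  proof
    fix z assume "z \<in> C j"
    then show "z \<in> V" using Ccase[of z j] pcV IY(1)[OF that] rest Bv(2) by blast
  qed
  have Cd: "disjoint_family_on C {1..t}"
    unfolding disjoint_family_on_def
  proof (intro ballI impI)
    fix j l assume jl: "j \<in> {1..t}" "l \<in> {1..t}" "j \<noteq> l"
    have II: "I j \<inter> I l = {}" using disjoint_family_onD[OF Id jl] .
    show "C j \<inter> C l = {}"
    proof (rule ccontr)
      assume "C j \<inter> C l \<noteq> {}"
      then obtain z where z: "z \<in> C j" "z \<in> C l" by blast
      consider i i' where "i \<in> I j" "i' \<in> I l" "z \<in> pc i" "z \<in> pc i'"
        | i v where "i \<in> Y" "v \<in> rest" "z \<in> pc i" "z \<in> B v"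
        using Ccase[OF z(1)] Ccase[OF z(2)] IY(1)[OF jl(1)] IY(1)[OF jl(2)] jl(3) by blast
      then show False
      proof cases
        case 1
        then have "i \<noteq> i'" using II by blast
        then show ?thesis using 1 pcd[of i i'] IY(1)[OF jl(1)] IY(1)[OF jl(2)] by blast
      next
        case 2
        then show ?thesis using pcr[OF 2(1,2)] by blast
      qed
    qed
  qed
  have Ncard: "card (N v) = k" "N v \<subseteq> B v" "finite (N v)" if "v \<in> ?R" for v
  proof -
    show "card (N v) = k" using that hub_m hub_p unfolding hub_def by blast
    then show "finite (N v)" using k by (intro card_ge_0_finite) simp
    show "N v \<subseteq> B v" using Bv(1)[OF that] by blast
  qed
  have robpc: "rob (pc i) x" if i: "i \<in> Y" and x: "x \<in> pc i" for i x
  proof -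
    have robB: "rob (pc i) y" if y: "y \<in> B (\<alpha> i) \<union> B (\<beta> i)" for y
    proof (cases "y \<in> B (\<alpha> i)")
      case True
      from Bv(4)[OF Rab(1)[OF i] this] show ?thesis by (rule robust_mono) (auto simp: pc_def)
    next
      case False
      then have "y \<in> B (\<beta> i)" using y by simp
      from Bv(4)[OF Rab(2)[OF i] this] show ?thesis by (rule robust_mono) (auto simp: pc_def)
    qed
    have "S i \<noteq> []" using sel(4)[OF i] by (simp add: linked_def)
    then have sub: "{hd (S i), last (S i)} \<union> g i \<subseteq> pc i" by (auto simp: pc_def)
    have robend: "rob (pc i) y" if "y \<in> {hd (S i), last (S i)} \<union> g i" for y
      using sel(8)[OF i that] sub by (rule robust_mono)
    consider "x \<in> B (\<alpha> i) \<union> B (\<beta> i)" | "x \<in> {hd (S i), last (S i)} \<union> g i"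
      | "x \<in> set (S i)" "x \<noteq> hd (S i)" "x \<noteq> last (S i)"
      using x unfolding pc_def by blast
    then show ?thesis
    proof cases
      case 3
      have dom: "\<forall>e\<in>N (\<alpha> i). E e x" "\<forall>f\<in>N (\<beta> i). E x f"
        using sel(4)[OF i] 3 unfolding linked_def by blast+
      have robN: "rob (pc i) e" if "e \<in> N (\<alpha> i) \<union> N (\<beta> i)" for e
        using robB that Ncard(2) Rab[OF i] by blast
      have sub: "N (\<alpha> i) \<subseteq> pc i" "N (\<beta> i) \<subseteq> pc i"
        using Ncard(2) Rab[OF i] unfolding pc_def by blast+
      have cN: "k \<le> card (N (\<alpha> i))" "k \<le> card (N (\<beta> i))"
        using Ncard(1) Rab[OF i] by simp_all
      show ?thesis
        by (rule robust_step[OF sub(1) Ncard(3)[OF Rab(1)[OF i]] cN(1) sub(2) Ncard(3)[OF Rab(2)[OF i]] cN(2) dom])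
          (rule robN)
    qed (simp_all add: robB robend)
  qed
  have robC: "rob (C j) x" if j: "j \<in> {1..t}" and x: "x \<in> C j" for j x
    using Ccase[OF x]
  proof
    assume "\<exists>i\<in>I j. x \<in> pc i"
    then obtain i where i: "i \<in> I j" "x \<in> pc i" by blast
    then have "rob (pc i) x" using robpc IY(1)[OF j] by blast
    then show ?thesis by (rule robust_mono) (use i in \<open>auto simp: C_def\<close>)
  next
    assume "j = 1 \<and> (\<exists>v\<in>rest. x \<in> B v)"
    then obtain v where v: "v \<in> rest" "x \<in> B v" "j = 1" by blast
    then have "rob (B v) x" using Bv(4) rest by blast
    then show ?thesis by (rule robust_mono) (use v in \<open>auto simp: C_def\<close>)
  qed
  have coreC: "core \<subseteq> (\<Union>j\<in>{1..t}. C j)"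
  proof
    have "card (\<Union>j\<in>{1..t}. I j) = k * t"
    proof -
      have "card (\<Union>j\<in>{1..t}. I j) = (\<Sum>j\<in>{1..t}. card (I j))"
        using IY(3) disjoint_family_onD[OF Id] by (intro card_UN_disjoint) auto
      also have "\<dots> = (\<Sum>j\<in>{1..t}. k)" using IY(2) by (intro sum.cong) auto
      finally show ?thesis by (simp add: mult.commute)
    qed
    moreover have "(\<Union>j\<in>{1..t}. I j) \<subseteq> Y" using IY(1) by blast
    ultimately have YI: "Y = (\<Union>j\<in>{1..t}. I j)"
      using Y(2) finY card_subset_eq by metis
    fix x assume "x \<in> core"
    then obtain v where v: "v \<in> ?R" "x \<in> B v" unfolding core_eq using Bv(1) by blast
    show "x \<in> (\<Union>j\<in>{1..t}. C j)"
    proof (cases "v \<in> rest")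
      case True
      then have "x \<in> C 1" using v by (auto simp: C_def)
      then show ?thesis using t by auto
    next
      case False
      then obtain i where i: "i \<in> Y" "v = \<alpha> i \<or> v = \<beta> i" using v by (auto simp: rest_def)
      then obtain j where j: "j \<in> {1..t}" "i \<in> I j" using YI by blast
      have "x \<in> pc i" using i v by (auto simp: pc_def)
      then have "x \<in> C j" using j by (auto simp: C_def)
      then show ?thesis using j by blast
    qed
  qed
  have finL: "finite L" using L finite_V finite_subset by blast
  have cSg: "card (\<Union>i\<in>J. set (S i) \<union> g i) \<le> (\<Sum>i\<in>J. card (set (S i))) + card J * (6 * k ^ 2)" if J: "J \<subseteq> Y" for J
  proof -
    have "card (\<Union>i\<in>J. set (S i) \<union> g i) \<le> (\<Sum>i\<in>J. card (set (S i) \<union> g i))"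
      using J finY finite_subset by (intro card_UN_le) blast
    also have "\<dots> \<le> (\<Sum>i\<in>J. card (set (S i)) + 6 * k ^ 2)"
    proof (rule sum_mono)
      fix i assume "i \<in> J"
      then show "card (set (S i) \<union> g i) \<le> card (set (S i)) + 6 * k ^ 2"
        using card_Un_le[of "set (S i)" "g i"] sel(7)[of i] J by fastforce
    qed
    finally show ?thesis by (simp add: sum.distrib)
  qed
  have total: "G * r * (\<Sum>i\<in>J. card (set (S i))) \<le> card J * (2 * card V)" if J: "J \<subseteq> Y" for J
  proof -
    have "G * r * (\<Sum>i\<in>J. card (set (S i))) = (\<Sum>i\<in>J. G * r * card (set (S i)))" by (simp only: sum_distrib_left)
    also have "\<dots> \<le> (\<Sum>i\<in>J. 2 * card V)" using sel(6) J by (intro sum_mono) blast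
    finally show ?thesis by simp
  qed
  have CL: "C j \<subseteq> L \<union> (\<Union>i\<in>I j. set (S i) \<union> g i)" if j: "j \<in> {1..t}" for j
  proof
    fix z assume "z \<in> C j"
    then show "z \<in> L \<union> (\<Union>i\<in>I j. set (S i) \<union> g i)"
      using Ccase[of z j] rest Bv(3) Rab IY(1)[OF j] unfolding pc_def by blast
  qed
  have finS: "finite (\<Union>i\<in>J. set (S i) \<union> g i)" if "J \<subseteq> Y" for J
  proof (rule finite_subset[OF _ finite_V])
    show "(\<Union>i\<in>J. set (S i) \<union> g i) \<subseteq> V" using sel(3,5) that by blast
  qed
  have cC: "card (C j) \<le> card L + ((\<Sum>i\<in>I j. card (set (S i))) + k * (6 * k ^ 2))" if j: "j \<in> {1..t}" for j
  proof -
    have "card (C j) \<le> card (L \<union> (\<Union>i\<in>I j. set (S i) \<union> g i))"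
      using CL[OF j] finL finS[OF IY(1)[OF j]] by (intro card_mono) auto
    also have "\<dots> \<le> card L + card (\<Union>i\<in>I j. set (S i) \<union> g i)" by (rule card_Un_le)
    finally show ?thesis using cSg[OF IY(1)[OF j]] IY(2)[OF j] by simp
  qed
  have cUC: "card (\<Union>j\<in>{1..t}. C j) \<le> card L + ((\<Sum>i\<in>Y. card (set (S i))) + k * t * (6 * k ^ 2))"
  proof -
    have "(\<Union>j\<in>{1..t}. C j) \<subseteq> L \<union> (\<Union>i\<in>Y. set (S i) \<union> g i)" using CL IY(1) by blast
    then have "card (\<Union>j\<in>{1..t}. C j) \<le> card (L \<union> (\<Union>i\<in>Y. set (S i) \<union> g i))"
      using finL finS[of Y] by (intro card_mono) auto
    also have "\<dots> \<le> card L + card (\<Union>i\<in>Y. set (S i) \<union> g i)" by (rule card_Un_le)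
    finally show ?thesis using cSg[of Y] Y(2) by simp
  qed
  \<comment> \<open>\<open>k * t\<close> paths with at most \<open>2 * card V / (G * r)\<close>
    vertices each cover at most \<open>card V / (5 * r)\<close> vertices; \<open>room\<close> leaves
    a fifth of \<open>V\<close> for them.\<close>
  have "5 * (\<Sum>i\<in>Y. card (set (S i))) \<le> card V"
  proof -
    have "(2 * (k * t)) * (5 * r * (\<Sum>i\<in>Y. card (set (S i)))) \<le> (2 * (k * t)) * card V"
      using total[of Y] Y(2) by (simp add: G algebra_simps)
    then have "5 * r * (\<Sum>i\<in>Y. card (set (S i))) \<le> card V"
      using k t by (subst (asm) mult_le_cancel1) auto
    moreover have "5 * (\<Sum>i\<in>Y. card (set (S i))) \<le> 5 * r * (\<Sum>i\<in>Y. card (set (S i)))"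
      using r by (intro mult_le_mono1) simp
    ultimately show ?thesis by linarith
  qed
  then have room': "card (\<Union>j\<in>{1..t}. C j) + (3 * k + 1) * card (EA \<union> EB) + 2 * k + 1 \<le> card V"
    using cUC cL room by (simp add: power2_eq_square power3_eq_cube algebra_simps)
  have "card (N v) \<le> s" if "v \<in> ?R" for v
    using hub_card[OF that] card_mono[of "A v \<union> N v" "N v"] hub_subset[OF that] finite_V finite_subset
    by (meson Un_upper2 order_trans)
  moreover have "\<exists>v. v \<in> ?R"
  proof -
    have "card Xm \<noteq> 0" using card_roots(1) G k t by simp
    then have "Xm \<noteq> {}" by force
    then show ?thesis by blast
  qed
  ultimately have ks: "k \<le> s" using Ncard(1) by metis
  have "k * t + k \<le> G * s"
  proof -
    have "k * t + k \<le> 10 * k * t" using t by (cases t) auto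
    also have "\<dots> = G * 1" by (simp add: G)
    also have "\<dots> \<le> G * s" using ks k by (intro mult_le_mono2) simp
    finally show ?thesis .
  qed
  then have kt: "2 * (k * t + k) \<le> K" using K by simp
  have sup_in: "k * t + k \<le> card (nin V E x - EA)" if "x \<in> V - (\<Union>j\<in>{1..t}. C j)" for x
  proof -
    have "K \<le> 2 * card (nin V E x - (EA \<union> core))" using that coreC by (intro supply_in) blast
    moreover have "card (nin V E x - (EA \<union> core)) \<le> card (nin V E x - EA)"
      using fin_nin by (intro card_mono) auto
    ultimately show ?thesis using kt by simp
  qed
  have sup_out: "k * t + k \<le> card (nin V E\<inverse>\<inverse> x - (EA \<union> EB))" if "x \<in> V - (\<Union>j\<in>{1..t}. C j)" for x
  proof -
    have "K \<le> 2 * card (nin V E\<inverse>\<inverse> x - (EA \<union> EB \<union> core))" using that coreC by (intro supply_out) blast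
    moreover have "card (nin V E\<inverse>\<inverse> x - (EA \<union> EB \<union> core)) \<le> card (nin V E\<inverse>\<inverse> x - (EA \<union> EB))"
      using fin_nin by (intro card_mono) auto
    ultimately show ?thesis using kt by simp
  qed
  have EV: "EA \<subseteq> V" "EB \<subseteq> V" by (auto simp: EA_eq EB_eq undom_def)
  have "\<exists>D. (\<forall>j\<in>{1..t}. C j \<subseteq> D j \<and> D j \<subseteq> V \<and> (\<forall>x\<in>D j. rob (D j) x) \<and>
      card (D j) \<le> card (C j) + (3 * k + 1) * card (EA \<union> EB)) \<and>
    disjoint_family_on D {1..t} \<and> EA \<union> EB \<subseteq> (\<Union>j\<in>{1..t}. D j)"
    by (rule extend_colour_classes[OF tour t EV])
      ((rule CV Cd robC sup_in sup_out room'; assumption?)+)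
  then obtain D where D: "\<forall>j\<in>{1..t}. C j \<subseteq> D j \<and> D j \<subseteq> V \<and> (\<forall>x\<in>D j. rob (D j) x) \<and>
      card (D j) \<le> card (C j) + (3 * k + 1) * card (EA \<union> EB)"
    and Dd: "disjoint_family_on D {1..t}" and DE: "EA \<union> EB \<subseteq> (\<Union>j\<in>{1..t}. D j)"
    by (elim exE conjE)
  have size: "G * r * card (D j) \<le> G * r * (?l + 6 * k ^ 3 + (3 * k + 1) * card (EA \<union> EB)) + 2 * k * card V"
    if j: "j \<in> {1..t}" for j
  proof -
    let ?sum = "\<Sum>i\<in>I j. card (set (S i))"
    have "card (D j) \<le> ?l + (?sum + k * (6 * k ^ 2)) + (3 * k + 1) * card (EA \<union> EB)"
      using bspec[OF D j] cC[OF j] cL by linarith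
    also have "\<dots> = (?l + 6 * k ^ 3 + (3 * k + 1) * card (EA \<union> EB)) + ?sum"
      by (simp add: power2_eq_square power3_eq_cube)
    finally have "G * r * card (D j) \<le> G * r * (?l + 6 * k ^ 3 + (3 * k + 1) * card (EA \<union> EB)) + G * r * ?sum"
      by (metis add_mult_distrib2 mult_le_mono2)
    also have "G * r * ?sum \<le> 2 * k * card V" using total[OF IY(1)[OF j]] IY(2)[OF j] by simp
    finally show ?thesis by simp
  qed
  have conn: "strongly_k_connected (D j \<union> Q) E k"
    if j: "j \<in> {1..t}" and Q: "Q \<subseteq> V - (\<Union>i\<in>{1..t}. D i)" for j Q
  proof -
    let ?W = "D j \<union> Q"
    have WV: "?W \<subseteq> V" using bspec[OF D j] Q by blast
    \<comment> \<open>Only hubs and path enter the connecting set; the reserved vertices matter for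
      \<open>acc\<close> alone.\<close>
    define H where "H i = (A (\<alpha> i) \<union> N (\<alpha> i)) \<union> (A (\<beta> i) \<union> N (\<beta> i)) \<union> set (S i)" for i
    have Hpc: "H i \<subseteq> pc i" if "i \<in> Y" for i
      using Bv(1)[OF Rab(1)[OF that]] Bv(1)[OF Rab(2)[OF that]] unfolding H_def pc_def by blast
    have HD: "H i \<subseteq> ?W" if "i \<in> I j" for i
    proof -
      have "pc i \<subseteq> C j" using that by (auto simp: C_def)
      then show ?thesis using Hpc[of i] IY(1)[OF j] that bspec[OF D j] by blast
    qed
    have ham: "A (\<alpha> i) \<subseteq> V" "a (\<alpha> i) \<in> A (\<alpha> i)" "\<forall>x\<in>A (\<alpha> i) - {a (\<alpha> i)}. E (a (\<alpha> i)) x"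
      "\<forall>e\<in>N (\<alpha> i). E e (a (\<alpha> i))" if "i \<in> Y" for i
      using hub_m[OF sel(1)[OF that]] unfolding hub_def by simp_all
    have hap: "A (\<beta> i) \<subseteq> V" "a (\<beta> i) \<in> A (\<beta> i)" "\<forall>x\<in>A (\<beta> i) - {a (\<beta> i)}. E x (a (\<beta> i))"
      "\<forall>e\<in>N (\<beta> i). E (a (\<beta> i)) e" if "i \<in> Y" for i
      using hub_p[OF sel(2)[OF that]] unfolding hub_def by simp_all
    show ?thesis
    proof (rule strongly_k_connected_by_hubs[of _ k "I j" H E "\<lambda>i. a (\<beta> i)" "\<lambda>i. a (\<alpha> i)" "?W - EA" "?W - EB"])
      show "finite ?W" using WV finite_V finite_subset by blast
      show "finite (I j)" "k \<le> card (I j)" using IY[OF j] by auto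
      show "disjoint_family_on H (I j)"
        unfolding disjoint_family_on_def
      proof (intro ballI impI)
        fix i l assume il: "i \<in> I j" "l \<in> I j" "i \<noteq> l"
        have "i \<in> Y" "l \<in> Y" using il IY(1)[OF j] by blast+
        then show "H i \<inter> H l = {}" using Hpc[of i] Hpc[of l] pcd[of i l] il(3) by blast
      qed
      \<comment> \<open>The \<open>k\<close> vertices of one \<open>N\<close> and one vertex of the
        opposite hub are enough.\<close>
      show "k < card ?W"
      proof -
        have "I j \<noteq> {}" using IY(2)[OF j] k by auto
        then obtain i where i: "i \<in> I j" by blast
        then have iY: "i \<in> Y" using IY(1)[OF j] by blast
        have "a (\<beta> i) \<in> A (\<beta> i) \<union> N (\<beta> i)" using hap[OF iY] by blast
        moreover have "\<alpha> i \<noteq> \<beta> i" using sel(1,2)[OF iY] roots_disj by auto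
        then have "(A (\<alpha> i) \<union> N (\<alpha> i)) \<inter> (A (\<beta> i) \<union> N (\<beta> i)) = {}"
          by (rule disjoint_family_onD[OF hub_disj Rab[OF iY]])
        ultimately have "a (\<beta> i) \<notin> N (\<alpha> i)" by blast
        then have "card (insert (a (\<beta> i)) (N (\<alpha> i))) = Suc k" using Ncard[OF Rab(1)[OF iY]] by simp
        moreover have "insert (a (\<beta> i)) (N (\<alpha> i)) \<subseteq> ?W"
          using HD[OF i] hap(2)[OF iY] unfolding H_def by blast
        ultimately have "Suc k \<le> card ?W" using WV finite_V finite_subset by (metis card_mono)
        then show ?thesis by simp
      qed
    next
      fix i assume i: "i \<in> I j"
      then have iY: "i \<in> Y" using IY(1)[OF j] by blast
      let ?u = "hd (S i)" and ?w = "last (S i)"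
      obtain f e where fe: "f \<in> N (\<beta> i)" "E f ?u" "e \<in> N (\<alpha> i)" "E ?w e" "reach (set (S i)) E ?u ?w" "S i \<noteq> []"
        using sel(4)[OF iY] unfolding linked_def by blast
      have inH: "f \<in> H i" "e \<in> H i" "?u \<in> H i" "?w \<in> H i" "a (\<alpha> i) \<in> H i" "a (\<beta> i) \<in> H i"
        using fe ham(2)[OF iY] hap(2)[OF iY] by (auto simp: H_def)
      have "reach (H i) E (a (\<beta> i)) f" using hap(4)[OF iY] fe inH by (intro reach_edge) auto
      moreover have "reach (H i) E f ?u" using fe inH by (intro reach_edge) auto
      moreover have "reach (H i) E ?u ?w" using fe(5) by (rule reach_mono) (auto simp: H_def)
      moreover have "reach (H i) E ?w e" using fe inH by (intro reach_edge) auto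
      moreover have "reach (H i) E e (a (\<alpha> i))" using ham(4)[OF iY] fe inH by (intro reach_edge) auto
      ultimately have "reach (H i) E (a (\<beta> i)) (a (\<alpha> i))" using reach_trans[of "H i" E] by blast
      then show "H i \<subseteq> ?W \<and> reach (H i) E (a (\<beta> i)) (a (\<alpha> i))" using HD[OF i] by blast
    next
      fix i x assume i: "i \<in> I j" and x: "x \<in> ?W - EA"
      have iY: "i \<in> Y" using i IY(1)[OF j] by blast
      have "x \<in> V" "x \<notin> undom V E A Xm" using x WV EA_eq by blast+
      then obtain y where y: "y \<in> A (\<alpha> i)" "E y x" using sel(1)[OF iY] unfolding undom_def by blast
      have "reach (H i) E (a (\<alpha> i)) y"
      proof (cases "y = a (\<alpha> i)")
        case False
        then show ?thesis using ham(2,3)[OF iY] y by (intro reach_edge) (auto simp: H_def)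
      qed simp
      then show "\<exists>y\<in>H i. reach (H i) E (a (\<alpha> i)) y \<and> E y x" using y by (auto simp: H_def)
    next
      fix i x assume i: "i \<in> I j" and x: "x \<in> ?W - EB"
      have iY: "i \<in> Y" using i IY(1)[OF j] by blast
      have "x \<in> V" "x \<notin> undom V E\<inverse>\<inverse> A Xp" using x WV EB_eq by blast+
      then obtain y where y: "y \<in> A (\<beta> i)" "E x y" using sel(2)[OF iY] unfolding undom_def by blast
      have "reach (H i) E y (a (\<beta> i))"
      proof (cases "y = a (\<beta> i)")
        case False
        then show ?thesis using hap(2,3)[OF iY] y by (intro reach_edge) (auto simp: H_def)
      qed simp
      then show "\<exists>y\<in>H i. reach (H i) E y (a (\<beta> i)) \<and> E x y" using y by (auto simp: H_def)
    next
      fix x assume x: "x \<in> ?W"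
      have "rob ?W x"
      proof (cases "x \<in> D j")
        case True
        then have "rob (D j) x" using bspec[OF D j] by blast
        then show ?thesis by (rule robust_mono) blast
      next
        \<comment> \<open>Vertices of \<open>Q\<close> are unexceptional because the classes cover
          \<open>EA \<union> EB\<close>, so they need no reserved neighbours.\<close>
        case False
        then have "x \<notin> EA \<union> EB" using x Q DE by blast
        then show ?thesis using x by (auto simp: robust_def intro: acc.base)
      qed
      then show "acc ?W E k (?W - EA) x \<and> acc ?W E\<inverse>\<inverse> k (?W - EB) x" by (simp add: robust_def)
    qed
  qed
  have DV: "D j \<subseteq> V" if "j \<in> {1..t}" for j using bspec[OF D that] by blast
  show ?thesis
    by (intro exI[of _ D] conjI ballI allI impI Dd DV size conn)
qed

end

section \<open>Choice of the parameters and the final bound\<close>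

lemma le_mult_factor: "M = x * y \<Longrightarrow> 1 \<le> y \<Longrightarrow> x \<le> (M::nat)"
  by simp

text \<open>The budget \<open>card V / m\<close> of a class is halved: one half pays for its
  \<open>k\<close> paths, the other for blocks, reserved vertices and exceptional vertices.\<close>

lemma partition_oriented:
  fixes V :: "'a set" and k t m c s K :: nat
  assumes T: "tournament V E" and con: "strongly_k_connected V E K"
    and k: "1 \<le> k" and t: "2 \<le> t" "t \<le> m" and s: "s = c + 1 + k"
    and c: "4096 * (k * t * m) ^ 2 \<le> 2 ^ c" and K: "10 ^ 6 * (k ^ 5 * t ^ 2 * m * s) \<le> K"
    and X: "Xm \<subseteq> V" "Xp \<subseteq> V" "Xm \<inter> Xp = {}" "card Xm = 10 * k * t" "card Xp = 10 * k * t"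
    and dm: "\<And>v. v \<in> Xm \<Longrightarrow> card (nin V E v) \<le> dm"
      "\<And>x. x \<in> V - (Xm \<union> Xp) \<Longrightarrow> dm \<le> card (nin V E x)"
    and dp: "\<And>v. v \<in> Xp \<Longrightarrow> card (nin V E\<inverse>\<inverse> v) \<le> dp"
      "\<And>x. x \<in> V - (Xm \<union> Xp) \<Longrightarrow> dp \<le> card (nin V E\<inverse>\<inverse> x)"
    and dmp: "dm \<le> dp"
  shows "\<exists>D. (\<forall>j\<in>{1..t}. D j \<subseteq> V \<and> m * card (D j) \<le> card V \<and>
      (\<forall>R. R \<subseteq> V - (\<Union>i\<in>{1..t}. D i) \<longrightarrow> strongly_k_connected (D j \<union> R) E k)) \<and>
    disjoint_family_on D {1..t::nat}"
proof -
  define G where "G = 10 * k * t"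
  \<comment> \<open>\<open>13 * k ^ 2\<close> covers the \<open>12 * k ^ 2 + 1\<close> needed for
    the selection; the factor \<open>m\<close> shortens the paths enough for the size bound.\<close>
  define r where "r = 13 * k ^ 2 * m"
  \<comment> \<open>A common multiple of the monomials in all estimates below. The power
    \<open>k ^ 5\<close> comes from the sets reserved for path ends (\<open>b4\<close>), the factor
    \<open>t ^ 2 * m * s\<close> from the exceptional vertices (\<open>b8\<close>).\<close>
  define M where "M = k * k * k * k * k * t * t * m * s"
  have s1: "1 \<le> s" using s by simp
  have m1: "1 \<le> m" "1 \<le> t" using t by auto
  have MK: "1000000 * M \<le> K" using K by (simp add: M_def power_numeral_reduce algebra_simps)
  have Kn: "K < card V" using con by (simp add: strongly_k_connected_def)
  note pos = k s1 m1
  have b1: "k * t * s \<le> M" by (rule le_mult_factor[of _ _ "k * k * k * k * t * m"]) (use pos in \<open>simp_all add: M_def\<close>)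
  have b2: "k * k * t * t * s \<le> M" by (rule le_mult_factor[of _ _ "k * k * k * m"]) (use pos in \<open>simp_all add: M_def\<close>)
  have b3: "k * k * k * k * t * s \<le> M" by (rule le_mult_factor[of _ _ "k * t * m"]) (use pos in \<open>simp_all add: M_def\<close>)
  have b4: "k * k * k * k * k * t * m \<le> M" by (rule le_mult_factor[of _ _ "t * s"]) (use pos in \<open>simp_all add: M_def\<close>)
  have b5: "k * k * k * t * m \<le> M" by (rule le_mult_factor[of _ _ "k * k * t * s"]) (use pos in \<open>simp_all add: M_def\<close>)
  have b6: "k \<le> M" by (rule le_mult_factor[of _ _ "k * k * k * k * t * t * m * s"]) (use pos in \<open>simp_all add: M_def\<close>)
  have b7: "k * k * k * t \<le> M" by (rule le_mult_factor[of _ _ "k * k * t * m * s"]) (use pos in \<open>simp_all add: M_def\<close>)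
  have b8: "k * k * k * t * t * m * s \<le> M" by (rule le_mult_factor[of _ _ "k * k"]) (use pos in \<open>simp_all add: M_def\<close>)
  have b9: "k * k * k * k * t * m * s \<le> M" by (rule le_mult_factor[of _ _ "k * t"]) (use pos in \<open>simp_all add: M_def\<close>)
  have b10: "s \<le> M" by (rule le_mult_factor[of _ _ "k * k * k * k * k * t * t * m"]) (use pos in \<open>simp_all add: M_def\<close>)
  have b11: "k * k * k * m \<le> M" by (rule le_mult_factor[of _ _ "k * k * t * t * s"]) (use pos in \<open>simp_all add: M_def\<close>)
  have b12: "k * t * m * s \<le> M" by (rule le_mult_factor[of _ _ "k * k * k * k * t"]) (use pos in \<open>simp_all add: M_def\<close>)
  have b13: "k * t \<le> M" by (rule le_mult_factor[of _ _ "k * k * k * k * t * m * s"]) (use pos in \<open>simp_all add: M_def\<close>)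
  have b14: "k * k * t * m \<le> M" by (rule le_mult_factor[of _ _ "k * k * k * t * s"]) (use pos in \<open>simp_all add: M_def\<close>)
  have b15: "1 \<le> M" using b6 k by linarith
  have deg: "K \<le> card (nin V E x)" "K \<le> card (nin V E\<inverse>\<inverse> x)" if "x \<in> V" for x
    using degree_ge_connectivity[OF T con that]
      degree_ge_connectivity[OF tournament_flip[OF T] strongly_k_connected_flip[OF con] that] .
  have c': "4096 * (k * k * t * t * m * m) \<le> 2 ^ c"
    using c by (simp add: power2_eq_square algebra_simps)
  have kt_le: "k * t \<le> k * k * t * t * m * m"
    by (rule le_mult_factor[of _ _ "k * t * m * m"]) (use pos in simp_all)
  have kktm_le: "k * k * t * m \<le> k * k * t * t * m * m"
    by (rule le_mult_factor[of _ _ "t * m"]) (use pos in simp_all)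
  have Gc: "8 * G \<le> 2 ^ c" using c' kt_le unfolding G_def by linarith
  have K1: "2 * G * s + s \<le> K" using b1 b10 MK unfolding G_def by (simp add: algebra_simps)
  have K2: "16 * G * (2 * G * s + 1) + 16 * G * s \<le> K"
    using b1 b2 b13 MK unfolding G_def by (simp add: algebra_simps)
  have "\<exists>A N a core EA EB. hub_system V E k K G s Xm Xp A N a core EA EB \<and>
      2 ^ c * card (EA \<union> EB) \<le> 2 ^ c * (2 * G * (2 * G * s + 1)) + 2 * G * card V"
    by (rule hub_system_exists[OF T k _ _ X(1-3) X(4,5)[folded G_def] _ _ _ _ dmp s Gc K1 K2])
      ((rule deg dm dp, assumption)+)
  then obtain A N a core EA EB where hs: "hub_system V E k K G s Xm Xp A N a core EA EB"
    and e: "2 ^ c * card (EA \<union> EB) \<le> 2 ^ c * (2 * G * (2 * G * s + 1)) + 2 * G * card V"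
    by (elim exE conjE)
  interpret hub_system V E k K G s Xm Xp A N a core EA EB by (rule hs)
  let ?e = "card (EA \<union> EB)"
  \<comment> \<open>The multiplier is chosen for \<open>e1\<close>; the degree term becomes
    \<open>128 * k * m * G = 1280 * k ^ 2 * t * m\<close> times \<open>card V\<close>, and this
    coefficient is below \<open>2 ^ c\<close>.\<close>
  have "2 ^ c * (64 * k * m * ?e) \<le> 2 ^ c * (64 * k * m * (2 * G * (2 * G * s + 1))) + 1280 * (k * k * t * m) * card V"
    using mult_le_mono2[OF e, of "64 * k * m"] by (simp add: G_def algebra_simps)
  also have "1280 * (k * k * t * m) * card V \<le> 2 ^ c * card V"
    using c' kktm_le by (intro mult_le_mono1) linarith
  finally have "2 ^ c * (64 * k * m * ?e) \<le> 2 ^ c * (64 * k * m * (2 * G * (2 * G * s + 1)) + card V)"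
    by (simp add: add_mult_distrib2)
  then have "64 * k * m * ?e \<le> 64 * k * m * (2 * G * (2 * G * s + 1)) + card V"
    by (subst (asm) mult_le_cancel1) simp
  also have "64 * k * m * (2 * G * (2 * G * s + 1)) \<le> card V"
    using b8 b14 MK Kn unfolding G_def by (simp add: algebra_simps)
  finally have e1: "32 * (k * m * ?e) \<le> card V" by simp
  have "(3 * k + 1) * ?e \<le> (4 * k) * ?e" using k by (intro mult_le_mono1) simp
  then have "8 * (m * ((3 * k + 1) * ?e)) \<le> 8 * (m * ((4 * k) * ?e))" by (intro mult_le_mono2)
  also have "\<dots> = 32 * (k * m * ?e)" by simp
  finally have e2: "8 * (m * ((3 * k + 1) * ?e)) \<le> card V" using e1 by linarith
  have "1 * ((3 * k + 1) * ?e) \<le> m * ((3 * k + 1) * ?e)" using m1 by (intro mult_le_mono1)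
  then have e3: "8 * ((3 * k + 1) * ?e) \<le> card V" using e2 by linarith
  have r: "12 * k ^ 2 + 1 \<le> r"
  proof -
    have "12 * k ^ 2 + 1 \<le> 13 * k ^ 2" using k by simp
    also have "\<dots> \<le> r" using m1 by (simp add: r_def)
    finally show ?thesis .
  qed
  have K3: "2 * (2 * G * s + 16 * G * s * k ^ 3 + 6 * k ^ 2 * (G * r) + 2 * G * r + k) \<le> K"
    using b1 b3 b4 b5 b6 MK unfolding G_def r_def by (simp add: power_numeral_reduce algebra_simps)
  define P where "P = 2 * G * s + 16 * G * s * k ^ 3"
  have P: "P \<le> 180 * M" using b1 b3 unfolding P_def G_def by (simp add: power_numeral_reduce algebra_simps)
  have room: "5 * (2 * G * s + 16 * G * s * k ^ 3 + 6 * k ^ 3 * t + (3 * k + 1) * ?e + 2 * k + 1) \<le> 4 * card V"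
  proof -
    have "6 * k ^ 3 * t \<le> 6 * M" using b7 by (simp add: power_numeral_reduce algebra_simps)
    then have "5 * P + 5 * (6 * k ^ 3 * t) + 5 * ((3 * k + 1) * ?e) + 10 * k + 5 \<le> 4 * card V"
      using P e3 b6 b15 MK Kn by linarith
    then show ?thesis unfolding P_def by simp
  qed
  obtain D where D: "\<forall>j\<in>{1..t}. D j \<subseteq> V \<and>
      G * r * card (D j) \<le> G * r * (2 * G * s + 16 * G * s * k ^ 3 + 6 * k ^ 3 + (3 * k + 1) * ?e) + 2 * k * card V \<and>
      (\<forall>R. R \<subseteq> V - (\<Union>i\<in>{1..t}. D i) \<longrightarrow> strongly_k_connected (D j \<union> R) E k)"
    and Dd: "disjoint_family_on D {1..t}"
    using coloured_partition[OF con m1(2) G_def r K3 room] by (elim exE conjE)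
  have size: "m * card (D j) \<le> card V" if j: "j \<in> {1..t}" for j
  proof -
    let ?Q = "P + 6 * k ^ 3 + (3 * k + 1) * ?e"
    have "m * P \<le> 180 * M"
      using b9 b12 unfolding P_def G_def by (simp add: power_numeral_reduce algebra_simps)
    moreover have "m * (6 * k ^ 3) \<le> 6 * M" using b11 by (simp add: power_numeral_reduce algebra_simps)
    ultimately have Q: "2 * (m * ?Q) \<le> card V"
      using e2 MK Kn by (simp add: add_mult_distrib2)
    have kkt: "4 * k \<le> 130 * (k * k * k * t)"
    proof -
      have "k \<le> k * k * k * t" by (rule le_mult_factor[of _ _ "k * k * t"]) (use pos in simp_all)
      then show ?thesis by linarith
    qed
    \<comment> \<open>\<open>G * r\<close> equals \<open>?c * m\<close>, so after cancelling
      \<open>?c\<close> the claim remains; the two summands \<open>?c * card V\<close> below are the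
      two halves of the budget.\<close>
    let ?c = "130 * (k * k * k * t)"
    have "G * r * card (D j) \<le> G * r * ?Q + 2 * k * card V"
      using bspec[OF D j] unfolding P_def by (elim conjE)
    then have "?c * (m * card (D j)) \<le> ?c * (m * ?Q) + 2 * k * card V"
      unfolding G_def r_def by (simp only: power2_eq_square) (simp add: mult_ac)
    then have "2 * (?c * (m * card (D j))) \<le> ?c * (2 * (m * ?Q)) + 4 * k * card V" by simp
    also have "\<dots> \<le> ?c * card V + ?c * card V"
      by (intro add_mono mult_le_mono2 mult_le_mono1 Q kkt)
    finally have "?c * (m * card (D j)) \<le> ?c * card V" by simp
    then show ?thesis using k t by (subst (asm) mult_le_cancel1) simp
  qed
  have DD: "D j \<subseteq> V" "\<And>R. R \<subseteq> V - (\<Union>i\<in>{1..t}. D i) \<Longrightarrow> strongly_k_connected (D j \<union> R) E k" if "j \<in> {1..t}" for j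
    using bspec[OF D that] by (elim conjE, simp)+
  show ?thesis by (intro exI[of _ D] conjI ballI allI impI DD size Dd)
qed

theorem theorem1p5:
  fixes V :: "'a set" and E :: "'a \<Rightarrow> 'a \<Rightarrow> bool" and n k m t :: nat
  assumes "tournament V E" and "card V = n"
    and "k \<ge> 1" and "m \<ge> t" and "t \<ge> 2"
    and "strongly_k_connected V E
           (nat \<lceil>10^7 * real k ^ 6 * real t ^ 2 * real m * log 2 (real (k * t * m))\<rceil>)"
  shows "\<exists>Vs :: nat \<Rightarrow> 'a set.
           (\<forall>j\<in>{1..t}. Vs j \<subseteq> V) \<and>
           (\<forall>i\<in>{1..t}. \<forall>j\<in>{1..t}. i \<noteq> j \<longrightarrow> Vs i \<inter> Vs j = {}) \<and>
           (\<forall>j\<in>{1..t}. real (card (Vs j)) \<le> real n / real m \<and>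
              (\<forall>R. R \<subseteq> V - (\<Union>i\<in>{1..t}. Vs i) \<longrightarrow> strongly_k_connected (Vs j \<union> R) E k))"
proof -
  define q where "q = k * t * m"
  define l where "l = log 2 (real q)"
  define K where "K = nat \<lceil>10^7 * real k ^ 6 * real t ^ 2 * real m * l\<rceil>"
  define d where "d = nat \<lceil>l\<rceil>"
  \<comment> \<open>\<open>2 ^ 12\<close> is the factor \<open>4096\<close> and \<open>2 * d\<close>
    accounts for the square of \<open>k * t * m\<close>.\<close>
  define c where "c = 2 * d + 12"
  define s where "s = c + 1 + k"
  note T = assms(1) and k = assms(3) and t = assms(5,4)
  have con: "strongly_k_connected V E K" using assms(6) by (simp add: K_def l_def q_def)
  have "1 * 2 * 2 \<le> k * t * m" using k t by (intro mult_le_mono) auto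
  then have q4: "4 \<le> q" by (simp add: q_def)
  have l2: "2 \<le> l" using q4 by (simp add: l_def le_log_iff)
  have dl: "l \<le> real d" "real d \<le> l + 1" using l2 by (auto simp: d_def)
  have "real q = 2 powr l" using q4 by (simp add: l_def)
  also have "\<dots> \<le> 2 powr real d" using dl by (intro powr_mono) auto
  also have "\<dots> = real (2 ^ d)" by (simp add: powr_realpow)
  finally have "q \<le> 2 ^ d" by linarith
  then have "q ^ 2 \<le> (2 ^ d) ^ 2" by (rule power_mono) simp
  also have "\<dots> = 2 ^ (2 * d)" by (simp add: power_mult[symmetric] mult.commute)
  finally have c: "4096 * (k * t * m) ^ 2 \<le> 2 ^ c" by (simp add: c_def q_def power_add)
  \<comment> \<open>As \<open>l \<ge> 2\<close> and \<open>k \<ge> 1\<close>, the three summands are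
    at most 2, 7.5 and 0.5 times \<open>k * l\<close>. This factor 10 turns
    \<open>10 ^ 6 * k ^ 5\<close> into \<open>10 ^ 7 * k ^ 6\<close>.\<close>
  have "real s \<le> 2 * l + 15 + real k" using dl(2) by (simp add: s_def c_def)
  also have "\<dots> \<le> 10 * (real k * l)"
  proof -
    have "1 * l \<le> real k * l" using k l2 by (intro mult_right_mono) auto
    moreover have "2 * real k \<le> real k * l" using mult_left_mono[of 2 l "real k"] l2 by simp
    ultimately show ?thesis using l2 by linarith
  qed
  finally have sl: "real s \<le> 10 * (real k * l)" .
  have "real (10 ^ 6 * (k ^ 5 * t ^ 2 * m * s)) = 10 ^ 6 * (real k ^ 5 * real t ^ 2 * real m) * real s" by simp
  also have "\<dots> \<le> 10 ^ 6 * (real k ^ 5 * real t ^ 2 * real m) * (10 * (real k * l))"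
    using sl by (intro mult_left_mono) auto
  also have "\<dots> = 10 ^ 7 * real k ^ 6 * real t ^ 2 * real m * l" by (simp add: power_numeral_reduce)
  also have "\<dots> \<le> real K" unfolding K_def by (rule real_nat_ceiling_ge)
  finally have K: "10 ^ 6 * (k ^ 5 * t ^ 2 * m * s) \<le> K" by linarith
  let ?G = "10 * k * t"
  have fin: "finite V" using T by (simp add: tournament_def)
  have "k * t \<le> k ^ 5 * t ^ 2 * m * s"
  proof (rule le_mult_factor)
    show "k ^ 5 * t ^ 2 * m * s = k * t * (k ^ 4 * t * m * s)" by (simp add: power_numeral_reduce)
    have "0 < s" "0 < k" "0 < t" "0 < m" using k t by (auto simp: s_def)
    then have "0 < k ^ 4 * t * m * s" by simp
    then show "1 \<le> k ^ 4 * t * m * s" by linarith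
  qed
  moreover have "1000000 * (k ^ 5 * t ^ 2 * m * s) \<le> K" using K by simp
  moreover have "K < card V" using con by (simp add: strongly_k_connected_def)
  ultimately have "20 * (k * t) \<le> card V" by linarith
  then have Gn: "2 * ?G \<le> card V" by simp
  have G1: "?G \<le> card V" using Gn by simp
  obtain Xm dm where Xm: "Xm \<subseteq> V" "card Xm = ?G" "\<forall>x\<in>Xm. card (nin V E x) \<le> dm"
    "\<forall>x\<in>V - Xm. dm \<le> card (nin V E x)"
    using smallest_subset[OF fin G1, of "\<lambda>x. card (nin V E x)"] by (elim exE conjE) (rule that)
  have "finite Xm" using Xm(1) fin finite_subset by blast
  then have G2: "?G \<le> card (V - Xm)" using Gn Xm by (simp add: card_Diff_subset)
  have fin2: "finite (V - Xm)" using fin by simp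
  obtain Xp dp where Xp: "Xp \<subseteq> V - Xm" "card Xp = ?G" "\<forall>x\<in>Xp. card (nin V E\<inverse>\<inverse> x) \<le> dp"
    "\<forall>x\<in>V - Xm - Xp. dp \<le> card (nin V E\<inverse>\<inverse> x)"
    using smallest_subset[OF fin2 G2, of "\<lambda>x. card (nin V E\<inverse>\<inverse> x)"] by (elim exE conjE) (rule that)
  have ex: "\<exists>D. (\<forall>j\<in>{1..t}. D j \<subseteq> V \<and> m * card (D j) \<le> card V \<and>
      (\<forall>R. R \<subseteq> V - (\<Union>i\<in>{1..t}. D i) \<longrightarrow> strongly_k_connected (D j \<union> R) E k)) \<and>
    disjoint_family_on D {1..t}"
  proof (cases "dm \<le> dp")
    case True
    show ?thesis
      by (rule partition_oriented[OF T con k t s_def c K, of Xm Xp dm dp])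
        (use Xm Xp True in auto)
  next
    case False
    \<comment> \<open>Reversing all edges exchanges the two root sets and their thresholds and
      preserves strong connectivity, so the case \<open>dp < dm\<close> reduces to the other
      one.\<close>
    have flip: "strongly_k_connected W E\<inverse>\<inverse> k \<longleftrightarrow> strongly_k_connected W E k" for W
      using strongly_k_connected_flip[of W E k] strongly_k_connected_flip[of W "E\<inverse>\<inverse>" k] by auto
    have "\<exists>D. (\<forall>j\<in>{1..t}. D j \<subseteq> V \<and> m * card (D j) \<le> card V \<and>
        (\<forall>R. R \<subseteq> V - (\<Union>i\<in>{1..t}. D i) \<longrightarrow> strongly_k_connected (D j \<union> R) E\<inverse>\<inverse> k)) \<and>
      disjoint_family_on D {1..t}"
      by (rule partition_oriented[OF tournament_flip[OF T] strongly_k_connected_flip[OF con] k t s_def c K, of Xp Xm dp dm])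
        (use Xm Xp False in auto)
    then show ?thesis unfolding flip .
  qed
  then obtain D where D: "\<forall>j\<in>{1..t}. D j \<subseteq> V \<and> m * card (D j) \<le> card V \<and>
      (\<forall>R. R \<subseteq> V - (\<Union>i\<in>{1..t}. D i) \<longrightarrow> strongly_k_connected (D j \<union> R) E k)"
    and Dd: "disjoint_family_on D {1..t}" by (elim exE conjE)
  have "real (card (D j)) \<le> real n / real m" if "j \<in> {1..t}" for j
  proof -
    have "m * card (D j) \<le> n" using bspec[OF D that] assms(2) by simp
    then have "real m * real (card (D j)) \<le> real n" by (metis of_nat_le_iff of_nat_mult)
    then show ?thesis using t by (simp add: field_simps)
  qed
  then show ?thesis
    using D disjoint_family_onD[OF Dd] by (intro exI[of _ D]) simp
qed

end
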